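(* Assume (A1), (A2), (A3), (A4), (A5) of the context. Let $u^*$ be the unique minimiser of $J$ over $\mathcal U_{\mathrm{det}}$, and let $(u^k)_{k\ge0}$ be generated by the projected stochastic gradient scheme $$u^{k+1}=\Pi_{\mathcal U_{\mathrm{det}}}\bigl(u^k-\eta_k\widehat g^{\,k}\bigr)$$ described in the context, with step sizes $$\eta_k=\frac{\eta_0}{k+1},\qquad \eta_0>\frac1\mu .$$ Then, for fixed $(N,h,H)$, there exist constants $C_0,C_1>0$, depending on the constants in the assumptions, on $\eta_0$ and on the initial error, such that for every $K\ge1$ $$\mathbb E\|u^K-u^*\|^2_{\mathcal H_{\mathrm{det}}}\le\frac{C_0(1+V_H(N))}{K}+\frac{C_1(1+V_H(N))}{Kh}.$$
   Context: Noise. Fix $H\in(0,1)$, an integer $N\ge1$, a step size $h>0$, $T=Nh$, $t_n=nh$, and a scalar fractional Brownian motion $B^H$ of Hurst exponent $H$ on a complete probability space $(\Omega,\mathcal F,\mathbb P)$. For $0\le n<N$ put $\xi_n^H=h^{-H}(B^H_{t_{n+1}}-B^H_{t_n})$; these are centred Gaussian with covariance $\rho(i,j)=\tfrac12(|i-j+1|^{2H}+|i-j-1|^{2H}-2|i-j|^{2H})$. The covariance matrix $\Sigma_N=[\rho(i,j)]_{0\le i,j<N}$ is strictly positive definite; $\beta=(\beta(n,k))_{0\le k\le n<N}$ is its unique lower triangular Cholesky factor with $\beta(n,n)>0$, and $\gamma=\beta^{-1}$. The innovations $\sum_{k=0}^n\gamma(n,k)\xi_k^H$, written $\eta_n$ in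 this paragraph only (the step sizes of the scheme are also written $\eta_k$ and are unrelated numbers), are i.i.d. standard normal and $\xi_n^H=\sum_{k=0}^n\beta(n,k)\eta_k$. Let $\mathcal F_n=\sigma(\eta_0,\dots,\eta_{n-1})$, $\mathcal F_0=\{\emptyset,\Omega\}$, and $V_H(N)=\max_{0\le n<N}\sum_{k=0}^{n-1}\beta(n,k)^2=\max_{0\le n<N}(1-\beta(n,n)^2)$. State equation. Let $\mathcal U\subset\mathbb R^p$ be closed, convex, containing the origin, $x_0\in\mathbb R^d$, and $b,\sigma:\{0,\dots,N-1\}\times\mathbb R^d\times\mathbb R^p\to\mathbb R^d$ deterministic. For a control $u=(u_n)$, $X=X^u$ solves $X_{n+1}=X_n+h\,b(n,X_n,u_n)+\sqrt h\,\sigma(n,X_n,u_n)\xi_n^H$, $X_0=x_0$, $0\le n\le N-1$. Cost. $J(u)=\mathbb E\bigl[\Phi(X_N^u)+h\sum_{n=0}^{N-1}\ell(n,X_n^u,u_n)\bigr]$ with $\Phi:\mathbb R^d\to\mathbb R$, $\ell:\{0,\dots,N-1\}\times\mathbb R^d\times\mathbb R^p\to\mathbb R$. Deterministic parameters. $\mathcal H_{\mathrm{det}}=(\mathbb R^p)^N$ with inner product $\langle u,v\rangle_{\mathcal H_{\mathrm{det}}}=h\sum_{n=0}^{N-1}\langle u_n,v_n\rangle$ and norm $\|u\|^2_{\mathcal H_{\mathrm{det}}}=h\sum_n\|u_n\|^2$; $\mathcal U_{\mathrm{det}}=\{u\in\mathcal H_{\mathrm{det}}:u_n\in\mathcal U\text{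 for every }n\}$. $\nabla J$ denotes the gradient of $J:\mathcal H_{\mathrm{det}}\to\mathbb R$ with respect to this inner product. Samplewise gradient. With $A_n=I_d+h\,b_x(n,X_n,u_n)$, $B_n=\sqrt h\,\sigma_x(n,X_n,u_n)$, $\Lambda_n=\ell_x(n,X_n,u_n)$, define pathwise $$\widehat p_N=\Phi_x(X_N),\qquad \widehat p_n=A_n^*\widehat p_{n+1}+B_n^*\widehat p_{n+1}\xi_n^H+h\Lambda_n,\quad n=N-1,\dots,0,$$ $$\widehat g_n=b_u(n,X_n,u_n)^*\widehat p_{n+1}+\ell_u(n,X_n,u_n)+h^{-1/2}\sigma_u(n,X_n,u_n)^*\widehat p_{n+1}\xi_n^H,$$ $\widehat g(u)=(\widehat g_n)_{n=0}^{N-1}$; write $\widehat p_n^u$ to show the dependence on $u$. Subscripts $x,u$ denote partial derivatives, $^*$ the transpose. Algorithm. Choose $u^0\in\mathcal U_{\mathrm{det}}$. At iteration $k\ge0$ draw a fresh independent white noise vector (standard normal in $\mathbb R^N$, independent of the past iterations), reconstruct from it the increments $\xi^{H,(k)}_n$ through $\beta$, let $\widehat g^{\,k}$ be the samplewise gradient $\widehat g(u^k)$ computed along this noise trajectory, and update $u^{k+1}=\Pi_{\mathcal U_{\mathrm{det}}}(u^k-\eta_k\widehat g^{\,k})$, where $\eta_k$ are the step sizes and $\Pi_{\mathcal U_{\mathrm{det}}}$ is the orthogonal projection onto $\mathcal U_{\mathrm{det}}$ in $\mathcal H_{\mathrm{det}}$. Assumptions. (A1) $b,\sigma,\Phi,\ell$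 are twice continuously differentiable in $(x,u)$ and their partial derivatives up to order two are bounded by a constant $L>0$ and globally Lipschitz in $(x,u)$, uniformly in $n$. (A2) There is $L'>0$ with $\|b(n,x,u)\|\le L'(1+\|x\|+\|u\|)$ and $\|\sigma(n,x,u)\|\le L'$ for all $(n,x,u)$. (A3) Adapted controls are sequences $u=(u_n)$ with $u_n\in L^2(\Omega,\mathcal F_n;\mathbb R^p)$, forming the Hilbert space $\mathcal H_{\mathrm{ad}}$ with $\|u\|^2_{\mathcal H_{\mathrm{ad}}}=h\sum_n\mathbb E\|u_n\|^2$, and are admissible if $u_n\in\mathcal U$ a.s. for every $n$. (A4) $J:\mathcal H_{\mathrm{det}}\to\mathbb R$ is Fréchet differentiable and $\mu$-strongly convex on $\mathcal U_{\mathrm{det}}$ (with $\mu>0$): $\langle\nabla J(u)-\nabla J(v),u-v\rangle_{\mathcal H_{\mathrm{det}}}\ge\mu\|u-v\|^2_{\mathcal H_{\mathrm{det}}}$ for all $u,v\in\mathcal U_{\mathrm{det}}$. (A5) There are constants $L_J,M_2,M_4<\infty$ (possibly depending on $(N,h,H)$) such that for all $u,v\in\mathcal U_{\mathrm{det}}$, $\|\nabla J(u)-\nabla J(v)\|_{\mathcal H_{\mathrm{det}}}\le L_J\|u-v\|_{\mathcal H_{\mathrm{det}}}$, and for every $u\in\mathcal U_{\mathrm{det}}$, $\max_{0\le n\le N}\mathbb E\|\widehat p_n^u\|^2\le M_2(1+V_H(N))$ and $\max_{0\le n\le N}\mathbb E\|\widehat p_n^u\|^4\le M_4(1+V_H(N))^2$.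 *)

theory Defs
  imports "HOL-Probability.Probability"
begin

text \<open>A degenerate (almost surely constant) random variable counts as Gaussian.\<close>

definition gaussian_rv :: "'w measure \<Rightarrow> ('w \<Rightarrow> real) \<Rightarrow> bool" where
  "gaussian_rv M X \<longleftrightarrow> X \<in> borel_measurable M \<and>
     ((\<exists>m s. s > 0 \<and> distributed M lborel X (\<lambda>x. ennreal (normal_density m s x))) \<or>
      (\<exists>m. AE \<omega> in M. X \<omega> = m))"

definition gaussian_process :: "'w measure \<Rightarrow> real set \<Rightarrow> (real \<Rightarrow> 'w \<Rightarrow> real) \<Rightarrow> bool" where
  "gaussian_process M T B \<longleftrightarrow>
     (\<forall>F c. finite F \<and> F \<subseteq> T \<longrightarrow> gaussian_rv M (\<lambda>\<omega>. \<Sum>t\<in>F. c t * B t \<omega>))"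

text \<open>Continuity of the sample paths is not required: only the values on a finite time grid matter.\<close>

definition fractional_brownian_motion ::
  "'w measure \<Rightarrow> real \<Rightarrow> (real \<Rightarrow> 'w \<Rightarrow> real) \<Rightarrow> bool" where
  "fractional_brownian_motion M H B \<longleftrightarrow>
     gaussian_process M {0..} B \<and>
     (\<forall>t\<ge>0. (\<integral>\<omega>. B t \<omega> \<partial>M) = 0) \<and>
     (\<forall>s\<ge>0. \<forall>t\<ge>0. (\<integral>\<omega>. B s \<omega> * B t \<omega> \<partial>M) =
        (s powr (2 * H) + t powr (2 * H) - \<bar>t - s\<bar> powr (2 * H)) / 2)"

definition fgn :: "real \<Rightarrow> real \<Rightarrow> (real \<Rightarrow> 'w \<Rightarrow> real) \<Rightarrow> nat \<Rightarrow> 'w \<Rightarrow> real" where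
  "fgn h H B n \<omega> = h powr (- H) * (B (real (n + 1) * h) \<omega> - B (real n * h) \<omega>)"

definition fgn_cov :: "real \<Rightarrow> nat \<Rightarrow> nat \<Rightarrow> real" where
  "fgn_cov H i j = (let r = real i - real j in
     (\<bar>r + 1\<bar> powr (2 * H) + \<bar>r - 1\<bar> powr (2 * H) - 2 * \<bar>r\<bar> powr (2 * H)) / 2)"

text \<open>An \<open>N \<times> N\<close> matrix is a function of two indices of which only the values below \<open>N\<close> are used.\<close>

definition cholesky_factor :: "nat \<Rightarrow> (nat \<Rightarrow> nat \<Rightarrow> real) \<Rightarrow> (nat \<Rightarrow> nat \<Rightarrow> real) \<Rightarrow> bool" where
  "cholesky_factor N S \<beta> \<longleftrightarrow>
     (\<forall>n<N. \<beta> n n > 0) \<and>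
     (\<forall>n<N. \<forall>k<N. n < k \<longrightarrow> \<beta> n k = 0) \<and>
     (\<forall>i<N. \<forall>j<N. (\<Sum>k<N. \<beta> i k * \<beta> j k) = S i j)"

definition V_H :: "nat \<Rightarrow> (nat \<Rightarrow> nat \<Rightarrow> real) \<Rightarrow> real" where
  "V_H N \<beta> = (MAX n\<in>{..<N}. \<Sum>k<n. (\<beta> n k)\<^sup>2)"

definition reconstruct :: "(nat \<Rightarrow> nat \<Rightarrow> real) \<Rightarrow> (nat \<Rightarrow> real) \<Rightarrow> nat \<Rightarrow> real" where
  "reconstruct \<beta> z n = (\<Sum>k\<le>n. \<beta> n k * z k)"

definition deriv_x :: "('x::real_normed_vector \<Rightarrow> 'c::real_normed_vector \<Rightarrow> 'y::real_normed_vector)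
    \<Rightarrow> 'x \<Rightarrow> 'c \<Rightarrow> ('x \<Rightarrow>\<^sub>L 'y)" where
  "deriv_x f x u = Blinfun (frechet_derivative (\<lambda>x'. f x' u) (at x))"

definition deriv_u :: "('x::real_normed_vector \<Rightarrow> 'c::real_normed_vector \<Rightarrow> 'y::real_normed_vector)
    \<Rightarrow> 'x \<Rightarrow> 'c \<Rightarrow> ('c \<Rightarrow>\<^sub>L 'y)" where
  "deriv_u f x u = Blinfun (frechet_derivative (\<lambda>u'. f x u') (at u))"

definition C1 :: "('x::real_normed_vector \<Rightarrow> 'c::real_normed_vector \<Rightarrow> 'y::real_normed_vector)
    \<Rightarrow> bool" where
  "C1 f \<longleftrightarrow> (\<forall>z. (\<lambda>(x, u). f x u) differentiable (at z)) \<and>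
     continuous_on UNIV (\<lambda>(x, u). deriv_x f x u) \<and>
     continuous_on UNIV (\<lambda>(x, u). deriv_u f x u)"

definition C2 :: "('x::real_normed_vector \<Rightarrow> 'c::real_normed_vector \<Rightarrow> 'y::real_normed_vector)
    \<Rightarrow> bool" where
  "C2 f \<longleftrightarrow> C1 f \<and> C1 (deriv_x f) \<and> C1 (deriv_u f)"

definition bounded_lipschitz :: "real \<Rightarrow> real \<Rightarrow>
    ('x::real_normed_vector \<Rightarrow> 'c::real_normed_vector \<Rightarrow> 'y::real_normed_vector) \<Rightarrow> bool" where
  "bounded_lipschitz L K f \<longleftrightarrow>
     (\<forall>x u. norm (f x u) \<le> L) \<and> K-lipschitz_on UNIV (\<lambda>(x, u). f x u)"

text \<open>\<open>f\<close> is twice continuously differentiable and all its partial derivatives of orders one and two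
  are bounded by \<open>L\<close> in operator norm and \<open>K\<close>-Lipschitz; \<open>f\<close> itself need not be bounded.\<close>

definition smooth_coeff :: "real \<Rightarrow> real \<Rightarrow>
    ('x::real_normed_vector \<Rightarrow> 'c::real_normed_vector \<Rightarrow> 'y::real_normed_vector) \<Rightarrow> bool" where
  "smooth_coeff L K f \<longleftrightarrow> C2 f \<and>
     bounded_lipschitz L K (deriv_x f) \<and> bounded_lipschitz L K (deriv_u f) \<and>
     bounded_lipschitz L K (deriv_x (deriv_x f)) \<and> bounded_lipschitz L K (deriv_u (deriv_x f)) \<and>
     bounded_lipschitz L K (deriv_x (deriv_u f)) \<and> bounded_lipschitz L K (deriv_u (deriv_u f))"

record ('x, 'c) control_problem =
  drift :: "nat \<Rightarrow> 'x \<Rightarrow> 'c \<Rightarrow> 'x"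
  diffusion :: "nat \<Rightarrow> 'x \<Rightarrow> 'c \<Rightarrow> 'x"
  terminal_cost :: "'x \<Rightarrow> real"
  running_cost :: "nat \<Rightarrow> 'x \<Rightarrow> 'c \<Rightarrow> real"
  init_state :: 'x
  control_set :: "'c set"

definition smooth_problem :: "nat \<Rightarrow> real \<Rightarrow>
    ('x::euclidean_space, 'c::euclidean_space) control_problem \<Rightarrow> bool" where
  "smooth_problem N L P \<longleftrightarrow> (\<exists>K.
     (\<forall>n<N. smooth_coeff L K (drift P n) \<and> smooth_coeff L K (diffusion P n) \<and>
        smooth_coeff L K (running_cost P n)) \<and>
     smooth_coeff L K (\<lambda>x (u::'c). terminal_cost P x))"

definition growth_bounds :: "nat \<Rightarrow> real \<Rightarrow>
    ('x::euclidean_space, 'c::euclidean_space) control_problem \<Rightarrow> bool" where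
  "growth_bounds N L' P \<longleftrightarrow> (\<forall>n<N. \<forall>x u.
     norm (drift P n x u) \<le> L' * (1 + norm x + norm u) \<and> norm (diffusion P n x u) \<le> L')"

primrec state :: "real \<Rightarrow> ('x::euclidean_space, 'c::euclidean_space) control_problem
    \<Rightarrow> (nat \<Rightarrow> real) \<Rightarrow> (nat \<Rightarrow> 'c) \<Rightarrow> nat \<Rightarrow> 'x" where
  "state h P \<xi> u 0 = init_state P"
| "state h P \<xi> u (Suc n) = state h P \<xi> u n
     + h *\<^sub>R drift P n (state h P \<xi> u n) (u n)
     + (sqrt h * \<xi> n) *\<^sub>R diffusion P n (state h P \<xi> u n) (u n)"

definition cost :: "nat \<Rightarrow> real \<Rightarrow> ('x::euclidean_space, 'c::euclidean_space) control_problem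
    \<Rightarrow> 'w measure \<Rightarrow> (nat \<Rightarrow> 'w \<Rightarrow> real) \<Rightarrow> (nat \<Rightarrow> 'w \<Rightarrow> 'c) \<Rightarrow> real" where
  "cost N h P M \<xi> u = (\<integral>\<omega>. (let X = state h P (\<lambda>n. \<xi> n \<omega>) (\<lambda>n. u n \<omega>) in
     terminal_cost P (X N) + h * (\<Sum>n<N. running_cost P n (X n) (u n \<omega>))) \<partial>M)"

text \<open>\<open>\<gamma>\<close> is the inverse of the Cholesky factor, hence lower triangular.  Adaptedness is measurability
  with respect to the innovations strictly before \<open>n\<close>; deterministic controls are the constant
  admissible ones, whatever \<open>\<gamma>\<close> is, which is why it plays no role for the deterministic scheme.\<close>

definition innovation :: "(nat \<Rightarrow> nat \<Rightarrow> real) \<Rightarrow> (nat \<Rightarrow> 'w \<Rightarrow> real) \<Rightarrow> nat \<Rightarrow> 'w \<Rightarrow> real" where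
  "innovation \<gamma> \<xi> n \<omega> = (\<Sum>k\<le>n. \<gamma> n k * \<xi> k \<omega>)"

definition history :: "'w measure \<Rightarrow> (nat \<Rightarrow> 'w \<Rightarrow> real) \<Rightarrow> nat \<Rightarrow> 'w measure" where
  "history M \<epsilon> n = sigma (space M) {\<epsilon> k -` A \<inter> space M | k A. k < n \<and> A \<in> sets borel}"

definition adapted_controls :: "nat \<Rightarrow> 'w measure \<Rightarrow> (nat \<Rightarrow> 'w measure)
    \<Rightarrow> (nat \<Rightarrow> 'w \<Rightarrow> 'c::euclidean_space) set" where
  "adapted_controls N M F = {u. \<forall>n<N. u n \<in> borel_measurable (F n) \<and>
     integrable M (\<lambda>\<omega>. (norm (u n \<omega>))\<^sup>2)}"

definition admissible_controls :: "nat \<Rightarrow> 'w measure \<Rightarrow> (nat \<Rightarrow> 'w measure) \<Rightarrow> 'c set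
    \<Rightarrow> (nat \<Rightarrow> 'w \<Rightarrow> 'c::euclidean_space) set" where
  "admissible_controls N M F U =
     {u \<in> adapted_controls N M F. \<forall>n<N. AE \<omega> in M. u n \<omega> \<in> U}"

text \<open>The space of \<open>N\<close>-tuples of vectors is represented by the sequences that vanish from index \<open>N\<close>
  on.  Its inner product carries the weight \<open>h\<close>, so gradient and projection are defined with respect
  to it explicitly.\<close>

definition Hdet :: "nat \<Rightarrow> (nat \<Rightarrow> 'c::euclidean_space) set" where
  "Hdet N = {u. \<forall>n\<ge>N. u n = 0}"

definition Udet :: "nat \<Rightarrow> 'c set \<Rightarrow> (nat \<Rightarrow> 'c::euclidean_space) set" where
  "Udet N U = {u \<in> Hdet N. \<forall>n<N. u n \<in> U}"

definition hinner :: "nat \<Rightarrow> real \<Rightarrow> (nat \<Rightarrow> 'c::euclidean_space) \<Rightarrow> (nat \<Rightarrow> 'c) \<Rightarrow> real" where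
  "hinner N h u v = h * (\<Sum>n<N. u n \<bullet> v n)"

definition hnorm :: "nat \<Rightarrow> real \<Rightarrow> (nat \<Rightarrow> 'c::euclidean_space) \<Rightarrow> real" where
  "hnorm N h u = sqrt (hinner N h u u)"

definition hproj :: "nat \<Rightarrow> real \<Rightarrow> 'c set \<Rightarrow> (nat \<Rightarrow> 'c::euclidean_space) \<Rightarrow> (nat \<Rightarrow> 'c)" where
  "hproj N h U w = (THE v. v \<in> Udet N U \<and>
     (\<forall>z\<in>Udet N U. hnorm N h (\<lambda>n. w n - v n) \<le> hnorm N h (\<lambda>n. w n - z n)))"

definition has_hgradient :: "nat \<Rightarrow> real \<Rightarrow> ((nat \<Rightarrow> 'c::euclidean_space) \<Rightarrow> real)
    \<Rightarrow> (nat \<Rightarrow> 'c) \<Rightarrow> (nat \<Rightarrow> 'c) \<Rightarrow> bool" where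
  "has_hgradient N h J u G \<longleftrightarrow> G \<in> Hdet N \<and>
     (\<forall>\<epsilon>>0. \<exists>\<delta>>0. \<forall>v\<in>Hdet N. hnorm N h v < \<delta> \<longrightarrow>
        \<bar>J (\<lambda>n. u n + v n) - J u - hinner N h G v\<bar> \<le> \<epsilon> * hnorm N h v)"

definition hgradient :: "nat \<Rightarrow> real \<Rightarrow> ((nat \<Rightarrow> 'c::euclidean_space) \<Rightarrow> real)
    \<Rightarrow> (nat \<Rightarrow> 'c) \<Rightarrow> (nat \<Rightarrow> 'c)" where
  "hgradient N h J u = (THE G. has_hgradient N h J u G)"

definition det_cost :: "nat \<Rightarrow> real \<Rightarrow> ('x::euclidean_space, 'c::euclidean_space) control_problem
    \<Rightarrow> 'w measure \<Rightarrow> (nat \<Rightarrow> 'w \<Rightarrow> real) \<Rightarrow> (nat \<Rightarrow> 'c) \<Rightarrow> real" where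
  "det_cost N h P M \<xi> u = cost N h P M \<xi> (\<lambda>n \<omega>. u n)"

lemma deterministic_admissible:
  assumes "prob_space M" and "u \<in> Udet N U"
  shows "(\<lambda>n \<omega>. u n) \<in> admissible_controls N M (history M (innovation \<gamma> \<xi>)) U"
proof -
  interpret prob_space M by fact
  show ?thesis
    using assms(2) by (auto simp: admissible_controls_def adapted_controls_def Udet_def)
qed

definition strongly_convex_cost :: "nat \<Rightarrow> real \<Rightarrow> 'c set \<Rightarrow> real
    \<Rightarrow> ((nat \<Rightarrow> 'c::euclidean_space) \<Rightarrow> real) \<Rightarrow> bool" where
  "strongly_convex_cost N h U \<mu> J \<longleftrightarrow>
     (\<forall>u\<in>Hdet N. \<exists>G. has_hgradient N h J u G) \<and>
     (\<forall>u\<in>Udet N U. \<forall>v\<in>Udet N U.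
        hinner N h (\<lambda>n. hgradient N h J u n - hgradient N h J v n) (\<lambda>n. u n - v n)
          \<ge> \<mu> * (hnorm N h (\<lambda>n. u n - v n))\<^sup>2)"

text \<open>\<open>adjoint_back \<dots> j\<close> is the adjoint variable at time \<open>N - j\<close>.  For a real-valued map with
  derivative \<open>D\<close>, the vector \<open>adjoint D 1\<close> is its gradient.\<close>

primrec adjoint_back :: "nat \<Rightarrow> real \<Rightarrow> ('x::euclidean_space, 'c::euclidean_space) control_problem
    \<Rightarrow> (nat \<Rightarrow> real) \<Rightarrow> (nat \<Rightarrow> 'c) \<Rightarrow> nat \<Rightarrow> 'x" where
  "adjoint_back N h P \<xi> u 0 =
     adjoint (frechet_derivative (terminal_cost P) (at (state h P \<xi> u N))) 1"
| "adjoint_back N h P \<xi> u (Suc j) =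
     (let n = N - Suc j; X = state h P \<xi> u n; p = adjoint_back N h P \<xi> u j;
          A = (\<lambda>y. y + h *\<^sub>R deriv_x (drift P n) X (u n) y);
          B = (\<lambda>y. sqrt h *\<^sub>R deriv_x (diffusion P n) X (u n) y);
          \<Lambda> = adjoint (deriv_x (running_cost P n) X (u n)) 1
      in adjoint A p + \<xi> n *\<^sub>R adjoint B p + h *\<^sub>R \<Lambda>)"

definition phat :: "nat \<Rightarrow> real \<Rightarrow> ('x::euclidean_space, 'c::euclidean_space) control_problem
    \<Rightarrow> (nat \<Rightarrow> real) \<Rightarrow> (nat \<Rightarrow> 'c) \<Rightarrow> nat \<Rightarrow> 'x" where
  "phat N h P \<xi> u n = adjoint_back N h P \<xi> u (N - n)"

definition ghat :: "nat \<Rightarrow> real \<Rightarrow> ('x::euclidean_space, 'c::euclidean_space) control_problem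
    \<Rightarrow> (nat \<Rightarrow> real) \<Rightarrow> (nat \<Rightarrow> 'c) \<Rightarrow> nat \<Rightarrow> 'c" where
  "ghat N h P \<xi> u n = (if n < N then
     let X = state h P \<xi> u n; p = phat N h P \<xi> u (Suc n) in
       adjoint (deriv_u (drift P n) X (u n)) p
       + adjoint (deriv_u (running_cost P n) X (u n)) 1
       + (h powr (-1/2) * \<xi> n) *\<^sub>R adjoint (deriv_u (diffusion P n) X (u n)) p
     else 0)"

definition gradient_bounds :: "nat \<Rightarrow> real \<Rightarrow>
    ('x::euclidean_space, 'c::euclidean_space) control_problem \<Rightarrow> 'w measure \<Rightarrow>
    (nat \<Rightarrow> 'w \<Rightarrow> real) \<Rightarrow> real \<Rightarrow> real \<Rightarrow> real \<Rightarrow> real \<Rightarrow> bool" where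
  "gradient_bounds N h P M \<xi> V L\<^sub>J M\<^sub>2 M\<^sub>4 \<longleftrightarrow>
     (let U = control_set P; grad = hgradient N h (det_cost N h P M \<xi>);
          p = (\<lambda>u n \<omega>. phat N h P (\<lambda>i. \<xi> i \<omega>) u n) in
     (\<forall>u\<in>Udet N U. \<forall>v\<in>Udet N U.
        hnorm N h (\<lambda>n. grad u n - grad v n) \<le> L\<^sub>J * hnorm N h (\<lambda>n. u n - v n)) \<and>
     (\<forall>u\<in>Udet N U. \<forall>n\<le>N.
        integrable M (\<lambda>\<omega>. norm (p u n \<omega>) ^ 2) \<and>
        (\<integral>\<omega>. norm (p u n \<omega>) ^ 2 \<partial>M) \<le> M\<^sub>2 * (1 + V)) \<and>
     (\<forall>u\<in>Udet N U. \<forall>n\<le>N.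
        integrable M (\<lambda>\<omega>. norm (p u n \<omega>) ^ 4) \<and>
        (\<integral>\<omega>. norm (p u n \<omega>) ^ 4 \<partial>M) \<le> M\<^sub>4 * (1 + V)\<^sup>2))"

text \<open>\<open>Z k n\<close> is the \<open>n\<close>-th coordinate of the white noise vector drawn at iteration \<open>k\<close>.\<close>

definition white_noise :: "'s measure \<Rightarrow> nat \<Rightarrow> (nat \<Rightarrow> nat \<Rightarrow> 's \<Rightarrow> real) \<Rightarrow> bool" where
  "white_noise S N Z \<longleftrightarrow>
     prob_space.indep_vars S (\<lambda>_. borel) (\<lambda>(k, n). Z k n) (UNIV \<times> {..<N}) \<and>
     (\<forall>k. \<forall>n<N. distributed S lborel (Z k n) (\<lambda>x. ennreal (std_normal_density x)))"

primrec sgd :: "nat \<Rightarrow> real \<Rightarrow> ('x::euclidean_space, 'c::euclidean_space) control_problem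
    \<Rightarrow> (nat \<Rightarrow> nat \<Rightarrow> real) \<Rightarrow> (nat \<Rightarrow> nat \<Rightarrow> 's \<Rightarrow> real) \<Rightarrow> (nat \<Rightarrow> real) \<Rightarrow> (nat \<Rightarrow> 'c)
    \<Rightarrow> nat \<Rightarrow> 's \<Rightarrow> nat \<Rightarrow> 'c" where
  "sgd N h P \<beta> Z step u0 0 \<omega> = u0"
| "sgd N h P \<beta> Z step u0 (Suc k) \<omega> =
     (let u = sgd N h P \<beta> Z step u0 k \<omega>; \<xi> = reconstruct \<beta> (\<lambda>n. Z k n \<omega>) in
      hproj N h (control_set P) (\<lambda>n. u n - step k *\<^sub>R ghat N h P \<xi> u n))"

end

theory Submission
  imports Defs
begin

text \<open>
  The projection onto the admissible set is nonexpansive, so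
  \<open>\<parallel>e\<^sub>k\<^sub>+\<^sub>1\<parallel>\<^sup>2 \<le> \<parallel>e\<^sub>k\<parallel>\<^sup>2 - 2 \<eta>\<^sub>k \<langle>g\<^sub>k, e\<^sub>k\<rangle> + \<eta>\<^sub>k\<^sup>2 \<parallel>g\<^sub>k\<parallel>\<^sup>2\<close> for the errors \<open>e\<^sub>k = u\<^sup>k - u\<^sup>*\<close>.
  Since the noise of iteration \<open>k\<close> is independent of \<open>u\<^sup>k\<close> and has the law of fractional Gaussian
  noise, Fubini reduces both expectations to a fixed control.  There the samplewise gradient is an
  unbiased estimator of the gradient of the cost (pathwise duality between the tangent process and
  the adjoint, then dominated convergence), so strong convexity and the first-order optimality of
  \<open>u\<^sup>*\<close> bound the cross term below by \<open>\<mu> E\<parallel>e\<^sub>k\<parallel>\<^sup>2\<close>; and the moment bounds on the adjoint give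
  \<open>E\<parallel>g\<^sub>k\<parallel>\<^sup>2 \<le> G (1 + V)\<close>.  With \<open>\<mu> \<eta>\<^sub>0 \<ge> 1\<close> the resulting recursion
  \<open>a\<^sub>k\<^sub>+\<^sub>1 \<le> (1 - 2 / (k + 1)) a\<^sub>k + D / (k + 1)\<^sup>2\<close> forces \<open>a\<^sub>K \<le> D / K\<close>; its first step discards
  \<open>a\<^sub>0\<close>, so the constants do not involve the initial error.
\<close>

section \<open>Characteristic functions of random vectors\<close>

text \<open>The samplewise gradient contains the product of \<open>\<xi> n\<close> with the adjoint
  at time \<open>n + 1\<close>. The two are in general dependent, since that adjoint is built from
  states which \<open>\<xi> n\<close> has already driven. The second moment of the product cannot be
  factored; a weighted Young inequality splits it into fourth moments, which is where the
  fourth-moment bound of (A5) and the Gaussian value 3 enter. Squaring the factor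
  \<open>h powr (-1/2)\<close> in front of the product yields the extra 1 / h that separates the two
  terms of the final bound. That reconstructed and fractional noise have the same law is read off
  their common characteristic function exp (- t^T Sigma t / 2), which requires the uniqueness
  theorem for vectors; it is derived from the one-dimensional one. The Bochner integral of a
  non-integrable function is 0, so every moment bound has to travel with an integrability statement;
  along the iterations both are carried together. The bounds for a fixed control are uniform over
  the admissible set, and the projection keeps every iterate inside it, so they apply conditionally
  on the past.\<close>

lemma finite_measure_cf_unique:
  fixes M1 M2 :: "real measure"
  assumes "finite_measure M1" "finite_measure M2"
    and [simp, measurable_cong]: "sets M1 = sets borel" "sets M2 = sets borel"
    and cf: "\<And>t. (\<integral>x. iexp (t * x) \<partial>M1) = (\<integral>x. iexp (t * x) \<partial>M2)"
  shows "M1 = M2"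
proof -
  interpret M1: finite_measure M1 by fact
  interpret M2: finite_measure M2 by fact
  have sp: "space M1 = UNIV" "space M2 = UNIV"
    using sets_eq_imp_space_eq[OF assms(3)] sets_eq_imp_space_eq[OF assms(4)] by simp_all
  \<comment> \<open>Frequency 0 shows that the total masses agree. If the common mass vanishes, so
    do both measures; otherwise division by it leads to Levy's theorem for probability
    measures.\<close>
  define c where "c = measure M1 UNIV"
  have c2: "c = measure M2 UNIV"
    using cf[of 0] sp by (simp add: c_def)
  show ?thesis
  proof (cases "c = 0")
    case True
    have "emeasure M1 A = emeasure M2 A" for A
    proof -
      have "emeasure M1 A \<le> emeasure M1 (space M1)" "emeasure M2 A \<le> emeasure M2 (space M2)"
        using emeasure_space by auto
      then show ?thesis
        using True c2 sp by (simp add: c_def M1.emeasure_eq_measure M2.emeasure_eq_measure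
            measure_le_0_iff)
    qed
    then show ?thesis by (intro measure_eqI) simp_all
  next
    case False
    then have c: "c > 0" by (simp add: c_def less_le)
    define N1 where "N1 = density M1 (\<lambda>_. ennreal (1 / c))"
    define N2 where "N2 = density M2 (\<lambda>_. ennreal (1 / c))"
    have s[simp]: "sets N1 = sets borel" "sets N2 = sets borel" "space N1 = UNIV" "space N2 = UNIV"
      by (simp_all add: N1_def N2_def sp)
    have "prob_space N1"
      using c by (intro prob_spaceI)
        (simp add: N1_def emeasure_density sp M1.emeasure_eq_measure c_def flip: ennreal_mult'')
    moreover have "prob_space N2"
      using c by (intro prob_spaceI)
        (simp add: N2_def emeasure_density sp M2.emeasure_eq_measure c2 flip: ennreal_mult'')
    moreover have "char N1 = char N2"
    proof
      fix t
      show "char N1 t = char N2 t"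
        using c cf[of t] by (simp add: N1_def N2_def char_def integral_density del: of_real_mult)
    qed
    ultimately have "N1 = N2"
      by (intro Levy_uniqueness) (simp_all add: real_distribution_def real_distribution_axioms_def)
    show ?thesis
    proof (rule measure_eqI)
      fix A assume A: "A \<in> sets M1"
      have "emeasure N1 A = emeasure N2 A" by (simp add: \<open>N1 = N2\<close>)
      then show "emeasure M1 A = emeasure M2 A"
        using A c by (simp add: N1_def N2_def emeasure_density nn_integral_cmult_indicator
            M1.emeasure_eq_measure M2.emeasure_eq_measure flip: ennreal_mult'')
    qed simp
  qed
qed

lemma (in finite_measure) integrable_bounded:
  fixes f :: "'a \<Rightarrow> 'b::{banach, second_countable_topology}"
  assumes "f \<in> borel_measurable M" "\<And>x. norm (f x) \<le> B"
  shows "integrable M f"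
  using assms by (intro integrable_const_bound[of _ B]) auto

lemma borel_measurable_iexp:
  "f \<in> borel_measurable M \<Longrightarrow> (\<lambda>x. iexp (f x)) \<in> borel_measurable M" for f :: "'a \<Rightarrow> real"
  by measurable

text \<open>
  Reduces the joint characteristic function, one coordinate at a time, to the one-dimensional
  uniqueness theorem: weighting a law by \<open>1 + cos (S + c) \<ge> 0\<close> with a linear form \<open>S\<close> in the other
  coordinates keeps it a finite measure, and its characteristic function is a combination of joint ones.
\<close>

lemma cos_as_iexp:
  "complex_of_real (cos (s + c)) * iexp r
    = (iexp c / 2) * iexp (s + r) + (iexp (- c) / 2) * iexp (- s + r)"
proof -
  have "complex_of_real (cos (s + c)) = (iexp (s + c) + iexp (- (s + c))) / 2"
    by (simp add: cos_of_real[symmetric] cos_exp_eq algebra_simps del: cos_of_real)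
  moreover have "iexp c * iexp (s + r) = iexp (s + c) * iexp r"
    "iexp (- c) * iexp (- s + r) = iexp (- (s + c)) * iexp r"
    by (simp_all add: algebra_simps flip: exp_add)
  ultimately show ?thesis by (simp add: algebra_simps add_divide_distrib)
qed

definition phase_weight :: "nat \<Rightarrow> (nat \<Rightarrow> real) \<Rightarrow> real \<Rightarrow> (nat \<Rightarrow> 'a \<Rightarrow> real) \<Rightarrow> 'a \<Rightarrow> real" where
  "phase_weight n t c X \<omega> = 1 + cos ((\<Sum>i<n. t i * X i \<omega>) + c)"

lemma phase_weight_bounds: "0 \<le> phase_weight n t c X \<omega>" "phase_weight n t c X \<omega> \<le> 2"
  using cos_ge_minus_one[of "(\<Sum>i<n. t i * X i \<omega>) + c"] cos_le_one[of "(\<Sum>i<n. t i * X i \<omega>) + c"]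
  unfolding phase_weight_def by linarith+

lemma borel_measurable_phase_weight:
  assumes "\<And>i. i < n \<Longrightarrow> X i \<in> borel_measurable M"
  shows "phase_weight n t c X \<in> borel_measurable M"
proof -
  have [measurable]: "(\<lambda>\<omega>. \<Sum>i<n. t i * X i \<omega>) \<in> borel_measurable M"
    using assms by (intro borel_measurable_sum) simp
  show ?thesis unfolding phase_weight_def by measurable
qed

context finite_measure
begin

text \<open>Writing the cosine as half the sum of two exponentials splits the weight into a constant
  and two opposite phases. Hence the three frequency vectors: 0, \<open>t\<close> and
  \<open>- t\<close> on the first \<open>n\<close> coordinates, each with \<open>r\<close> at
  position \<open>n\<close>.\<close>

lemma
  fixes X :: "nat \<Rightarrow> 'a \<Rightarrow> real" and t :: "nat \<Rightarrow> real" and c r :: real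
  assumes X: "\<And>i. i \<le> n \<Longrightarrow> X i \<in> borel_measurable M"
  defines "W \<equiv> distr (density M (\<lambda>\<omega>. ennreal (phase_weight n t c X \<omega>))) borel (X n)"
  shows finite_measure_phase_marginal: "finite_measure W"
    and phase_marginal_cf: "(\<integral>x. iexp (r * x) \<partial>W) =
      (\<integral>\<omega>. iexp (\<Sum>i<Suc n. ((\<lambda>_. 0)(n := r)) i * X i \<omega>) \<partial>M)
      + iexp c / 2 * (\<integral>\<omega>. iexp (\<Sum>i<Suc n. (t(n := r)) i * X i \<omega>) \<partial>M)
      + iexp (- c) / 2 * (\<integral>\<omega>. iexp (\<Sum>i<Suc n. ((- t)(n := r)) i * X i \<omega>) \<partial>M)"
    and measure_phase_marginal: "A \<in> sets borel \<Longrightarrow>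
      measure W A = (\<integral>\<omega>. indicator A (X n \<omega>) * phase_weight n t c X \<omega> \<partial>M)"
proof -
  let ?w = "phase_weight n t c X"
  have Xn[measurable]: "X n \<in> borel_measurable M" using X by simp
  have w[measurable]: "?w \<in> borel_measurable M"
    using X by (intro borel_measurable_phase_weight) simp
  have sum[measurable]: "(\<lambda>\<omega>. \<Sum>i<Suc n. s i * X i \<omega>) \<in> borel_measurable M" for s
    using X by (intro borel_measurable_sum) simp
  have eW: "emeasure W A = ennreal (\<integral>\<omega>. indicator A (X n \<omega>) * ?w \<omega> \<partial>M)"
    if [measurable]: "A \<in> sets borel" for A
  proof -
    have "emeasure W A = (\<integral>\<^sup>+\<omega>. ennreal (?w \<omega>) * indicator (X n -` A \<inter> space M) \<omega> \<partial>M)"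
      by (simp add: W_def emeasure_distr emeasure_density)
    also have "\<dots> = (\<integral>\<^sup>+\<omega>. ennreal (indicator A (X n \<omega>) * ?w \<omega>) \<partial>M)"
      by (intro nn_integral_cong) (simp add: indicator_def)
    also have "\<dots> = ennreal (\<integral>\<omega>. indicator A (X n \<omega>) * ?w \<omega> \<partial>M)"
      using phase_weight_bounds[of n t c X]
      by (intro nn_integral_eq_integral integrable_bounded[of _ 2])
        (auto simp: indicator_def)
    finally show ?thesis .
  qed
  show "finite_measure W"
    using eW[of UNIV] by (intro finite_measureI) (simp add: W_def)
  show "measure W A = (\<integral>\<omega>. indicator A (X n \<omega>) * ?w \<omega> \<partial>M)" if "A \<in> sets borel"
    using phase_weight_bounds[of n t c X] eW[OF that]
    by (simp add: measure_def integral_nonneg_AE)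
  let ?e = "\<lambda>s \<omega>. iexp (\<Sum>i<Suc n. s i * X i \<omega>)"
  have int: "integrable M (?e s)" for s
    using borel_measurable_iexp[OF sum[of s]]
    by (intro integrable_bounded[of _ 1]) (simp_all del: of_real_sum sum.lessThan_Suc)
  have "(\<integral>x. iexp (r * x) \<partial>W) = (\<integral>\<omega>. of_real (?w \<omega>) * iexp (r * X n \<omega>) \<partial>M)"
    using phase_weight_bounds[of n t c X]
    by (simp add: W_def integral_distr integral_density scaleR_conv_of_real)
  also have "\<dots> = (\<integral>\<omega>. ?e ((\<lambda>_. 0)(n := r)) \<omega> + (iexp c / 2 * ?e (t(n := r)) \<omega>
      + iexp (- c) / 2 * ?e ((- t)(n := r)) \<omega>) \<partial>M)"
  proof (rule Bochner_Integration.integral_cong[OF refl])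
    fix \<omega>
    have "(\<Sum>i<n. (t(n := r)) i * X i \<omega>) = (\<Sum>i<n. t i * X i \<omega>)"
      "(\<Sum>i<n. ((- t)(n := r)) i * X i \<omega>) = - (\<Sum>i<n. t i * X i \<omega>)"
      "(\<Sum>i<n. ((\<lambda>_. 0)(n := r)) i * X i \<omega>) = 0"
      by (auto simp: sum_negf[symmetric] intro!: sum.cong)
    then show "of_real (?w \<omega>) * iexp (r * X n \<omega>) = ?e ((\<lambda>_. 0)(n := r)) \<omega> + (iexp c / 2 * ?e (t(n := r)) \<omega>
        + iexp (- c) / 2 * ?e ((- t)(n := r)) \<omega>)"
      using cos_as_iexp[of "\<Sum>i<n. t i * X i \<omega>" c "r * X n \<omega>"]
      by (simp add: phase_weight_def distrib_right del: of_real_sum)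
  qed
  also have "\<dots> = (\<integral>\<omega>. ?e ((\<lambda>_. 0)(n := r)) \<omega> \<partial>M) + (iexp c / 2 * (\<integral>\<omega>. ?e (t(n := r)) \<omega> \<partial>M)
      + iexp (- c) / 2 * (\<integral>\<omega>. ?e ((- t)(n := r)) \<omega> \<partial>M))"
    using int by (simp del: sum.lessThan_Suc of_real_sum)
  finally show "(\<integral>x. iexp (r * x) \<partial>W) = (\<integral>\<omega>. ?e ((\<lambda>_. 0)(n := r)) \<omega> \<partial>M) + iexp c / 2 * (\<integral>\<omega>. ?e (t(n := r)) \<omega> \<partial>M)
      + iexp (- c) / 2 * (\<integral>\<omega>. ?e ((- t)(n := r)) \<omega> \<partial>M)" by (simp only: add.assoc)
qed

end

text \<open>The weighted laws of the last coordinate are finite measures on the line whose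
  characteristic functions are the same combination of joint ones, so the one-dimensional theorem
  identifies them.\<close>

lemma phase_marginal_unique:
  fixes X :: "nat \<Rightarrow> 'a \<Rightarrow> real" and Y :: "nat \<Rightarrow> 'b \<Rightarrow> real"
  assumes fin: "finite_measure M1" "finite_measure M2"
    and X: "\<And>i. i \<le> n \<Longrightarrow> X i \<in> borel_measurable M1"
    and Y: "\<And>i. i \<le> n \<Longrightarrow> Y i \<in> borel_measurable M2"
    and cf: "\<And>t. (\<integral>\<omega>. iexp (\<Sum>i<Suc n. t i * X i \<omega>) \<partial>M1)
               = (\<integral>\<omega>. iexp (\<Sum>i<Suc n. t i * Y i \<omega>) \<partial>M2)"
    and A: "A \<in> sets borel"
  shows "(\<integral>\<omega>. indicator A (X n \<omega>) * phase_weight n t c X \<omega> \<partial>M1)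
       = (\<integral>\<omega>. indicator A (Y n \<omega>) * phase_weight n t c Y \<omega> \<partial>M2)"
proof -
  have "distr (density M1 (\<lambda>\<omega>. ennreal (phase_weight n t c X \<omega>))) borel (X n)
      = distr (density M2 (\<lambda>\<omega>. ennreal (phase_weight n t c Y \<omega>))) borel (Y n)"
  proof (rule finite_measure_cf_unique)
    fix r
    show "(\<integral>x. iexp (r * x) \<partial>distr (density M1 (\<lambda>\<omega>. ennreal (phase_weight n t c X \<omega>))) borel (X n))
      = (\<integral>x. iexp (r * x) \<partial>distr (density M2 (\<lambda>\<omega>. ennreal (phase_weight n t c Y \<omega>))) borel (Y n))"
      by (subst finite_measure.phase_marginal_cf[OF fin(1)], fact X,
          subst finite_measure.phase_marginal_cf[OF fin(2)], fact Y, simp only: cf)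
  qed (use X Y fin in \<open>auto intro!: finite_measure.finite_measure_phase_marginal\<close>)
  moreover note finite_measure.measure_phase_marginal[where M = M1 and n = n and X = X and t = t and c = c, OF fin(1) _ A]
    finite_measure.measure_phase_marginal[where M = M2 and n = n and X = Y and t = t and c = c, OF fin(2) _ A]
  ultimately show ?thesis using X Y by simp
qed

text \<open>Recovers the complex exponential from the real weights. Phase 0 gives 1 + cos S and
  phase - pi / 2 gives 1 + sin S; zero frequencies with phase pi / 2 make the weight identically 1,
  which is then subtracted.\<close>

lemma phase_marginal_iexp:
  fixes X :: "nat \<Rightarrow> 'a \<Rightarrow> real" and t :: "nat \<Rightarrow> real"
  assumes fin: "finite_measure M"
    and X: "\<And>i. i \<le> n \<Longrightarrow> X i \<in> borel_measurable M" and A[measurable]: "A \<in> sets borel"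
  defines "w \<equiv> \<lambda>t c. (\<integral>\<omega>. indicator A (X n \<omega>) * phase_weight n t c X \<omega> \<partial>M)"
  shows "(\<integral>\<omega>. indicator A (X n \<omega>) *\<^sub>R iexp (\<Sum>i<n. t i * X i \<omega>) \<partial>M)
    = of_real (w t 0 - w (\<lambda>_. 0) (pi / 2)) + \<i> * of_real (w t (- pi / 2) - w (\<lambda>_. 0) (pi / 2))"
proof -
  interpret finite_measure M by fact
  have Xn[measurable]: "X n \<in> borel_measurable M" using X by simp
  have [measurable]: "phase_weight n t c X \<in> borel_measurable M" for t c
    using X by (intro borel_measurable_phase_weight) simp
  let ?f = "\<lambda>t c \<omega>. indicator A (X n \<omega>) * phase_weight n t c X \<omega>"
  have int: "integrable M (?f t c)" for t c
    using phase_weight_bounds[of n t c X]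
    by (intro integrable_bounded[of _ 2]) (auto simp: indicator_def)
  have "(\<integral>\<omega>. indicator A (X n \<omega>) *\<^sub>R iexp (\<Sum>i<n. t i * X i \<omega>) \<partial>M)
      = (\<integral>\<omega>. of_real (?f t 0 \<omega> - ?f (\<lambda>_. 0) (pi / 2) \<omega>)
        + \<i> * of_real (?f t (- pi / 2) \<omega> - ?f (\<lambda>_. 0) (pi / 2) \<omega>) \<partial>M)"
  proof (rule Bochner_Integration.integral_cong[OF refl])
    fix \<omega>
    show "indicator A (X n \<omega>) *\<^sub>R iexp (\<Sum>i<n. t i * X i \<omega>)
        = of_real (?f t 0 \<omega> - ?f (\<lambda>_. 0) (pi / 2) \<omega>)
        + \<i> * of_real (?f t (- pi / 2) \<omega> - ?f (\<lambda>_. 0) (pi / 2) \<omega>)"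
      by (simp add: indicator_def phase_weight_def complex_eq_iff Re_exp Im_exp cos_diff
          del: of_real_sum)
  qed
  also have "\<dots> = of_real (w t 0 - w (\<lambda>_. 0) (pi / 2)) + \<i> * of_real (w t (- pi / 2) - w (\<lambda>_. 0) (pi / 2))"
    unfolding w_def using int[of t 0] int[of t "- pi / 2"] int[of "\<lambda>_. 0" "pi / 2"]
    by (simp del: of_real_mult of_real_diff)
  finally show ?thesis .
qed

lemma sets_Collect_box:
  fixes X :: "nat \<Rightarrow> 'a \<Rightarrow> real"
  assumes "\<And>i. i < n \<Longrightarrow> X i \<in> borel_measurable M" "\<And>i. i < n \<Longrightarrow> A i \<in> sets borel"
  shows "{\<omega> \<in> space M. \<forall>i<n. X i \<omega> \<in> A i} \<in> sets M"
proof -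
  have "{\<omega> \<in> space M. \<forall>i\<in>{..<n}. X i \<omega> \<in> A i} \<in> sets M"
  proof (rule sets.sets_Collect_finite_All)
    fix i assume "i \<in> {..<n}"
    then have "X i -` A i \<inter> space M \<in> sets M"
      using assms by (auto intro: measurable_sets)
    also have "X i -` A i \<inter> space M = {\<omega> \<in> space M. X i \<omega> \<in> A i}" by auto
    finally show "{\<omega> \<in> space M. X i \<omega> \<in> A i} \<in> sets M" .
  qed simp
  then show ?thesis by (simp only: Ball_def lessThan_iff)
qed

text \<open>Induction on the dimension: restricting each measure to the event that the last
  coordinate lies in its side of the box leaves a problem in \<open>n\<close> coordinates.
  Restriction destroys total mass 1, so the claim is made for finite measures and the induction
  generalises over them.\<close>

lemma joint_cf_unique_boxes:
  fixes X :: "nat \<Rightarrow> 'a \<Rightarrow> real" and Y :: "nat \<Rightarrow> 'b \<Rightarrow> real"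
  assumes "finite_measure M1" "finite_measure M2"
    and "\<And>i. i < n \<Longrightarrow> X i \<in> borel_measurable M1"
    and "\<And>i. i < n \<Longrightarrow> Y i \<in> borel_measurable M2"
    and "\<And>t. (\<integral>\<omega>. iexp (\<Sum>i<n. t i * X i \<omega>) \<partial>M1) = (\<integral>\<omega>. iexp (\<Sum>i<n. t i * Y i \<omega>) \<partial>M2)"
    and "\<And>i. i < n \<Longrightarrow> A i \<in> sets borel"
  shows "measure M1 {\<omega> \<in> space M1. \<forall>i<n. X i \<omega> \<in> A i} = measure M2 {\<omega> \<in> space M2. \<forall>i<n. Y i \<omega> \<in> A i}"
  using assms
proof (induction n arbitrary: M1 M2)
  case 0
  then show ?case by simp
next
  case (Suc n)
  interpret M1: finite_measure M1 by fact
  interpret M2: finite_measure M2 by fact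
  note X = Suc.prems(3) and Y = Suc.prems(4) and A = Suc.prems(6)
  have X'[measurable]: "X n \<in> borel_measurable M1" and Y'[measurable]: "Y n \<in> borel_measurable M2"
    and A'[measurable]: "A n \<in> sets borel" using X Y A by simp_all
  define N1 where "N1 = density M1 (\<lambda>\<omega>. ennreal (indicator (A n) (X n \<omega>)))"
  define N2 where "N2 = density M2 (\<lambda>\<omega>. ennreal (indicator (A n) (Y n \<omega>)))"
  have e1: "emeasure N1 B = ennreal (measure M1 {\<omega> \<in> B. X n \<omega> \<in> A n})" if "B \<in> sets M1" for B
  proof -
    have "emeasure N1 B = (\<integral>\<^sup>+\<omega>. ennreal (indicator (A n) (X n \<omega>)) * indicator B \<omega> \<partial>M1)"
      using that by (simp add: N1_def emeasure_density)
    also have "\<dots> = (\<integral>\<^sup>+\<omega>. indicator {\<omega> \<in> B. X n \<omega> \<in> A n} \<omega> \<partial>M1)"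
      by (intro nn_integral_cong) (auto simp: indicator_def)
    finally have "emeasure N1 B = \<dots>" .
    moreover have "{\<omega> \<in> B. X n \<omega> \<in> A n} = B \<inter> (X n -` A n \<inter> space M1)"
      using sets.sets_into_space[OF that] by auto
    ultimately show ?thesis using that by (simp add: M1.emeasure_eq_measure)
  qed
  have e2: "emeasure N2 B = ennreal (measure M2 {\<omega> \<in> B. Y n \<omega> \<in> A n})" if "B \<in> sets M2" for B
  proof -
    have "emeasure N2 B = (\<integral>\<^sup>+\<omega>. ennreal (indicator (A n) (Y n \<omega>)) * indicator B \<omega> \<partial>M2)"
      using that by (simp add: N2_def emeasure_density)
    also have "\<dots> = (\<integral>\<^sup>+\<omega>. indicator {\<omega> \<in> B. Y n \<omega> \<in> A n} \<omega> \<partial>M2)"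
      by (intro nn_integral_cong) (auto simp: indicator_def)
    finally have "emeasure N2 B = \<dots>" .
    moreover have "{\<omega> \<in> B. Y n \<omega> \<in> A n} = B \<inter> (Y n -` A n \<inter> space M2)"
      using sets.sets_into_space[OF that] by auto
    ultimately show ?thesis using that by (simp add: M2.emeasure_eq_measure)
  qed
  have [measurable_cong, simp]: "sets N1 = sets M1" "sets N2 = sets M2" by (simp_all add: N1_def N2_def)
  have [simp]: "space N1 = space M1" "space N2 = space M2" by (simp_all add: N1_def N2_def)
  have "measure N1 {\<omega> \<in> space N1. \<forall>i<n. X i \<omega> \<in> A i} = measure N2 {\<omega> \<in> space N2. \<forall>i<n. Y i \<omega> \<in> A i}"
  proof (rule Suc.IH)
    show "finite_measure N1" "finite_measure N2"
      by (intro finite_measureI; simp add: e1 e2)+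
    fix t :: "nat \<Rightarrow> real"
    have [measurable]: "(\<lambda>\<omega>. iexp (\<Sum>i<n. t i * X i \<omega>)) \<in> borel_measurable M1"
      "(\<lambda>\<omega>. iexp (\<Sum>i<n. t i * Y i \<omega>)) \<in> borel_measurable M2"
      using X Y by (auto intro!: borel_measurable_iexp borel_measurable_sum simp del: of_real_sum)
    have "(\<integral>\<omega>. iexp (\<Sum>i<n. t i * X i \<omega>) \<partial>N1)
        = (\<integral>\<omega>. indicator (A n) (X n \<omega>) *\<^sub>R iexp (\<Sum>i<n. t i * X i \<omega>) \<partial>M1)"
      unfolding N1_def by (subst integral_density) (simp_all del: of_real_sum)
    also have "\<dots> = (\<integral>\<omega>. indicator (A n) (Y n \<omega>) *\<^sub>R iexp (\<Sum>i<n. t i * Y i \<omega>) \<partial>M2)"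
    proof -
      have X': "i \<le> n \<Longrightarrow> X i \<in> borel_measurable M1" and Y': "i \<le> n \<Longrightarrow> Y i \<in> borel_measurable M2" for i
        using X Y by auto
      show ?thesis
        using phase_marginal_iexp[where M = M1 and X = X and t = t, OF Suc.prems(1) _ A', of n]
          phase_marginal_iexp[where M = M2 and X = Y and t = t, OF Suc.prems(2) _ A', of n]
          phase_marginal_unique[where X = X and Y = Y and n = n, OF Suc.prems(1,2) _ _ Suc.prems(5) A'] X' Y'
        by simp
    qed
    also have "\<dots> = (\<integral>\<omega>. iexp (\<Sum>i<n. t i * Y i \<omega>) \<partial>N2)"
      unfolding N2_def by (subst integral_density) (simp_all del: of_real_sum)
    finally show "(\<integral>\<omega>. iexp (\<Sum>i<n. t i * X i \<omega>) \<partial>N1) = (\<integral>\<omega>. iexp (\<Sum>i<n. t i * Y i \<omega>) \<partial>N2)" .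
  qed (use X Y A in simp_all)
  moreover have "measure N1 {\<omega> \<in> space N1. \<forall>i<n. X i \<omega> \<in> A i} = measure M1 {\<omega> \<in> space M1. \<forall>i<Suc n. X i \<omega> \<in> A i}"
  proof -
    have "{\<omega> \<in> space M1. \<forall>i<n. X i \<omega> \<in> A i} \<in> sets M1"
      using X A by (intro sets_Collect_box) auto
    from e1[OF this] have "measure N1 {\<omega> \<in> space N1. \<forall>i<n. X i \<omega> \<in> A i}
        = measure M1 {\<omega> \<in> {\<omega> \<in> space M1. \<forall>i<n. X i \<omega> \<in> A i}. X n \<omega> \<in> A n}"
      by (simp add: measure_def)
    also have "{\<omega> \<in> {\<omega> \<in> space M1. \<forall>i<n. X i \<omega> \<in> A i}. X n \<omega> \<in> A n}
        = {\<omega> \<in> space M1. \<forall>i<Suc n. X i \<omega> \<in> A i}"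
      by (auto simp: less_Suc_eq)
    finally show ?thesis .
  qed
  moreover have "measure N2 {\<omega> \<in> space N2. \<forall>i<n. Y i \<omega> \<in> A i} = measure M2 {\<omega> \<in> space M2. \<forall>i<Suc n. Y i \<omega> \<in> A i}"
  proof -
    have "{\<omega> \<in> space M2. \<forall>i<n. Y i \<omega> \<in> A i} \<in> sets M2"
      using Y A by (intro sets_Collect_box) auto
    from e2[OF this] have "measure N2 {\<omega> \<in> space N2. \<forall>i<n. Y i \<omega> \<in> A i}
        = measure M2 {\<omega> \<in> {\<omega> \<in> space M2. \<forall>i<n. Y i \<omega> \<in> A i}. Y n \<omega> \<in> A n}"
      by (simp add: measure_def)
    also have "{\<omega> \<in> {\<omega> \<in> space M2. \<forall>i<n. Y i \<omega> \<in> A i}. Y n \<omega> \<in> A n}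
        = {\<omega> \<in> space M2. \<forall>i<Suc n. Y i \<omega> \<in> A i}"
      by (auto simp: less_Suc_eq)
    finally show ?thesis .
  qed
  ultimately show ?case by simp
qed

lemma joint_cf_unique:
  fixes X :: "nat \<Rightarrow> 'a \<Rightarrow> real" and Y :: "nat \<Rightarrow> 'b \<Rightarrow> real"
  assumes fin: "finite_measure M1" "finite_measure M2"
    and X: "\<And>i. i < n \<Longrightarrow> X i \<in> borel_measurable M1"
    and Y: "\<And>i. i < n \<Longrightarrow> Y i \<in> borel_measurable M2"
    and cf: "\<And>t. (\<integral>\<omega>. iexp (\<Sum>i<n. t i * X i \<omega>) \<partial>M1) = (\<integral>\<omega>. iexp (\<Sum>i<n. t i * Y i \<omega>) \<partial>M2)"
  shows "distr M1 (\<Pi>\<^sub>M i\<in>{..<n}. borel) (\<lambda>\<omega>. \<lambda>i\<in>{..<n}. X i \<omega>)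
    = distr M2 (\<Pi>\<^sub>M i\<in>{..<n}. borel) (\<lambda>\<omega>. \<lambda>i\<in>{..<n}. Y i \<omega>)"
proof (rule measure_eqI_PiM_finite[of "{..<n}"])
  have box: "(\<lambda>i\<in>{..<n}. Z i) \<in> Pi\<^sub>E {..<n} A \<longleftrightarrow> (\<forall>i<n. Z i \<in> A i)"
    for Z :: "nat \<Rightarrow> real" and A
    unfolding restrict_PiE_iff by auto
  interpret M1: finite_measure M1 by fact
  interpret M2: finite_measure M2 by fact
  let ?P = "\<Pi>\<^sub>M i\<in>{..<n}. borel :: real measure"
  have measurable: "(\<lambda>\<omega>. \<lambda>i\<in>{..<n}. X i \<omega>) \<in> measurable M1 ?P" "(\<lambda>\<omega>. \<lambda>i\<in>{..<n}. Y i \<omega>) \<in> measurable M2 ?P"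
    using X Y by (auto intro!: measurable_restrict)
  show "emeasure (distr M1 ?P (\<lambda>\<omega>. \<lambda>i\<in>{..<n}. X i \<omega>)) (Pi\<^sub>E {..<n} A)
      = emeasure (distr M2 ?P (\<lambda>\<omega>. \<lambda>i\<in>{..<n}. Y i \<omega>)) (Pi\<^sub>E {..<n} A)"
    if A: "\<And>i. i \<in> {..<n} \<Longrightarrow> A i \<in> sets borel" for A
  proof -
    have "Pi\<^sub>E {..<n} A \<in> sets ?P" using A by (rule sets_PiM_I_finite[OF finite_lessThan])
    moreover have "(\<lambda>\<omega>. \<lambda>i\<in>{..<n}. X i \<omega>) -` Pi\<^sub>E {..<n} A \<inter> space M1 = {\<omega> \<in> space M1. \<forall>i<n. X i \<omega> \<in> A i}"
      "(\<lambda>\<omega>. \<lambda>i\<in>{..<n}. Y i \<omega>) -` Pi\<^sub>E {..<n} A \<inter> space M2 = {\<omega> \<in> space M2. \<forall>i<n. Y i \<omega> \<in> A i}"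
      unfolding vimage_def box by blast+
    moreover have "measure M1 {\<omega> \<in> space M1. \<forall>i<n. X i \<omega> \<in> A i} = measure M2 {\<omega> \<in> space M2. \<forall>i<n. Y i \<omega> \<in> A i}"
      using A by (intro joint_cf_unique_boxes fin X Y cf) auto
    ultimately show ?thesis
      by (simp add: emeasure_distr[OF measurable(1)] emeasure_distr[OF measurable(2)]
          M1.emeasure_eq_measure M2.emeasure_eq_measure)
  qed
  \<comment> \<open>The whole space is itself a box of finite measure, so a constant sequence serves
    as the exhausting family.\<close>
  show "range (\<lambda>_::nat. space ?P) \<subseteq> prod_algebra {..<n} (\<lambda>_. borel)"
    by (simp add: space_PiM image_subset_iff prod_algebraI_finite)
  show "emeasure (distr M1 ?P (\<lambda>\<omega>. \<lambda>i\<in>{..<n}. X i \<omega>)) (space ?P) \<noteq> \<infinity>"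
    using measurable by (simp add: emeasure_distr M1.emeasure_eq_measure)
qed simp_all

section \<open>Fractional Gaussian noise\<close>

context prob_space
begin

lemma gaussian_rv_measurable: "gaussian_rv M X \<Longrightarrow> X \<in> borel_measurable M"
  by (simp add: gaussian_rv_def)

text \<open>For a nondegenerate normal law, the triangle inequality around the mean and the binomial
  theorem dominate the power by finitely many centred absolute moments, all of which are
  finite.\<close>

lemma gaussian_rv_abs_moment:
  assumes "gaussian_rv M X"
  shows "integrable M (\<lambda>\<omega>. \<bar>X \<omega>\<bar> ^ k)"
proof -
  have [measurable]: "X \<in> borel_measurable M" using assms by (rule gaussian_rv_measurable)
  consider (normal) m s where "s > 0" "distributed M lborel X (\<lambda>x. ennreal (normal_density m s x))"
    | (const) m where "AE \<omega> in M. X \<omega> = m"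
    using assms unfolding gaussian_rv_def by blast
  then show ?thesis
  proof cases
    case normal
    have eq: "normal_density m s x * (\<Sum>i\<le>k. of_nat (k choose i) * \<bar>x - m\<bar> ^ i * \<bar>m\<bar> ^ (k - i))
        = (\<Sum>i\<le>k. of_nat (k choose i) * \<bar>m\<bar> ^ (k - i) * (normal_density m s x * \<bar>x - m\<bar> ^ i))" for x
      by (simp add: sum_distrib_left mult_ac)
    have "integrable lborel (\<lambda>x. normal_density m s x * \<bar>x\<bar> ^ k)"
    proof (rule Bochner_Integration.integrable_bound)
      show "integrable lborel (\<lambda>x. normal_density m s x * (\<Sum>i\<le>k. of_nat (k choose i) * \<bar>x - m\<bar> ^ i * \<bar>m\<bar> ^ (k - i)))"
        unfolding eq using normal(1)
        by (intro Bochner_Integration.integrable_sum integrable_mult_right integrable_normal_moment_abs)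
      show "AE x in lborel. norm (normal_density m s x * \<bar>x\<bar> ^ k)
          \<le> norm (normal_density m s x * (\<Sum>i\<le>k. of_nat (k choose i) * \<bar>x - m\<bar> ^ i * \<bar>m\<bar> ^ (k - i)))"
      proof (rule AE_I2)
        fix x
        have "\<bar>x\<bar> ^ k \<le> (\<bar>x - m\<bar> + \<bar>m\<bar>) ^ k" by (intro power_mono) auto
        also have "\<dots> = (\<Sum>i\<le>k. of_nat (k choose i) * \<bar>x - m\<bar> ^ i * \<bar>m\<bar> ^ (k - i))"
          by (rule binomial_ring)
        finally show "norm (normal_density m s x * \<bar>x\<bar> ^ k)
          \<le> norm (normal_density m s x * (\<Sum>i\<le>k. of_nat (k choose i) * \<bar>x - m\<bar> ^ i * \<bar>m\<bar> ^ (k - i)))"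
          by (simp add: abs_mult mult_left_mono order_trans[OF _ abs_ge_self])
      qed
    qed measurable
    then show ?thesis
      using distributed_integrable[OF normal(2), of "\<lambda>x. \<bar>x\<bar> ^ k"] by simp
  next
    case const
    have "AE \<omega> in M. \<bar>m\<bar> ^ k = \<bar>X \<omega>\<bar> ^ k"
      using const by eventually_elim simp
    then show ?thesis
      by (rule integrable_cong_AE_imp[of _ "\<lambda>_. \<bar>m\<bar> ^ k", rotated 2]) simp_all
  qed
qed

lemma gaussian_rv_moment:
  assumes "gaussian_rv M X"
  shows "integrable M (\<lambda>\<omega>. X \<omega> ^ k)"
proof -
  have [measurable]: "X \<in> borel_measurable M" using assms by (rule gaussian_rv_measurable)
  show ?thesis
    by (rule Bochner_Integration.integrable_bound[OF gaussian_rv_abs_moment[OF assms, of k]])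
      (auto simp: power_abs)
qed

lemma gaussian_rv_mult_integrable:
  assumes "gaussian_rv M X" "gaussian_rv M Y"
  shows "integrable M (\<lambda>\<omega>. X \<omega> * Y \<omega>)"
proof (rule Bochner_Integration.integrable_bound)
  show "integrable M (\<lambda>\<omega>. (X \<omega>)\<^sup>2 + (Y \<omega>)\<^sup>2)"
    using assms by (intro Bochner_Integration.integrable_add gaussian_rv_moment)
  show "AE \<omega> in M. norm (X \<omega> * Y \<omega>) \<le> norm ((X \<omega>)\<^sup>2 + (Y \<omega>)\<^sup>2)"
  proof (rule AE_I2)
    fix \<omega>
    have "2 * \<bar>X \<omega>\<bar> * \<bar>Y \<omega>\<bar> \<le> (X \<omega>)\<^sup>2 + (Y \<omega>)\<^sup>2"
      using sum_squares_bound[of "\<bar>X \<omega>\<bar>" "\<bar>Y \<omega>\<bar>"] by simp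
    moreover have "0 \<le> \<bar>X \<omega>\<bar> * \<bar>Y \<omega>\<bar>" by simp
    ultimately show "norm (X \<omega> * Y \<omega>) \<le> norm ((X \<omega>)\<^sup>2 + (Y \<omega>)\<^sup>2)"
      unfolding real_norm_def abs_mult by linarith
  qed
qed (use assms in \<open>intro borel_measurable_times gaussian_rv_measurable\<close>)

text \<open>A mean of zero pins both the location parameter and the degenerate value at 0. Each case
  also records the second moment, so that later arguments can work from the variance alone.\<close>

lemma gaussian_rv_centred_cases:
  assumes X: "gaussian_rv M X" and mean: "expectation X = 0"
  obtains (normal) s where "s > 0" "distributed M lborel X (\<lambda>x. ennreal (normal_density 0 s x))"
      "expectation (\<lambda>\<omega>. (X \<omega>)\<^sup>2) = s\<^sup>2"
    | (zero) "AE \<omega> in M. X \<omega> = 0" "expectation (\<lambda>\<omega>. (X \<omega>)\<^sup>2) = 0"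
proof -
  have [measurable]: "X \<in> borel_measurable M" using X by (rule gaussian_rv_measurable)
  consider m s where "s > 0" "distributed M lborel X (\<lambda>x. ennreal (normal_density m s x))"
    | m where "AE \<omega> in M. X \<omega> = m"
    using X unfolding gaussian_rv_def by blast
  then show ?thesis
  proof cases
    case 1
    have "m = 0" using normal_distributed_expectation[OF 1] mean by simp
    then show ?thesis
      using normal[of s] 1 normal_distributed_variance[OF 1] mean by simp
  next
    case 2
    have "expectation X = expectation (\<lambda>_. m)"
      using 2 by (intro integral_cong_AE) auto
    then have "m = 0" using mean by (simp add: prob_space)
    have "expectation (\<lambda>\<omega>. (X \<omega>)\<^sup>2) = expectation (\<lambda>_. 0)"
      using 2 \<open>m = 0\<close> by (intro integral_cong_AE) (auto elim: eventually_mono)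
    then show ?thesis using 2 \<open>m = 0\<close> zero by simp
  qed
qed

lemma std_normal_iexp:
  assumes "distributed M lborel X (\<lambda>x. ennreal (std_normal_density x))"
  shows "expectation (\<lambda>\<omega>. iexp (t * X \<omega>)) = complex_of_real (exp (- t\<^sup>2 / 2))"
proof -
  have [measurable]: "X \<in> borel_measurable M"
    using distributed_measurable[OF assms] by simp
  have "expectation (\<lambda>\<omega>. iexp (t * X \<omega>)) = (\<integral>x. iexp (t * x) \<partial>distr M lborel X)"
    by (subst integral_distr) simp_all
  also have "distr M lborel X = std_normal_distribution"
    using assms by (rule distributed_distr_eq_density)
  finally show ?thesis
    using fun_cong[OF char_std_normal_distribution, of t] by (simp add: char_def)
qed

lemma gaussian_rv_centred_iexp:
  assumes X: "gaussian_rv M X" and mean: "expectation X = 0"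
  shows "expectation (\<lambda>\<omega>. iexp (X \<omega>)) = complex_of_real (exp (- expectation (\<lambda>\<omega>. (X \<omega>)\<^sup>2) / 2))"
  using assms
proof (cases rule: gaussian_rv_centred_cases)
  case (normal s)
  then have "distributed M lborel (\<lambda>\<omega>. X \<omega> / s) (\<lambda>x. ennreal (std_normal_density x))"
    using normal_standard_normal_convert[of s X 0] by simp
  \<comment> \<open>Frequency \<open>s\<close> undoes the division by \<open>s\<close>, and the
    variance of \<open>X\<close> is \<open>s\<close> squared.\<close>
  from std_normal_iexp[OF this, of s] normal show ?thesis by simp
next
  case zero
  have [measurable]: "X \<in> borel_measurable M" using X by (rule gaussian_rv_measurable)
  have "expectation (\<lambda>\<omega>. iexp (X \<omega>)) = expectation (\<lambda>_. 1 :: complex)"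
    using zero by (intro integral_cong_AE) (auto elim: eventually_mono)
  then show ?thesis using zero by (simp add: prob_space)
qed

lemma gaussian_rv_fourth_moment:
  assumes X: "gaussian_rv M X" and mean: "expectation X = 0"
    and var: "expectation (\<lambda>\<omega>. (X \<omega>)\<^sup>2) = 1"
  shows "expectation (\<lambda>\<omega>. X \<omega> ^ 4) = 3"
  using X mean
proof (cases rule: gaussian_rv_centred_cases)
  case (normal s)
  then have "s = 1" using var by (auto simp: power2_eq_1_iff)
  then show ?thesis
    \<comment> \<open>The even-moment formula at 2 reads 4! / (2^2 2!) = 3. The degenerate case
      below contradicts unit variance.\<close>
    using distributed_integral[OF normal(2), of "\<lambda>x. x ^ 4"] integral_std_normal_moment_even[of 2]
    by (simp add: fact_numeral)
next
  case zero
  then show ?thesis using var by simp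
qed

end

text \<open>The definition of a Gaussian process speaks of sums over distinct times. When
  \<open>s\<close> repeats a time, the coefficients belonging to it are added up first; this matters
  for increments, since neighbouring ones share an endpoint.\<close>

lemma (in prob_space) gaussian_process_sum:
  assumes "gaussian_process M T B" "finite I" "s ` I \<subseteq> T"
  shows "gaussian_rv M (\<lambda>\<omega>. \<Sum>i\<in>I. a i * B (s i) \<omega>)"
proof -
  have "(\<Sum>i\<in>I. a i * B (s i) \<omega>) = (\<Sum>t\<in>s ` I. (\<Sum>i\<in>{i \<in> I. s i = t}. a i) * B t \<omega>)" for \<omega>
    using assms(2) by (subst sum.image_gen[of I _ s]) (auto simp: sum_distrib_right intro!: sum.cong)
  then show ?thesis
    using assms unfolding gaussian_process_def by simp
qed

section \<open>Normalised increments of a fractional Brownian motion on the grid\<close>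

locale fbm_noise = prob_space M for M :: "'w measure" +
  fixes H h :: real and B :: "real \<Rightarrow> 'w \<Rightarrow> real"
  assumes fbm: "fractional_brownian_motion M H B" and h_pos: "h > 0"
begin

abbreviation \<xi> :: "nat \<Rightarrow> 'w \<Rightarrow> real" where "\<xi> \<equiv> fgn h H B"

lemma gaussian_B: "t \<ge> 0 \<Longrightarrow> gaussian_rv M (B t)"
  using gaussian_process_sum[of "{0..}" B "{()}" "\<lambda>_. t" "\<lambda>_. 1"] fbm
  by (simp add: fractional_brownian_motion_def)

lemma gaussian_fgn_sum: "gaussian_rv M (\<lambda>\<omega>. \<Sum>n<N. t n * \<xi> n \<omega>)"
proof -
  \<comment> \<open>The pair \<open>(n, True)\<close> stands for the right endpoint of the
    \<open>n\<close>-th increment, with sign +1, and \<open>(n, False)\<close> for the left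
    endpoint, with sign -1.\<close>
  have "gaussian_rv M (\<lambda>\<omega>. \<Sum>p\<in>{..<N} \<times> {True, False}.
      (t (fst p) * h powr (- H) * (if snd p then 1 else - 1)) * B (real (fst p + of_bool (snd p)) * h) \<omega>)"
    using fbm h_pos by (intro gaussian_process_sum) (auto simp: fractional_brownian_motion_def)
  also have "(\<lambda>\<omega>. \<Sum>p\<in>{..<N} \<times> {True, False}.
      (t (fst p) * h powr (- H) * (if snd p then 1 else - 1)) * B (real (fst p + of_bool (snd p)) * h) \<omega>)
    = (\<lambda>\<omega>. \<Sum>n<N. t n * \<xi> n \<omega>)"
    by (rule ext, subst sum.cartesian_product', simp add: fgn_def algebra_simps)
  finally show ?thesis .
qed

lemma gaussian_fgn: "gaussian_rv M (\<xi> n)"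
proof -
  have "(\<lambda>\<omega>. \<Sum>i<Suc n. (if i = n then 1 else 0) * \<xi> i \<omega>) = \<xi> n"
    by (rule ext) simp
  then show ?thesis using gaussian_fgn_sum[of "\<lambda>i. if i = n then 1 else 0" "Suc n"] by simp
qed

lemmas fgn_measurable[measurable] = gaussian_rv_measurable[OF gaussian_fgn]
lemmas fgn_integrable = gaussian_rv_moment[OF gaussian_fgn, of _ 1, simplified]

lemma fgn_mean: "expectation (\<xi> n) = 0"
proof -
  have "integrable M (B t)" "expectation (B t) = 0" if "t \<ge> 0" for t
    using gaussian_rv_moment[OF gaussian_B[OF that], of 1] fbm that
    by (simp_all add: fractional_brownian_motion_def)
  then show ?thesis
    using h_pos by (simp add: fgn_def[abs_def])
qed

text \<open>The product of two increments expands into four covariances. Self-similarity extracts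
  \<open>h powr (2 * H)\<close>, which the normalisation cancels, and in the mixed second difference
  of \<open>R\<close> the terms depending on a single index drop out.\<close>

lemma fgn_covariance: "expectation (\<lambda>\<omega>. \<xi> i \<omega> * \<xi> j \<omega>) = fgn_cov H i j"
proof -
  define R where "R p q = (real p powr (2 * H) + real q powr (2 * H) - \<bar>real q - real p\<bar> powr (2 * H)) / 2"
    for p q :: nat
  let ?B = "\<lambda>p. B (real p * h)"
  have int: "integrable M (\<lambda>\<omega>. ?B p \<omega> * ?B q \<omega>)" for p q
    using h_pos by (intro gaussian_rv_mult_integrable gaussian_B) simp_all
  have E: "expectation (\<lambda>\<omega>. ?B p \<omega> * ?B q \<omega>) = h powr (2 * H) * R p q" for p q
  proof -
    have "\<bar>real q * h - real p * h\<bar> = \<bar>real q - real p\<bar> * h"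
      using h_pos by (simp add: abs_mult flip: left_diff_distrib)
    then have "expectation (\<lambda>\<omega>. ?B p \<omega> * ?B q \<omega>)
      = ((real p * h) powr (2 * H) + (real q * h) powr (2 * H) - (\<bar>real q - real p\<bar> * h) powr (2 * H)) / 2"
      using fbm h_pos by (simp add: fractional_brownian_motion_def)
    then show ?thesis
      using h_pos by (simp add: R_def powr_mult algebra_simps)
  qed
  have "(\<lambda>\<omega>. \<xi> i \<omega> * \<xi> j \<omega>) = (\<lambda>\<omega>. (h powr (- H))\<^sup>2 * (?B (i + 1) \<omega> * ?B (j + 1) \<omega> - ?B (i + 1) \<omega> * ?B j \<omega>
      - ?B i \<omega> * ?B (j + 1) \<omega> + ?B i \<omega> * ?B j \<omega>))"
    by (auto simp: fgn_def power2_eq_square algebra_simps)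
  then have "expectation (\<lambda>\<omega>. \<xi> i \<omega> * \<xi> j \<omega>)
      = (h powr (- H))\<^sup>2 * h powr (2 * H) * (R (i + 1) (j + 1) - R (i + 1) j - R i (j + 1) + R i j)"
    using int[of "i + 1" "j + 1"] int[of "i + 1" j] int[of i "j + 1"] int[of i j]
      E[of "i + 1" "j + 1"] E[of "i + 1" j] E[of i "j + 1"] E[of i j]
    by (simp del: of_nat_add of_nat_Suc add: right_diff_distrib distrib_left mult.assoc)
  also have "(h powr (- H))\<^sup>2 * h powr (2 * H) = 1"
    using h_pos by (simp add: power2_eq_square flip: powr_add)
  also have "R (i + 1) (j + 1) - R (i + 1) j - R i (j + 1) + R i j = fgn_cov H i j"
  proof -
    have a: "\<bar>real (j + 1) - real (i + 1)\<bar> = \<bar>real i - real j\<bar>" "\<bar>real j - real (i + 1)\<bar> = \<bar>real i - real j + 1\<bar>"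
      "\<bar>real (j + 1) - real i\<bar> = \<bar>real i - real j - 1\<bar>" "\<bar>real j - real i\<bar> = \<bar>real i - real j\<bar>"
      by simp_all
    show ?thesis unfolding R_def fgn_cov_def Let_def a by (simp add: field_simps)
  qed
  finally show ?thesis by simp
qed

lemma fgn_variance: "expectation (\<lambda>\<omega>. (\<xi> n \<omega>)\<^sup>2) = 1"
  using fgn_covariance[of n n] by (simp add: fgn_cov_def power2_eq_square)

lemma fgn_fourth_moment: "expectation (\<lambda>\<omega>. \<xi> n \<omega> ^ 4) = 3"
  by (intro gaussian_rv_fourth_moment gaussian_fgn fgn_mean fgn_variance)

lemma fgn_cf: "expectation (\<lambda>\<omega>. iexp (\<Sum>n<N. t n * \<xi> n \<omega>))
    = complex_of_real (exp (- (\<Sum>i<N. \<Sum>j<N. t i * t j * fgn_cov H i j) / 2))"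
proof -
  have "expectation (\<lambda>\<omega>. \<Sum>n<N. t n * \<xi> n \<omega>) = 0"
    using fgn_integrable fgn_mean by simp
  moreover have "expectation (\<lambda>\<omega>. (\<Sum>n<N. t n * \<xi> n \<omega>)\<^sup>2) = (\<Sum>i<N. \<Sum>j<N. t i * t j * fgn_cov H i j)"
  proof -
    have int: "integrable M (\<lambda>\<omega>. (t i * t j) * (\<xi> i \<omega> * \<xi> j \<omega>))" for i j
      by (intro integrable_mult_right gaussian_rv_mult_integrable gaussian_fgn)
    have "expectation (\<lambda>\<omega>. (\<Sum>n<N. t n * \<xi> n \<omega>)\<^sup>2)
        = expectation (\<lambda>\<omega>. \<Sum>i<N. \<Sum>j<N. (t i * t j) * (\<xi> i \<omega> * \<xi> j \<omega>))"
      by (simp add: power2_eq_square sum_product mult_ac)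
    also have "\<dots> = (\<Sum>i<N. \<Sum>j<N. expectation (\<lambda>\<omega>. (t i * t j) * (\<xi> i \<omega> * \<xi> j \<omega>)))"
      using int by (simp only: Bochner_Integration.integral_sum Bochner_Integration.integrable_sum)
    finally show ?thesis by (simp add: fgn_covariance)
  qed
  ultimately show ?thesis
    using gaussian_rv_centred_iexp[OF gaussian_fgn_sum[of t N]] by simp
qed

end

section \<open>Reconstruction of the noise from white noise\<close>

lemma reconstruct_sum:
  assumes \<beta>: "cholesky_factor N C \<beta>"
  shows "(\<Sum>n<N. t n * reconstruct \<beta> z n) = (\<Sum>k<N. (\<Sum>n<N. t n * \<beta> n k) * z k)"
proof -
  \<comment> \<open>The reconstruction stops at \<open>n\<close>; the terms with index strictly
    between \<open>n\<close> and \<open>N\<close> vanish because the factor is lower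
    triangular.\<close>
  have "reconstruct \<beta> z n = (\<Sum>k<N. \<beta> n k * z k)" if "n < N" for n
    unfolding reconstruct_def using that \<beta>
    by (intro sum.mono_neutral_left) (auto simp: cholesky_factor_def)
  then have "(\<Sum>n<N. t n * reconstruct \<beta> z n) = (\<Sum>n<N. \<Sum>k<N. t n * \<beta> n k * z k)"
    by (simp add: sum_distrib_left mult.assoc)
  also have "\<dots> = (\<Sum>k<N. (\<Sum>n<N. t n * \<beta> n k) * z k)"
    by (subst sum.swap) (simp add: sum_distrib_right)
  finally show ?thesis .
qed

text \<open>With B the matrix of \<open>\<beta>\<close>, this is |B^T t|^2 = t^T B B^T t together
  with B B^T = C.\<close>

lemma cholesky_sum:
  assumes \<beta>: "cholesky_factor N C \<beta>"
  shows "(\<Sum>k<N. (\<Sum>n<N. t n * \<beta> n k)\<^sup>2) = (\<Sum>i<N. \<Sum>j<N. t i * t j * C i j)"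
proof -
  have "(\<Sum>k<N. (\<Sum>n<N. t n * \<beta> n k)\<^sup>2) = (\<Sum>k<N. \<Sum>i<N. \<Sum>j<N. t i * t j * (\<beta> i k * \<beta> j k))"
    by (simp add: power2_eq_square sum_product mult_ac)
  also have "\<dots> = (\<Sum>i<N. \<Sum>j<N. \<Sum>k<N. t i * t j * (\<beta> i k * \<beta> j k))"
    by (subst sum.swap, rule sum.cong[OF refl], rule sum.swap)
  also have "\<dots> = (\<Sum>i<N. \<Sum>j<N. t i * t j * C i j)"
    using \<beta> by (intro sum.cong refl) (simp add: cholesky_factor_def flip: sum_distrib_left)
  finally show ?thesis .
qed

lemma (in prob_space) white_noise_measurable:
  assumes "white_noise M N Z" "n < N"
  shows "Z k n \<in> borel_measurable M"
proof -
  have "distributed M lborel (Z k n) (\<lambda>x. ennreal (std_normal_density x))"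
    using assms by (simp add: white_noise_def)
  from distributed_measurable[OF this] show ?thesis by simp
qed

lemma reconstruct_measurable:
  assumes "\<And>n. n < N \<Longrightarrow> z n \<in> borel_measurable M" "n < N"
  shows "(\<lambda>\<omega>. reconstruct \<beta> (\<lambda>i. z i \<omega>) n) \<in> borel_measurable M"
  unfolding reconstruct_def using assms
  by (intro borel_measurable_sum borel_measurable_times borel_measurable_const) auto

text \<open>A linear form in the reconstructed noise is a linear form in independent standard
  normals with coefficient vector B^T t, where B is the matrix of \<open>\<beta>\<close>. The
  characteristic function factors, and the exponents add up to -|B^T t|^2 / 2.\<close>

lemma (in prob_space) reconstruct_cf:
  assumes Z: "white_noise M N Z" and \<beta>: "cholesky_factor N C \<beta>"
  shows "expectation (\<lambda>\<omega>. iexp (\<Sum>n<N. t n * reconstruct \<beta> (\<lambda>i. Z k i \<omega>) n))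
    = complex_of_real (exp (- (\<Sum>i<N. \<Sum>j<N. t i * t j * C i j) / 2))"
proof -
  define c where "c j = (\<Sum>n<N. t n * \<beta> n j)" for j
  \<comment> \<open>Independence is given for the family indexed by pairs, so the factors are kept
    on the pairs \<open>(k, j)\<close> and reindexed only after the expectation has been
    split.\<close>
  define e where "e p \<omega> = iexp (c (snd p) * (\<lambda>(k, n). Z k n) p \<omega>)" for p \<omega>
  have "indep_vars (\<lambda>_. borel) (\<lambda>(k, n). Z k n) (Pair k ` {..<N})"
    using Z unfolding white_noise_def by (auto intro: indep_vars_subset)
  then have ind: "indep_vars (\<lambda>_. borel) e (Pair k ` {..<N})"
    unfolding e_def
    by (rule indep_vars_compose2[where Y = "\<lambda>p x. iexp (c (snd p) * x)"]) (intro borel_measurable_iexp, simp)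
  have e: "e (k, j) \<omega> = iexp (c j * Z k j \<omega>)" for j \<omega> by (simp add: e_def)
  have m: "e p \<in> borel_measurable M" if "p \<in> Pair k ` {..<N}" for p
    using that unfolding e_def
    by (auto intro!: borel_measurable_iexp borel_measurable_times white_noise_measurable[OF Z] simp del: of_real_mult)
  have "expectation (\<lambda>\<omega>. iexp (\<Sum>n<N. t n * reconstruct \<beta> (\<lambda>i. Z k i \<omega>) n))
      = expectation (\<lambda>\<omega>. \<Prod>j<N. iexp (c j * Z k j \<omega>))"
    unfolding reconstruct_sum[OF \<beta>] c_def[symmetric] by (simp add: exp_sum sum_distrib_left)
  also have "\<dots> = expectation (\<lambda>\<omega>. \<Prod>p\<in>Pair k ` {..<N}. e p \<omega>)"
    by (subst prod.reindex) (simp_all add: inj_on_def e)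
  also have "\<dots> = (\<Prod>p\<in>Pair k ` {..<N}. expectation (e p))"
  proof (rule indep_vars_lebesgue_integral[OF _ ind])
    have "norm (e p \<omega>) \<le> 1" for p \<omega> by (simp add: e_def)
    then show "integrable M (e p)" if "p \<in> Pair k ` {..<N}" for p
      using m[OF that] by (intro integrable_bounded[of _ 1])
  qed simp
  also have "\<dots> = (\<Prod>j<N. expectation (\<lambda>\<omega>. iexp (c j * Z k j \<omega>)))"
    by (subst prod.reindex) (simp_all add: inj_on_def e[abs_def])
  also have "\<dots> = (\<Prod>j<N. complex_of_real (exp (- (c j)\<^sup>2 / 2)))"
    using Z by (intro prod.cong refl std_normal_iexp) (simp add: white_noise_def)
  also have "\<dots> = complex_of_real (exp (- (\<Sum>j<N. (c j)\<^sup>2) / 2))"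
    by (simp add: exp_sum[symmetric] sum_negf sum_divide_distrib flip: of_real_prod)
  finally show ?thesis unfolding c_def cholesky_sum[OF \<beta>] .
qed

text \<open>This transfers expectations at a fixed control from the sampling space \<open>S\<close>
  to \<open>M\<close>, on which the cost and the moment bounds are formulated.\<close>

lemma (in fbm_noise) reconstruct_law:
  assumes "prob_space S" and Z: "white_noise S N Z" and \<beta>: "cholesky_factor N (fgn_cov H) \<beta>"
  shows "distr S (\<Pi>\<^sub>M i\<in>{..<N}. borel) (\<lambda>\<omega>. \<lambda>n\<in>{..<N}. reconstruct \<beta> (\<lambda>i. Z k i \<omega>) n)
    = distr M (\<Pi>\<^sub>M i\<in>{..<N}. borel) (\<lambda>\<omega>. \<lambda>n\<in>{..<N}. \<xi> n \<omega>)"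
proof -
  interpret S: prob_space S by fact
  show ?thesis
  proof (rule joint_cf_unique)
    show "finite_measure S" "finite_measure M" by unfold_locales
    show "(\<lambda>\<omega>. reconstruct \<beta> (\<lambda>i. Z k i \<omega>) n) \<in> borel_measurable S" if "n < N" for n
      using S.white_noise_measurable[OF Z] that by (rule reconstruct_measurable)
  qed (simp_all only: fgn_measurable fgn_cf S.reconstruct_cf[OF Z \<beta>])
qed

section \<open>Pathwise derivative of the cost\<close>

text \<open>\<open>C1\<close> contains joint differentiability, so the partial derivatives are the
  total derivative restricted to the two axes, and linearity reassembles it from them.\<close>

lemma C1_has_derivative:
  assumes "C1 f"
  shows "((\<lambda>(x, u). f x u) has_derivative (\<lambda>(y, w). deriv_x f x u y + deriv_u f x u w)) (at (x, u))"
    and C1_has_derivative_x: "((\<lambda>x. f x u) has_derivative deriv_x f x u) (at x)"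
    and C1_has_derivative_u: "((\<lambda>u. f x u) has_derivative deriv_u f x u) (at u)"
proof -
  obtain D where D: "((\<lambda>(x, u). f x u) has_derivative D) (at (x, u))"
    using assms unfolding C1_def differentiable_def by blast
  then have lin: "bounded_linear D" by (rule has_derivative_bounded_linear)
  have "((\<lambda>x'. (x', u)) has_derivative (\<lambda>y. (y, 0))) (at x)" "((\<lambda>u'. (x, u')) has_derivative (\<lambda>w. (0, w))) (at u)"
    by (auto intro!: derivative_eq_intros)
  from has_derivative_compose[OF this(1) D] has_derivative_compose[OF this(2) D]
  have x: "((\<lambda>x. f x u) has_derivative (\<lambda>y. D (y, 0))) (at x)"
    and u: "((\<lambda>u. f x u) has_derivative (\<lambda>w. D (0, w))) (at u)" by simp_all
  have dx: "blinfun_apply (deriv_x f x u) = (\<lambda>y. D (y, 0))"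
    unfolding deriv_x_def frechet_derivative_at[OF x, symmetric]
    using x by (intro bounded_linear_Blinfun_apply has_derivative_bounded_linear)
  have du: "blinfun_apply (deriv_u f x u) = (\<lambda>w. D (0, w))"
    unfolding deriv_u_def frechet_derivative_at[OF u, symmetric]
    using u by (intro bounded_linear_Blinfun_apply has_derivative_bounded_linear)
  have "D = (\<lambda>(y, w). deriv_x f x u y + deriv_u f x u w)"
  proof
    fix z
    show "D z = (\<lambda>(y, w). deriv_x f x u y + deriv_u f x u w) z"
      using linear_add[OF bounded_linear.linear[OF lin], of "(fst z, 0)" "(0, snd z)"]
      by (simp add: dx du case_prod_beta)
  qed
  with D show "((\<lambda>(x, u). f x u) has_derivative (\<lambda>(y, w). deriv_x f x u y + deriv_u f x u w)) (at (x, u))"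
    by simp
  show "((\<lambda>x. f x u) has_derivative deriv_x f x u) (at x)" using x by (simp add: dx)
  show "((\<lambda>u. f x u) has_derivative deriv_u f x u) (at u)" using u by (simp add: du)
qed

lemma C1_chain_rule:
  assumes f: "C1 f" and X: "(X has_vector_derivative Y) (at t)" and U: "(U has_vector_derivative W) (at t)"
  shows "((\<lambda>t. f (X t) (U t)) has_vector_derivative
    (deriv_x f (X t) (U t) Y + deriv_u f (X t) (U t) W)) (at t)"
proof -
  have "((\<lambda>t. (X t, U t)) has_derivative (\<lambda>r. (r *\<^sub>R Y, r *\<^sub>R W))) (at t)"
    using X U unfolding has_vector_derivative_def by (rule has_derivative_Pair)
  from has_derivative_compose[OF this C1_has_derivative(1)[OF f]]
  show ?thesis
    by (simp add: has_vector_derivative_def blinfun.scaleR_right scaleR_add_right)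
qed

text \<open>Mean value inequality in one variable at a time, through the intermediate point
  \<open>(x', u)\<close>.\<close>

lemma C1_lipschitz:
  assumes f: "C1 f" and L: "\<And>x u. norm (deriv_x f x u) \<le> L" "\<And>x u. norm (deriv_u f x u) \<le> L"
  shows "norm (f x u - f x' u') \<le> L * (norm (x - x') + norm (u - u'))"
proof -
  have "norm (f x u - f x' u) \<le> L * norm (x - x')"
    using C1_has_derivative_x[OF f] L(1)
    by (intro differentiable_bound[of UNIV "\<lambda>x. f x u" "\<lambda>x. deriv_x f x u"]) (auto simp: norm_blinfun.rep_eq)
  moreover have "norm (f x' u - f x' u') \<le> L * norm (u - u')"
    using C1_has_derivative_u[OF f] L(2)
    by (intro differentiable_bound[of UNIV "f x'" "\<lambda>u. deriv_u f x' u"]) (auto simp: norm_blinfun.rep_eq)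
  ultimately show ?thesis
    using norm_triangle_ineq[of "f x u - f x' u" "f x' u - f x' u'"] by (simp add: distrib_left)
qed

lemma smooth_coeffD:
  assumes "smooth_coeff L K f"
  shows "C1 f" "norm (deriv_x f x u) \<le> L" "norm (deriv_u f x u) \<le> L"
  using assms unfolding smooth_coeff_def C2_def bounded_lipschitz_def by auto

text \<open>Derivatives are handled after evaluation at a fixed vector. This suffices for
  transposes, since \<open>adjoint_blinfun_expand\<close> expresses them through finitely many such
  evaluations.\<close>

lemma C1_measurable:
  fixes f :: "'x::euclidean_space \<Rightarrow> 'c::euclidean_space \<Rightarrow> 'y::euclidean_space"
  assumes f: "C1 f" and [measurable]: "X \<in> borel_measurable M" "U \<in> borel_measurable M"
  shows "(\<lambda>\<omega>. f (X \<omega>) (U \<omega>)) \<in> borel_measurable M"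
    and C1_deriv_x_measurable: "(\<lambda>\<omega>. deriv_x f (X \<omega>) (U \<omega>) y) \<in> borel_measurable M"
    and C1_deriv_u_measurable: "(\<lambda>\<omega>. deriv_u f (X \<omega>) (U \<omega>) w) \<in> borel_measurable M"
proof -
  have m: "(\<lambda>\<omega>. g (X \<omega>, U \<omega>)) \<in> borel_measurable M" if "continuous_on UNIV g"
    for g :: "'x \<times> 'c \<Rightarrow> 'y"
  proof -
    have [measurable]: "g \<in> borel_measurable borel"
      using that by (rule borel_measurable_continuous_onI)
    have "(\<lambda>\<omega>. (X \<omega>, U \<omega>)) \<in> M \<rightarrow>\<^sub>M borel" by (rule borel_measurable_Pair; fact)
    then show ?thesis by measurable
  qed
  have "continuous_on UNIV (\<lambda>(x, u). f x u)"
    using f unfolding C1_def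
    by (intro continuous_at_imp_continuous_on) (auto intro: differentiable_imp_continuous_within)
  from m[OF this] show "(\<lambda>\<omega>. f (X \<omega>) (U \<omega>)) \<in> borel_measurable M" by simp
  have "continuous_on UNIV (\<lambda>z. blinfun_apply ((\<lambda>(x, u). deriv_x f x u) z) y)"
    "continuous_on UNIV (\<lambda>z. blinfun_apply ((\<lambda>(x, u). deriv_u f x u) z) w)"
    using f unfolding C1_def by (auto intro!: continuous_intros)
  from m[OF this(1)] m[OF this(2)]
  show "(\<lambda>\<omega>. deriv_x f (X \<omega>) (U \<omega>) y) \<in> borel_measurable M"
    "(\<lambda>\<omega>. deriv_u f (X \<omega>) (U \<omega>) w) \<in> borel_measurable M" by simp_all
qed

section \<open>Transposes of bounded linear maps\<close>

lemma linear_blinfun: "linear (blinfun_apply D)"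
  by (simp add: blinfun.bounded_linear_right bounded_linear.linear)

lemma adjoint_blinfun_inner:
  fixes D :: "'a::euclidean_space \<Rightarrow>\<^sub>L 'b::euclidean_space"
  shows "adjoint D p \<bullet> y = p \<bullet> D y"
  by (rule adjoint_clauses(2)[OF linear_blinfun])

lemma adjoint_blinfun_expand:
  fixes D :: "'a::euclidean_space \<Rightarrow>\<^sub>L 'b::euclidean_space"
  shows "adjoint D p = (\<Sum>b\<in>Basis. (p \<bullet> D b) *\<^sub>R b)"
  by (simp add: euclidean_representation flip: adjoint_blinfun_inner)

lemma adjoint_blinfun_norm:
  fixes D :: "'a::euclidean_space \<Rightarrow>\<^sub>L 'b::euclidean_space"
  shows "norm (adjoint D p) \<le> norm D * norm p"
proof (cases "adjoint D p = 0")
  case False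
  have "norm (adjoint D p) * norm (adjoint D p) = p \<bullet> D (adjoint D p)"
    by (simp add: power2_norm_eq_inner flip: power2_eq_square adjoint_blinfun_inner)
  also have "\<dots> \<le> norm p * norm (D (adjoint D p))" by (rule norm_cauchy_schwarz)
  also have "\<dots> \<le> norm p * (norm D * norm (adjoint D p))"
    by (intro mult_left_mono norm_blinfun) simp
  finally show ?thesis using False by (simp add: mult_ac)
qed simp

lemma adjoint_scaled_blinfun:
  fixes D :: "'a::euclidean_space \<Rightarrow>\<^sub>L 'b::euclidean_space"
  shows "adjoint (\<lambda>y. c *\<^sub>R D y) = (\<lambda>p. c *\<^sub>R adjoint D p)"
  by (rule adjoint_unique) (simp add: adjoint_works[OF linear_blinfun])

lemma adjoint_perturbed_identity:
  fixes D :: "'a::euclidean_space \<Rightarrow>\<^sub>L 'a"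
  shows "adjoint (\<lambda>y. y + c *\<^sub>R D y) = (\<lambda>p. p + c *\<^sub>R adjoint D p)"
  by (rule adjoint_unique)
    (simp add: adjoint_works[OF linear_blinfun] inner_add_left inner_add_right)

section \<open>Duality between the tangent process and the adjoint along one noise path\<close>

definition path_cost :: "nat \<Rightarrow> real \<Rightarrow> ('x::euclidean_space, 'c::euclidean_space) control_problem
    \<Rightarrow> (nat \<Rightarrow> real) \<Rightarrow> (nat \<Rightarrow> 'c) \<Rightarrow> real" where
  "path_cost N h P \<xi> u = terminal_cost P (state h P \<xi> u N)
     + h * (\<Sum>n<N. running_cost P n (state h P \<xi> u n) (u n))"

lemma det_cost_eq: "det_cost N h P M \<xi> u = (\<integral>\<omega>. path_cost N h P (\<lambda>n. \<xi> n \<omega>) u \<partial>M)"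
  by (simp add: det_cost_def cost_def path_cost_def Let_def)

lemma state_cong: "(\<And>i. i < n \<Longrightarrow> \<xi> i = \<xi>' i) \<Longrightarrow> state h P \<xi> u n = state h P \<xi>' u n"
  by (induction n) simp_all

lemma adjoint_back_cong:
  assumes "\<And>i. i < N \<Longrightarrow> \<xi> i = \<xi>' i"
  shows "j \<le> N \<Longrightarrow> adjoint_back N h P \<xi> u j = adjoint_back N h P \<xi>' u j"
proof (induction j)
  case 0
  then show ?case using state_cong[of N \<xi> \<xi>' h P u] assms by simp
next
  case (Suc j)
  moreover have "state h P \<xi> u (N - Suc j) = state h P \<xi>' u (N - Suc j)"
    using assms by (intro state_cong) simp
  moreover have "\<xi> (N - Suc j) = \<xi>' (N - Suc j)" using assms Suc.prems by simp
  ultimately show ?case by (simp add: Let_def)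
qed

lemma phat_cong: "(\<And>i. i < N \<Longrightarrow> \<xi> i = \<xi>' i) \<Longrightarrow> phat N h P \<xi> u n = phat N h P \<xi>' u n"
  unfolding phat_def by (rule adjoint_back_cong) simp_all

text \<open>Permits replacing a noise sequence by its restriction to \<open>{..<N}\<close>, a point
  of a finite product space whose values from \<open>N\<close> on are
  \<open>undefined\<close>.\<close>

lemma ghat_cong:
  assumes "\<And>i. i < N \<Longrightarrow> \<xi> i = \<xi>' i"
  shows "ghat N h P \<xi> u = ghat N h P \<xi>' u"
proof
  fix n
  have "state h P \<xi> u n = state h P \<xi>' u n" if "n < N"
    using assms that by (intro state_cong) simp
  moreover have "phat N h P \<xi> u (Suc n) = phat N h P \<xi>' u (Suc n)"
    using assms by (rule phat_cong)
  ultimately show "ghat N h P \<xi> u n = ghat N h P \<xi>' u n"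
    using assms by (simp add: ghat_def Let_def)
qed

text \<open>The state equation linearised in the control direction \<open>v\<close>. It starts at 0
  because the initial state does not depend on the control.\<close>

primrec tangent :: "real \<Rightarrow> ('x::euclidean_space, 'c::euclidean_space) control_problem
    \<Rightarrow> (nat \<Rightarrow> real) \<Rightarrow> (nat \<Rightarrow> 'c) \<Rightarrow> (nat \<Rightarrow> 'c) \<Rightarrow> nat \<Rightarrow> 'x" where
  "tangent h P \<xi> u v 0 = 0"
| "tangent h P \<xi> u v (Suc n) = (let X = state h P \<xi> u n; Y = tangent h P \<xi> u v n in
     Y + h *\<^sub>R (deriv_x (drift P n) X (u n) Y + deriv_u (drift P n) X (u n) (v n))
     + (sqrt h * \<xi> n) *\<^sub>R (deriv_x (diffusion P n) X (u n) Y + deriv_u (diffusion P n) X (u n) (v n)))"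

locale smooth_control =
  fixes N :: nat and h L L' :: real and P :: "('x::euclidean_space, 'c::euclidean_space) control_problem"
  assumes h_pos: "h > 0" and L_pos: "L > 0" and L'_pos: "L' > 0"
    and smooth: "smooth_problem N L P" and growth: "growth_bounds N L' P"
begin

lemma
  assumes "n < N"
  shows C1_drift: "C1 (drift P n)" and C1_diffusion: "C1 (diffusion P n)"
    and C1_running: "C1 (running_cost P n)"
    and drift_x: "norm (deriv_x (drift P n) x u) \<le> L" and drift_u: "norm (deriv_u (drift P n) x u) \<le> L"
    and diffusion_x: "norm (deriv_x (diffusion P n) x u) \<le> L"
    and diffusion_u: "norm (deriv_u (diffusion P n) x u) \<le> L"
    and running_x: "norm (deriv_x (running_cost P n) x u) \<le> L"
    and running_u: "norm (deriv_u (running_cost P n) x u) \<le> L"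
  using smooth assms smooth_coeffD unfolding smooth_problem_def by blast+

lemma
  shows C1_terminal: "C1 (\<lambda>x (u :: 'c). terminal_cost P x)"
    and terminal_x: "norm (deriv_x (\<lambda>x (u :: 'c). terminal_cost P x) x u) \<le> L"
    and terminal_u: "norm (deriv_u (\<lambda>x (u :: 'c). terminal_cost P x) x u) \<le> L"
  using smooth smooth_coeffD unfolding smooth_problem_def by blast+

text \<open>Smoothness of the terminal cost is phrased for a function of state and control that is
  constant in the control; 0 is an arbitrary dummy control.\<close>

definition terminal_deriv :: "'x \<Rightarrow> 'x \<Rightarrow>\<^sub>L real" where
  "terminal_deriv x = deriv_x (\<lambda>x (u :: 'c). terminal_cost P x) x 0"

lemma terminal_frechet: "frechet_derivative (terminal_cost P) (at x) = terminal_deriv x"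
  using frechet_derivative_at[OF C1_has_derivative_x[OF C1_terminal, where u = 0 and x = x]]
  by (simp add: terminal_deriv_def)

lemma phat_terminal: "phat N h P \<xi> u N = adjoint (terminal_deriv (state h P \<xi> u N)) 1"
  by (simp add: phat_def terminal_frechet)

text \<open>\<open>adjoint_back\<close> counts time from the end. Here the recursion is put into
  forward time and the transposes are distributed over the sums, the form in which duality and
  measurability use it.\<close>

lemma phat_step:
  fixes \<xi> :: "nat \<Rightarrow> real" and u :: "nat \<Rightarrow> 'c"
  assumes "n < N"
  defines "X \<equiv> state h P \<xi> u n" and "p \<equiv> phat N h P \<xi> u (Suc n)"
  shows "phat N h P \<xi> u n = p + h *\<^sub>R adjoint (deriv_x (drift P n) X (u n)) p
    + (\<xi> n * sqrt h) *\<^sub>R adjoint (deriv_x (diffusion P n) X (u n)) p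
    + h *\<^sub>R adjoint (deriv_x (running_cost P n) X (u n)) 1"
proof -
  have "N - n = Suc (N - Suc n)" "N - Suc (N - Suc n) = n" using assms(1) by simp_all
  then show ?thesis
    by (simp add: phat_def X_def p_def Let_def adjoint_scaled_blinfun adjoint_perturbed_identity)
qed

lemma state_has_vector_derivative:
  "n \<le> N \<Longrightarrow> ((\<lambda>t. state h P \<xi> (\<lambda>k. u k + t *\<^sub>R v k) n) has_vector_derivative tangent h P \<xi> u v n) (at 0)"
proof (induction n)
  case 0
  then show ?case by simp
next
  case (Suc n)
  then have n: "n < N" and X: "((\<lambda>t. state h P \<xi> (\<lambda>k. u k + t *\<^sub>R v k) n) has_vector_derivative tangent h P \<xi> u v n) (at 0)"
    by simp_all
  have U: "((\<lambda>t. u n + t *\<^sub>R v n) has_vector_derivative v n) (at 0)"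
    by (auto intro!: derivative_eq_intros)
  show ?case
    using C1_chain_rule[OF C1_drift[OF n] X U] C1_chain_rule[OF C1_diffusion[OF n] X U]
    by (auto simp: Let_def intro!: derivative_eq_intros X)
qed

text \<open>Telescoping this identity eliminates the tangent process from the derivative of the cost.\<close>

lemma tangent_phat_step:
  fixes \<xi> :: "nat \<Rightarrow> real" and u v :: "nat \<Rightarrow> 'c"
  assumes "n < N"
  defines "X \<equiv> state h P \<xi> u n"
  shows "phat N h P \<xi> u (Suc n) \<bullet> tangent h P \<xi> u v (Suc n) - phat N h P \<xi> u n \<bullet> tangent h P \<xi> u v n
    = h * (ghat N h P \<xi> u n \<bullet> v n) - h * (deriv_x (running_cost P n) X (u n) (tangent h P \<xi> u v n)
      + deriv_u (running_cost P n) X (u n) (v n))"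
proof -
  \<comment> \<open>The weight \<open>h\<close> of the inner product turns the factor
    \<open>h powr (-1/2)\<close> in \<open>ghat\<close> into the \<open>sqrt h\<close> in front of
    the diffusion.\<close>
  have s: "h * h powr (- 1 / 2) = sqrt h"
    using h_pos powr_add[of h 1 "- 1 / 2"] by (simp add: powr_half_sqrt)
  show ?thesis
    unfolding phat_step[OF assms(1)] tangent.simps Let_def X_def[symmetric]
    using assms(1)
    by (simp add: ghat_def Let_def X_def[symmetric] inner_add_left inner_add_right adjoint_blinfun_inner
        distrib_left s[symmetric] mult_ac)
qed

lemma path_cost_has_derivative:
  "((\<lambda>t. path_cost N h P \<xi> (\<lambda>k. u k + t *\<^sub>R v k)) has_real_derivative
     hinner N h (ghat N h P \<xi> u) v) (at 0)"
proof -
  let ?X = "\<lambda>t n. state h P \<xi> (\<lambda>k. u k + t *\<^sub>R v k) n" and ?Y = "tangent h P \<xi> u v"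
  let ?l = "\<lambda>n. deriv_x (running_cost P n) (state h P \<xi> u n) (u n) (?Y n)
      + deriv_u (running_cost P n) (state h P \<xi> u n) (u n) (v n)"
  let ?T = "terminal_deriv (state h P \<xi> u N) (?Y N)"
  have U: "((\<lambda>t. u n + t *\<^sub>R v n) has_vector_derivative v n) (at 0)" for n
    by (auto intro!: derivative_eq_intros)
  have "((\<lambda>t. terminal_cost P (?X t N)) has_vector_derivative ?T) (at 0)"
    using C1_chain_rule[OF C1_terminal state_has_vector_derivative[of N \<xi> u v], of "\<lambda>_. 0" 0]
    by (simp add: terminal_deriv_def)
  moreover have "((\<lambda>t. running_cost P n (?X t n) (u n + t *\<^sub>R v n)) has_vector_derivative ?l n) (at 0)"
    if "n < N" for n
    using C1_chain_rule[OF C1_running[OF that] state_has_vector_derivative[of n \<xi> u v] U] that by simp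
  ultimately have "((\<lambda>t. path_cost N h P \<xi> (\<lambda>k. u k + t *\<^sub>R v k)) has_vector_derivative
      ?T + h * (\<Sum>n<N. ?l n)) (at 0)"
    unfolding path_cost_def
    by (intro has_vector_derivative_add has_vector_derivative_mult_right has_vector_derivative_sum) auto
  moreover have "?T + h * (\<Sum>n<N. ?l n) = hinner N h (ghat N h P \<xi> u) v"
  proof -
    \<comment> \<open>The boundary term at time 0 vanishes since the tangent starts at 0. After
      telescoping, the running-cost derivatives cancel against those of the cost, and only the
      pairing of \<open>ghat\<close> with \<open>v\<close> remains.\<close>
    have "?T = phat N h P \<xi> u N \<bullet> ?Y N - phat N h P \<xi> u 0 \<bullet> ?Y 0"
      by (simp add: phat_terminal adjoint_blinfun_inner)
    also have "\<dots> = (\<Sum>n<N. phat N h P \<xi> u (Suc n) \<bullet> ?Y (Suc n) - phat N h P \<xi> u n \<bullet> ?Y n)"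
      by (rule sum_lessThan_telescope[symmetric])
    also have "\<dots> = (\<Sum>n<N. h * (ghat N h P \<xi> u n \<bullet> v n) - h * ?l n)"
      by (intro sum.cong refl tangent_phat_step) simp
    finally show ?thesis
      by (simp add: hinner_def sum_subtractf sum_distrib_left)
  qed
  ultimately show ?thesis
    by (simp add: has_real_derivative_iff_has_vector_derivative)
qed

end

section \<open>Growth, Lipschitz bounds and measurability\<close>

text \<open>A common dominating function for all pathwise estimates. The leading 1 makes its powers
  increase with the exponent and absorbs additive constants.\<close>

definition noise_size :: "nat \<Rightarrow> (nat \<Rightarrow> real) \<Rightarrow> real" where
  "noise_size N \<xi> = 1 + (\<Sum>k<N. \<bar>\<xi> k\<bar>)"

lemma noise_size_ge_1: "1 \<le> noise_size N \<xi>"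
  by (simp add: noise_size_def sum_nonneg)

lemma abs_le_noise_size: "n < N \<Longrightarrow> \<bar>\<xi> n\<bar> \<le> noise_size N \<xi>"
  unfolding noise_size_def using member_le_sum[of n "{..<N}" "\<lambda>k. \<bar>\<xi> k\<bar>"] by simp

text \<open>The sum is at most its number of terms times the largest term. The constant is crude,
  but only finiteness of moments is drawn from it.\<close>

lemma power_sum_le:
  fixes a :: "'i \<Rightarrow> real"
  assumes "finite I" "\<And>i. i \<in> I \<Longrightarrow> 0 \<le> a i" "I \<noteq> {}"
  shows "(\<Sum>i\<in>I. a i) ^ p \<le> real (card I) ^ p * (\<Sum>i\<in>I. a i ^ p)"
proof -
  have "Max (a ` I) \<in> a ` I" using assms by (intro Max_in) auto
  then obtain j where "j \<in> I" "Max (a ` I) = a j" by auto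
  then have j: "j \<in> I" "\<And>i. i \<in> I \<Longrightarrow> a i \<le> a j"
    using assms(1) by (auto simp flip: \<open>Max (a ` I) = a j\<close>)
  have "(\<Sum>i\<in>I. a i) \<le> real (card I) * a j"
    using sum_bounded_above[of I a "a j"] j by simp
  then have "(\<Sum>i\<in>I. a i) ^ p \<le> (real (card I) * a j) ^ p"
    using assms by (intro power_mono sum_nonneg) auto
  also have "\<dots> = real (card I) ^ p * a j ^ p" by (rule power_mult_distrib)
  also have "\<dots> \<le> real (card I) ^ p * (\<Sum>i\<in>I. a i ^ p)"
    using assms j(1) by (intro mult_left_mono member_le_sum) auto
  finally show ?thesis .
qed

lemma (in fbm_noise) noise_size_moment: "integrable M (\<lambda>\<omega>. noise_size N (\<lambda>n. \<xi> n \<omega>) ^ p)"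
proof (rule Bochner_Integration.integrable_bound)
  show "integrable M (\<lambda>\<omega>. real (Suc N) ^ p * (1 + (\<Sum>k<N. \<bar>\<xi> k \<omega>\<bar> ^ p)))"
    by (intro integrable_mult_right Bochner_Integration.integrable_add Bochner_Integration.integrable_sum
        gaussian_rv_abs_moment gaussian_fgn) simp
  show "(\<lambda>\<omega>. noise_size N (\<lambda>n. \<xi> n \<omega>) ^ p) \<in> borel_measurable M"
    unfolding noise_size_def by measurable
  show "AE \<omega> in M. norm (noise_size N (\<lambda>n. \<xi> n \<omega>) ^ p)
      \<le> norm (real (Suc N) ^ p * (1 + (\<Sum>k<N. \<bar>\<xi> k \<omega>\<bar> ^ p)))"
  proof (rule AE_I2)
    fix \<omega>
    \<comment> \<open>The summand 1 is stored as the value at index \<open>N\<close>, so that the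
      noise size becomes a plain sum of \<open>Suc N\<close> terms.\<close>
    define a where "a k = (if k < N then \<bar>\<xi> k \<omega>\<bar> else 1)" for k
    have "noise_size N (\<lambda>n. \<xi> n \<omega>) = (\<Sum>k<Suc N. a k)" "1 + (\<Sum>k<N. \<bar>\<xi> k \<omega>\<bar> ^ p) = (\<Sum>k<Suc N. a k ^ p)"
      by (simp_all add: noise_size_def a_def)
    moreover have "(\<Sum>k<Suc N. a k) ^ p \<le> real (card {..<Suc N}) ^ p * (\<Sum>k<Suc N. a k ^ p)"
      by (rule power_sum_le) (auto simp: a_def)
    moreover have "0 \<le> (\<Sum>k<Suc N. a k) ^ p"
      by (intro zero_le_power sum_nonneg) (simp add: a_def)
    ultimately show "norm (noise_size N (\<lambda>n. \<xi> n \<omega>) ^ p)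
      \<le> norm (real (Suc N) ^ p * (1 + (\<Sum>k<N. \<bar>\<xi> k \<omega>\<bar> ^ p)))"
      by (simp del: sum.lessThan_Suc of_nat_Suc)
  qed
qed

context smooth_control
begin

lemma drift_lipschitz: "n < N \<Longrightarrow> norm (drift P n x u - drift P n x' u') \<le> L * (norm (x - x') + norm (u - u'))"
  by (intro C1_lipschitz C1_drift drift_x drift_u)

lemma diffusion_lipschitz:
  "n < N \<Longrightarrow> norm (diffusion P n x u - diffusion P n x' u') \<le> L * (norm (x - x') + norm (u - u'))"
  by (intro C1_lipschitz C1_diffusion diffusion_x diffusion_u)

lemma running_lipschitz:
  "n < N \<Longrightarrow> \<bar>running_cost P n x u - running_cost P n x' u'\<bar> \<le> L * (norm (x - x') + norm (u - u'))"
  using C1_lipschitz[OF C1_running running_x running_u, where x = x and u = u and x' = x' and u' = u'] by simp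

lemma terminal_lipschitz: "\<bar>terminal_cost P x - terminal_cost P x'\<bar> \<le> L * norm (x - x')"
  using C1_lipschitz[OF C1_terminal terminal_x terminal_u, where x = x and u = 0 and x' = x' and u' = 0] by simp

text \<open>The bound stays linear in the noise because each increment multiplies a diffusion
  bounded by \<open>L'\<close>, independently of the state; no products of increments build
  up.\<close>

lemma state_growth: "n \<le> N \<Longrightarrow> \<exists>A\<ge>0. \<forall>\<xi>. norm (state h P \<xi> u n) \<le> A * noise_size N \<xi>"
proof (induction n)
  case 0
  have "norm (init_state P) \<le> norm (init_state P) * noise_size N \<xi>" for \<xi>
    using mult_left_mono[OF noise_size_ge_1[of N \<xi>], of "norm (init_state P)"] by simp
  then show ?case by (intro exI[of _ "norm (init_state P)"]) simp
next
  case (Suc n)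
  then obtain A where A: "A \<ge> 0" "\<And>\<xi>. norm (state h P \<xi> u n) \<le> A * noise_size N \<xi>" by auto
  let ?A = "A + h * (L' * (1 + A + norm (u n))) + sqrt h * L'"
  have "norm (state h P \<xi> u (Suc n)) \<le> ?A * noise_size N \<xi>" for \<xi>
  proof -
    define m where "m = noise_size N \<xi>"
    have m: "1 \<le> m" "\<bar>\<xi> n\<bar> \<le> m"
      using noise_size_ge_1 abs_le_noise_size[of n N \<xi>] Suc.prems by (simp_all add: m_def)
    let ?X = "state h P \<xi> u n"
    have "norm (drift P n ?X (u n)) \<le> L' * (1 + norm ?X + norm (u n))"
      and s: "norm (diffusion P n ?X (u n)) \<le> L'"
      using growth Suc.prems by (simp_all add: growth_bounds_def)
    note this(1)
    also have "L' * (1 + norm ?X + norm (u n)) \<le> L' * (1 * m + A * m + norm (u n) * m)"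
      using A(2)[of \<xi>] m L'_pos mult_left_mono[of 1 m "norm (u n)"]
      by (intro mult_left_mono add_mono) (simp_all add: m_def)
    finally have b: "norm (drift P n ?X (u n)) \<le> L' * (1 + A + norm (u n)) * m" by (simp add: algebra_simps)
    have "norm (state h P \<xi> u (Suc n)) \<le> norm ?X + h * norm (drift P n ?X (u n))
        + sqrt h * \<bar>\<xi> n\<bar> * norm (diffusion P n ?X (u n))"
      using h_pos by (simp add: norm_triangle_le norm_triangle_mono abs_mult)
    also have "\<dots> \<le> A * m + h * (L' * (1 + A + norm (u n)) * m) + sqrt h * m * L'"
      using A(2)[of \<xi>] b s m h_pos L'_pos by (intro add_mono mult_mono) (auto simp: m_def)
    finally show ?thesis by (simp add: m_def algebra_simps)
  qed
  moreover have "?A \<ge> 0" using A(1) h_pos L'_pos by simp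
  ultimately show ?case by blast
qed

lemma path_cost_growth: "\<exists>A\<ge>0. \<forall>\<xi>. \<bar>path_cost N h P \<xi> u\<bar> \<le> A * noise_size N \<xi>"
proof -
  have "\<forall>n\<in>{..N}. \<exists>A. A \<ge> 0 \<and> (\<forall>\<xi>. norm (state h P \<xi> u n) \<le> A * noise_size N \<xi>)"
    using state_growth[of _ u] by auto
  then obtain A where A: "\<And>n. n \<le> N \<Longrightarrow> A n \<ge> 0"
    "\<And>n \<xi>. n \<le> N \<Longrightarrow> norm (state h P \<xi> u n) \<le> A n * noise_size N \<xi>"
    unfolding bchoice_iff by (metis atMost_iff)
  define a where "a n = \<bar>running_cost P n 0 0\<bar> + L * (A n + norm (u n))" for n
  define a' where "a' = \<bar>terminal_cost P 0\<bar> + L * A N"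
  have up: "r \<le> r * noise_size N \<xi>" if "r \<ge> 0" for r \<xi>
    using mult_left_mono[OF noise_size_ge_1 that] by simp
  have "\<bar>path_cost N h P \<xi> u\<bar> \<le> (a' + h * (\<Sum>n<N. a n)) * noise_size N \<xi>" for \<xi>
  proof -
    let ?X = "state h P \<xi> u" and ?m = "noise_size N \<xi>"
    have "\<bar>running_cost P n (?X n) (u n)\<bar> \<le> a n * ?m" if "n < N" for n
    proof -
      have "\<bar>running_cost P n (?X n) (u n)\<bar> \<le> \<bar>running_cost P n 0 0\<bar> + L * (norm (?X n) + norm (u n))"
        using running_lipschitz[OF that, of "?X n" "u n" 0 0] by simp
      also have "\<dots> \<le> \<bar>running_cost P n 0 0\<bar> * ?m + L * (A n * ?m + norm (u n) * ?m)"
        using A(2)[of n \<xi>] that L_pos by (intro add_mono mult_left_mono up) auto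
      finally show ?thesis by (simp add: a_def algebra_simps)
    qed
    then have "\<bar>\<Sum>n<N. running_cost P n (?X n) (u n)\<bar> \<le> (\<Sum>n<N. a n * ?m)"
      by (intro order_trans[OF sum_abs] sum_mono) simp
    moreover have "\<bar>terminal_cost P (?X N)\<bar> \<le> a' * ?m"
    proof -
      have "\<bar>terminal_cost P (?X N)\<bar> \<le> \<bar>terminal_cost P 0\<bar> + L * norm (?X N)"
        using terminal_lipschitz[of "?X N" 0] by simp
      also have "\<dots> \<le> \<bar>terminal_cost P 0\<bar> * ?m + L * (A N * ?m)"
        using A(2)[of N \<xi>] L_pos by (intro add_mono mult_left_mono up) auto
      finally show ?thesis by (simp add: a'_def algebra_simps)
    qed
    ultimately have "\<bar>path_cost N h P \<xi> u\<bar> \<le> a' * ?m + h * (\<Sum>n<N. a n * ?m)"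
      unfolding path_cost_def using h_pos
      by (intro order_trans[OF abs_triangle_ineq] add_mono) (simp_all add: abs_mult)
    then show ?thesis by (simp add: distrib_right sum_distrib_right mult.assoc)
  qed
  moreover have "a' + h * (\<Sum>n<N. a n) \<ge> 0"
    using A(1) L_pos h_pos by (auto simp: a_def a'_def intro!: add_nonneg_nonneg mult_nonneg_nonneg sum_nonneg)
  ultimately show ?thesis by blast
qed

text \<open>Differences of the diffusion are controlled only by differences of the states, which
  already contain earlier increments. Each time step therefore costs one more power of the noise
  size, in contrast to \<open>state_growth\<close>.\<close>

lemma state_lipschitz: "n \<le> N \<Longrightarrow> \<exists>Q\<ge>0. \<forall>\<xi>. \<forall>t\<ge>0.
    norm (state h P \<xi> (\<lambda>k. u k + t *\<^sub>R v k) n - state h P \<xi> u n) \<le> t * Q * noise_size N \<xi> ^ n"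
proof (induction n)
  case 0
  then show ?case by (intro exI[of _ 0]) simp
next
  case (Suc n)
  then obtain Q where Q: "Q \<ge> 0" "\<And>\<xi> t. t \<ge> 0 \<Longrightarrow>
    norm (state h P \<xi> (\<lambda>k. u k + t *\<^sub>R v k) n - state h P \<xi> u n) \<le> t * Q * noise_size N \<xi> ^ n"
    by auto
  let ?c = "L * (Q + norm (v n))"
  let ?Q = "Q + h * ?c + sqrt h * ?c"
  have "norm (state h P \<xi> (\<lambda>k. u k + t *\<^sub>R v k) (Suc n) - state h P \<xi> u (Suc n)) \<le> t * ?Q * noise_size N \<xi> ^ Suc n"
    if t: "t \<ge> 0" for \<xi> t
  proof -
    define m where "m = noise_size N \<xi>"
    have m: "1 \<le> m" "\<bar>\<xi> n\<bar> \<le> m" and n: "n < N"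
      using noise_size_ge_1 abs_le_noise_size[of n N \<xi>] Suc.prems by (simp_all add: m_def)
    then have mn: "1 \<le> m ^ n" by simp
    let ?X = "state h P \<xi> u n" and ?X' = "state h P \<xi> (\<lambda>k. u k + t *\<^sub>R v k) n"
    let ?D = "norm (?X' - ?X)"
    have D: "?D \<le> t * Q * m ^ n" using Q(2)[OF t] by (simp add: m_def)
    have "norm (v n) * t \<le> norm (v n) * t * m ^ n"
      using mult_left_mono[OF mn, of "norm (v n) * t"] t by simp
    with D have "L * (?D + t * norm (v n)) \<le> L * (t * Q * m ^ n + t * norm (v n) * m ^ n)"
      using L_pos by (intro mult_left_mono) (simp_all add: mult_ac)
    then have c: "L * (?D + t * norm (v n)) \<le> t * ?c * m ^ n" by (simp add: algebra_simps)
    have "norm (drift P n ?X' (u n + t *\<^sub>R v n) - drift P n ?X (u n)) \<le> L * (?D + t * norm (v n))"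
      "norm (diffusion P n ?X' (u n + t *\<^sub>R v n) - diffusion P n ?X (u n)) \<le> L * (?D + t * norm (v n))"
      using drift_lipschitz[OF n, of ?X' "u n + t *\<^sub>R v n" ?X "u n"] t
        diffusion_lipschitz[OF n, of ?X' "u n + t *\<^sub>R v n" ?X "u n"] by simp_all
    with c have b: "norm (drift P n ?X' (u n + t *\<^sub>R v n) - drift P n ?X (u n)) \<le> t * ?c * m ^ n"
      and s: "norm (diffusion P n ?X' (u n + t *\<^sub>R v n) - diffusion P n ?X (u n)) \<le> t * ?c * m ^ n"
      by linarith+
    have "state h P \<xi> (\<lambda>k. u k + t *\<^sub>R v k) (Suc n) - state h P \<xi> u (Suc n)
      = (?X' - ?X) + h *\<^sub>R (drift P n ?X' (u n + t *\<^sub>R v n) - drift P n ?X (u n))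
        + (sqrt h * \<xi> n) *\<^sub>R (diffusion P n ?X' (u n + t *\<^sub>R v n) - diffusion P n ?X (u n))"
      by (simp add: algebra_simps)
    then have "norm (state h P \<xi> (\<lambda>k. u k + t *\<^sub>R v k) (Suc n) - state h P \<xi> u (Suc n))
      \<le> ?D + h * norm (drift P n ?X' (u n + t *\<^sub>R v n) - drift P n ?X (u n))
        + sqrt h * \<bar>\<xi> n\<bar> * norm (diffusion P n ?X' (u n + t *\<^sub>R v n) - diffusion P n ?X (u n))"
      using h_pos by (simp add: norm_triangle_le norm_triangle_mono abs_mult del: state.simps)
    also have "\<dots> \<le> t * Q * m ^ n + h * (t * ?c * m ^ n) + sqrt h * m * (t * ?c * m ^ n)"
      using D b s m h_pos by (intro add_mono mult_mono) auto
    also have "\<dots> \<le> t * Q * (m * m ^ n) + h * (t * ?c * (m * m ^ n)) + sqrt h * m * (t * ?c * m ^ n)"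
    proof -
      have "m ^ n \<le> m * m ^ n" using mult_right_mono[OF m(1), of "m ^ n"] mn by simp
      then show ?thesis
        using t Q(1) L_pos h_pos by (intro add_mono mult_left_mono order_refl mult_nonneg_nonneg) auto
    qed
    finally show ?thesis by (simp add: m_def algebra_simps)
  qed
  moreover have "?Q \<ge> 0" using Q(1) h_pos L_pos by simp
  ultimately show ?case by blast
qed

text \<open>After division by \<open>t\<close> the right-hand side is a dominating function for the
  difference quotients of the cost, uniform in \<open>t\<close> and integrable by
  \<open>noise_size_moment\<close>.\<close>

lemma path_cost_lipschitz: "\<exists>Q\<ge>0. \<forall>\<xi>. \<forall>t\<ge>0.
    \<bar>path_cost N h P \<xi> (\<lambda>k. u k + t *\<^sub>R v k) - path_cost N h P \<xi> u\<bar> \<le> t * Q * noise_size N \<xi> ^ N"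
proof -
  have "\<forall>n\<in>{..N}. \<exists>Q. Q \<ge> 0 \<and> (\<forall>\<xi>. \<forall>t\<ge>0.
    norm (state h P \<xi> (\<lambda>k. u k + t *\<^sub>R v k) n - state h P \<xi> u n) \<le> t * Q * noise_size N \<xi> ^ n)"
    using state_lipschitz[of _ u v] by auto
  then obtain Q where Q: "\<And>n. n \<le> N \<Longrightarrow> Q n \<ge> 0" "\<And>n \<xi> t. n \<le> N \<Longrightarrow> t \<ge> 0 \<Longrightarrow>
    norm (state h P \<xi> (\<lambda>k. u k + t *\<^sub>R v k) n - state h P \<xi> u n) \<le> t * Q n * noise_size N \<xi> ^ n"
    unfolding bchoice_iff by (metis atMost_iff)
  let ?Q = "L * Q N + h * (\<Sum>n<N. L * (Q n + norm (v n)))"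
  have "\<bar>path_cost N h P \<xi> (\<lambda>k. u k + t *\<^sub>R v k) - path_cost N h P \<xi> u\<bar> \<le> t * ?Q * noise_size N \<xi> ^ N"
    if t: "t \<ge> 0" for \<xi> t
  proof -
    let ?X = "state h P \<xi> u" and ?X' = "state h P \<xi> (\<lambda>k. u k + t *\<^sub>R v k)" and ?m = "noise_size N \<xi> ^ N"
    have D: "norm (?X' n - ?X n) \<le> t * Q n * ?m" if "n \<le> N" for n
    proof -
      have "noise_size N \<xi> ^ n \<le> ?m" using noise_size_ge_1 that by (intro power_increasing) auto
      then have "t * Q n * noise_size N \<xi> ^ n \<le> t * Q n * ?m"
        using t Q(1)[OF that] by (intro mult_left_mono) auto
      with Q(2)[OF that t, of \<xi>] show ?thesis by linarith
    qed
    have 1: "1 \<le> ?m" using noise_size_ge_1 by simp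
    let ?d = "\<lambda>n. running_cost P n (?X' n) (u n + t *\<^sub>R v n) - running_cost P n (?X n) (u n)"
    have "\<bar>?d n\<bar> \<le> t * (L * (Q n + norm (v n))) * ?m" if "n < N" for n
    proof -
      have "\<bar>?d n\<bar> \<le> L * (norm (?X' n - ?X n) + t * norm (v n))"
        using running_lipschitz[OF that, of "?X' n" "u n + t *\<^sub>R v n" "?X n" "u n"] t by simp
      also have "\<dots> \<le> L * (t * Q n * ?m + t * norm (v n) * ?m)"
        using L_pos D[of n] that t 1 mult_left_mono[OF 1, of "t * norm (v n)"]
        by (intro mult_left_mono add_mono) auto
      finally show ?thesis by (simp add: algebra_simps)
    qed
    then have "\<bar>\<Sum>n<N. ?d n\<bar> \<le> (\<Sum>n<N. t * (L * (Q n + norm (v n))) * ?m)"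
      by (intro order_trans[OF sum_abs] sum_mono) simp
    moreover have "\<bar>terminal_cost P (?X' N) - terminal_cost P (?X N)\<bar> \<le> L * (t * Q N * ?m)"
      using terminal_lipschitz[of "?X' N" "?X N"] D[of N] L_pos
      by (meson order_trans mult_left_mono less_imp_le order_refl)
    ultimately have "\<bar>(terminal_cost P (?X' N) - terminal_cost P (?X N)) + h * (\<Sum>n<N. ?d n)\<bar>
        \<le> L * (t * Q N * ?m) + h * (\<Sum>n<N. t * (L * (Q n + norm (v n))) * ?m)"
      using h_pos by (intro order_trans[OF abs_triangle_ineq] add_mono) (simp_all add: abs_mult)
    moreover have "(terminal_cost P (?X' N) - terminal_cost P (?X N)) + h * (\<Sum>n<N. ?d n)
        = path_cost N h P \<xi> (\<lambda>k. u k + t *\<^sub>R v k) - path_cost N h P \<xi> u"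
      by (simp add: path_cost_def sum_subtractf algebra_simps)
    moreover have "L * (t * Q N * ?m) + h * (\<Sum>n<N. t * (L * (Q n + norm (v n))) * ?m) = t * ?Q * ?m"
      by (simp add: distrib_left distrib_right sum_distrib_left sum_distrib_right mult_ac)
    ultimately show ?thesis by simp
  qed
  moreover have "?Q \<ge> 0"
    using Q(1) L_pos h_pos by (intro add_nonneg_nonneg mult_nonneg_nonneg sum_nonneg) auto
  ultimately show ?thesis by blast
qed

section \<open>Joint measurability when both noise and control are random\<close>

context
  fixes \<Omega> :: "'w measure" and \<xi> :: "nat \<Rightarrow> 'w \<Rightarrow> real" and u :: "nat \<Rightarrow> 'w \<Rightarrow> 'c"
  assumes \<xi>_meas: "\<And>n. n < N \<Longrightarrow> \<xi> n \<in> borel_measurable \<Omega>"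
    and u_meas: "\<And>n. n < N \<Longrightarrow> u n \<in> borel_measurable \<Omega>"
begin

lemma state_measurable:
  "n \<le> N \<Longrightarrow> (\<lambda>\<omega>. state h P (\<lambda>i. \<xi> i \<omega>) (\<lambda>i. u i \<omega>) n) \<in> borel_measurable \<Omega>"
proof (induction n)
  case (Suc n)
  then have n: "n < N" and X: "(\<lambda>\<omega>. state h P (\<lambda>i. \<xi> i \<omega>) (\<lambda>i. u i \<omega>) n) \<in> borel_measurable \<Omega>"
    by simp_all
  show ?case
    using C1_measurable[OF C1_drift[OF n] X u_meas[OF n]] C1_measurable[OF C1_diffusion[OF n] X u_meas[OF n]]
      X \<xi>_meas[OF n] by simp
qed simp

lemma adjoint_blinfun_measurable:
  fixes D :: "'w \<Rightarrow> 'e::euclidean_space \<Rightarrow>\<^sub>L 'f::euclidean_space"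
  assumes "\<And>b. (\<lambda>\<omega>. D \<omega> b) \<in> borel_measurable \<Omega>" "p \<in> borel_measurable \<Omega>"
  shows "(\<lambda>\<omega>. adjoint (D \<omega>) (p \<omega>)) \<in> borel_measurable \<Omega>"
  unfolding adjoint_blinfun_expand using assms
  by (intro borel_measurable_sum borel_measurable_scaleR borel_measurable_inner) auto

lemma path_cost_measurable:
  "(\<lambda>\<omega>. path_cost N h P (\<lambda>i. \<xi> i \<omega>) (\<lambda>i. u i \<omega>)) \<in> borel_measurable \<Omega>"
proof -
  have "(\<lambda>\<omega>. terminal_cost P (state h P (\<lambda>i. \<xi> i \<omega>) (\<lambda>i. u i \<omega>) N)) \<in> borel_measurable \<Omega>"
    using C1_measurable[OF C1_terminal state_measurable[of N], of "\<lambda>_. 0"] by simp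
  moreover have "(\<lambda>\<omega>. running_cost P n (state h P (\<lambda>i. \<xi> i \<omega>) (\<lambda>i. u i \<omega>) n) (u n \<omega>)) \<in> borel_measurable \<Omega>"
    if "n < N" for n
    using that C1_measurable[OF C1_running state_measurable[of n] u_meas, of n n] by simp
  ultimately show ?thesis
    unfolding path_cost_def
    by (intro borel_measurable_add borel_measurable_times borel_measurable_sum borel_measurable_const) auto
qed

lemma phat_measurable:
  "n \<le> N \<Longrightarrow> (\<lambda>\<omega>. phat N h P (\<lambda>i. \<xi> i \<omega>) (\<lambda>i. u i \<omega>) n) \<in> borel_measurable \<Omega>"
proof (induction n rule: inc_induct)
  case base
  show ?case
    unfolding phat_terminal terminal_deriv_def
    by (intro adjoint_blinfun_measurable C1_deriv_x_measurable C1_terminal state_measurable) simp_all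
next
  case (step n)
  then have X: "(\<lambda>\<omega>. state h P (\<lambda>i. \<xi> i \<omega>) (\<lambda>i. u i \<omega>) n) \<in> borel_measurable \<Omega>"
    by (intro state_measurable) simp
  have n: "n < N" by fact
  show ?case
    unfolding phat_step[OF n]
    by (intro borel_measurable_add borel_measurable_scaleR borel_measurable_times borel_measurable_const
        adjoint_blinfun_measurable C1_deriv_x_measurable C1_drift[OF n] C1_diffusion[OF n] C1_running[OF n]
        X step.IH \<xi>_meas u_meas n)
qed

lemma ghat_measurable:
  "(\<lambda>\<omega>. ghat N h P (\<lambda>i. \<xi> i \<omega>) (\<lambda>i. u i \<omega>) n) \<in> borel_measurable \<Omega>"
proof (cases "n < N")
  case True
  then have "Suc n \<le> N" "n \<le> N" by simp_all
  then show ?thesis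
    unfolding ghat_def Let_def if_P[OF True]
    by (intro borel_measurable_add borel_measurable_scaleR borel_measurable_times borel_measurable_const
        adjoint_blinfun_measurable C1_deriv_u_measurable C1_drift[OF True] C1_diffusion[OF True]
        C1_running[OF True] state_measurable phat_measurable \<xi>_meas[OF True] u_meas[OF True])
next
  case False
  then show ?thesis by (simp add: ghat_def)
qed

end

lemma ghat_norm_bound:
  assumes "n < N"
  shows "norm (ghat N h P \<xi> u n) \<le> L * norm (phat N h P \<xi> u (Suc n)) + L
    + h powr (-1/2) * L * (\<bar>\<xi> n\<bar> * norm (phat N h P \<xi> u (Suc n)))"
proof -
  let ?X = "state h P \<xi> u n" and ?p = "phat N h P \<xi> u (Suc n)"
  have a: "norm (adjoint (blinfun_apply D) q) \<le> L * norm q" if "norm D \<le> L"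
    for D :: "'c \<Rightarrow>\<^sub>L 'y::euclidean_space" and q
    by (rule order_trans[OF adjoint_blinfun_norm mult_right_mono[OF that]]) simp
  have "norm (ghat N h P \<xi> u n) \<le> norm (adjoint (deriv_u (drift P n) ?X (u n)) ?p)
      + norm (adjoint (deriv_u (running_cost P n) ?X (u n)) 1)
      + h powr (-1/2) * \<bar>\<xi> n\<bar> * norm (adjoint (deriv_u (diffusion P n) ?X (u n)) ?p)"
    using assms h_pos by (simp add: ghat_def Let_def norm_triangle_le norm_triangle_mono abs_mult)
  also have "\<dots> \<le> L * norm ?p + L * norm (1 :: real) + h powr (-1/2) * \<bar>\<xi> n\<bar> * (L * norm ?p)"
    using assms by (intro add_mono a mult_left_mono drift_u running_u diffusion_u) auto
  finally show ?thesis by (simp add: mult_ac)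
qed

end

section \<open>Gradient and projection in the space of deterministic controls\<close>

lemma hinner_nonneg: "h > 0 \<Longrightarrow> 0 \<le> hinner N h u u"
  by (simp add: hinner_def sum_nonneg)

lemma hnorm_sq: "h > 0 \<Longrightarrow> (hnorm N h u)\<^sup>2 = h * (\<Sum>n<N. (norm (u n))\<^sup>2)"
  using hinner_nonneg[of h N u] by (simp add: hnorm_def hinner_def power2_norm_eq_inner)

lemma hnorm_nonneg: "h > 0 \<Longrightarrow> 0 \<le> hnorm N h u"
  by (simp add: hnorm_def hinner_nonneg)

lemma hnorm_scaleR: "h > 0 \<Longrightarrow> hnorm N h (\<lambda>n. t *\<^sub>R v n) = \<bar>t\<bar> * hnorm N h v"
proof -
  assume "h > 0"
  then have "(hnorm N h (\<lambda>n. t *\<^sub>R v n))\<^sup>2 = (\<bar>t\<bar> * hnorm N h v)\<^sup>2"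
    by (simp add: hnorm_sq power_mult_distrib sum_distrib_left mult_ac)
  then show ?thesis
    using \<open>h > 0\<close> by (simp add: power2_eq_iff_nonneg hnorm_nonneg)
qed

lemma hinner_scaleR_right: "hinner N h u (\<lambda>n. t *\<^sub>R v n) = t * hinner N h u v"
  by (simp add: hinner_def sum_distrib_left mult_ac)

lemma hinner_diff_left: "hinner N h (\<lambda>n. u n - u' n) v = hinner N h u v - hinner N h u' v"
  by (simp add: hinner_def inner_diff_left sum_subtractf right_diff_distrib)

text \<open>Weaker than Cauchy-Schwarz, but in a form that derives integrability of an inner product
  directly from that of the two squared norms.\<close>

lemma abs_hinner_le: "h > 0 \<Longrightarrow> \<bar>hinner N h u v\<bar> \<le> (hnorm N h u)\<^sup>2 + (hnorm N h v)\<^sup>2"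
proof -
  assume h: "h > 0"
  have "\<bar>u n \<bullet> v n\<bar> \<le> (norm (u n))\<^sup>2 + (norm (v n))\<^sup>2" for n
  proof -
    have "\<bar>u n \<bullet> v n\<bar> \<le> norm (u n) * norm (v n)" by (rule Cauchy_Schwarz_ineq2)
    also have "\<dots> \<le> (norm (u n))\<^sup>2 + (norm (v n))\<^sup>2"
      using sum_squares_bound[of "norm (u n)" "norm (v n)"]
        mult_nonneg_nonneg[OF norm_ge_zero[of "u n"] norm_ge_zero[of "v n"]] by linarith
    finally show ?thesis .
  qed
  then have "\<bar>\<Sum>n<N. u n \<bullet> v n\<bar> \<le> (\<Sum>n<N. (norm (u n))\<^sup>2 + (norm (v n))\<^sup>2)"
    by (intro order_trans[OF sum_abs] sum_mono)
  then show ?thesis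
    using h by (simp add: hnorm_sq hinner_def abs_mult sum.distrib flip: distrib_left)
qed

lemma hnorm_diff_scaled_sq: "h > 0 \<Longrightarrow> (hnorm N h (\<lambda>n. w n - \<eta> *\<^sub>R g n))\<^sup>2
    = (hnorm N h w)\<^sup>2 - 2 * \<eta> * hinner N h g w + \<eta>\<^sup>2 * (hnorm N h g)\<^sup>2"
proof -
  assume h: "h > 0"
  have "(norm (w n - \<eta> *\<^sub>R g n))\<^sup>2 = (norm (w n))\<^sup>2 - 2 * \<eta> * (g n \<bullet> w n) + \<eta>\<^sup>2 * (norm (g n))\<^sup>2" for n
    unfolding power2_norm_eq_inner
    by (simp add: inner_diff_left inner_diff_right inner_commute algebra_simps power2_eq_square)
  then have sum: "(\<Sum>n<N. (norm (w n - \<eta> *\<^sub>R g n))\<^sup>2)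
      = (\<Sum>n<N. (norm (w n))\<^sup>2) - 2 * \<eta> * (\<Sum>n<N. g n \<bullet> w n) + \<eta>\<^sup>2 * (\<Sum>n<N. (norm (g n))\<^sup>2)"
    by (simp only: sum.distrib sum_subtractf sum_distrib_left)
  show ?thesis
    unfolding hnorm_sq[OF h] sum hinner_def by (simp add: algebra_simps)
qed

lemma Hdet_diff: "u \<in> Hdet N \<Longrightarrow> v \<in> Hdet N \<Longrightarrow> (\<lambda>n. u n - v n) \<in> Hdet N"
  by (simp add: Hdet_def)

lemma Udet_subset_Hdet: "u \<in> Udet N U \<Longrightarrow> u \<in> Hdet N"
  by (simp add: Udet_def)

lemma Udet_convex_combination:
  assumes "convex U" "u \<in> Udet N U" "v \<in> Udet N U" "0 \<le> t" "t \<le> 1"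
  shows "(\<lambda>n. u n + t *\<^sub>R (v n - u n)) \<in> Udet N U"
proof -
  have "u n + t *\<^sub>R (v n - u n) = (1 - t) *\<^sub>R u n + t *\<^sub>R v n" for n
    by (simp add: algebra_simps)
  then show ?thesis
    using assms by (auto simp: Udet_def Hdet_def intro!: convexD)
qed

lemma hinner_eq_zero_imp:
  assumes "h > 0" "u \<in> Hdet N" "hinner N h u u = 0"
  shows "u = (\<lambda>_. 0)"
proof
  fix n
  have "(\<Sum>n<N. u n \<bullet> u n) = 0" using assms by (simp add: hinner_def)
  then have "\<forall>n\<in>{..<N}. u n \<bullet> u n = 0" by (subst (asm) sum_nonneg_eq_0_iff) auto
  then show "u n = 0" using assms(2) by (cases "n < N") (auto simp: Hdet_def)
qed

text \<open>The limit is taken along the steps 1 / (k + 1), so that it can be matched with the limit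
  that dominated convergence provides for the same sequence.\<close>

lemma has_hgradient_directional:
  assumes h: "h > 0" and G: "has_hgradient N h J u G" and v: "v \<in> Hdet N"
  shows "(\<lambda>k. (J (\<lambda>n. u n + (1 / real (Suc k)) *\<^sub>R v n) - J u) * real (Suc k)) \<longlonglongrightarrow> hinner N h G v"
proof (rule LIMSEQ_I)
  fix r :: real assume r: "r > 0"
  \<comment> \<open>Adding 1 keeps \<open>c\<close> positive when \<open>v\<close> has norm zero and
    makes the later estimates strict.\<close>
  define c where "c = hnorm N h v + 1"
  have c: "c > 0" "hnorm N h v < c" using hnorm_nonneg[OF h, of N v] by (simp_all add: c_def)
  obtain \<delta> where \<delta>: "\<delta> > 0" and
    bound: "\<And>w. w \<in> Hdet N \<Longrightarrow> hnorm N h w < \<delta> \<Longrightarrow>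
      \<bar>J (\<lambda>n. u n + w n) - J u - hinner N h G w\<bar> \<le> (r / c) * hnorm N h w"
    using G r c(1) unfolding has_hgradient_def by (metis divide_pos_pos)
  obtain k0 where k0: "1 / real (Suc k0) < \<delta> / c"
    using \<delta> c nat_approx_posE[of "\<delta> / c"] by auto
  show "\<exists>k0. \<forall>k\<ge>k0. norm ((J (\<lambda>n. u n + (1 / real (Suc k)) *\<^sub>R v n) - J u) * real (Suc k) - hinner N h G v) < r"
  proof (intro exI allI impI)
    fix k assume "k0 \<le> k"
    define t where "t = 1 / real (Suc k)"
    have t: "t > 0" "real (Suc k) = 1 / t" by (simp_all add: t_def)
    have "t \<le> 1 / real (Suc k0)" unfolding t_def using \<open>k0 \<le> k\<close> by (intro divide_left_mono) auto
    also note k0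
    finally have "t * c < \<delta>" using c(1) by (simp add: pos_less_divide_eq)
    then have small: "hnorm N h (\<lambda>n. t *\<^sub>R v n) < \<delta>"
      using mult_strict_left_mono[OF c(2) t(1)] t(1)
      unfolding hnorm_scaleR[OF h] abs_of_pos[OF t(1)] by linarith
    have "\<bar>J (\<lambda>n. u n + t *\<^sub>R v n) - J u - t * hinner N h G v\<bar> \<le> (r / c) * (t * hnorm N h v)"
      using bound[OF _ small] v t(1) by (simp add: Hdet_def hnorm_scaleR[OF h] hinner_scaleR_right)
    also have "\<dots> < (r / c) * (t * c)"
      using r c t(1) by (intro mult_strict_left_mono) auto
    also have "\<dots> = t * r" using c by simp
    finally have "\<bar>J (\<lambda>n. u n + t *\<^sub>R v n) - J u - t * hinner N h G v\<bar> / t < r"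
      using t(1) by (simp add: field_simps)
    moreover have "(J (\<lambda>n. u n + t *\<^sub>R v n) - J u) * (1 / t) - hinner N h G v
        = (J (\<lambda>n. u n + t *\<^sub>R v n) - J u - t * hinner N h G v) / t"
      using t(1) by (simp add: field_simps)
    ultimately show "norm ((J (\<lambda>n. u n + (1 / real (Suc k)) *\<^sub>R v n) - J u) * real (Suc k) - hinner N h G v) < r"
      unfolding t(2) t_def[symmetric] using t(1) by (simp add: abs_divide)
  qed
qed

text \<open>Both candidates give the same directional derivative along their own difference, which
  forces its norm to vanish. Sequences in \<open>Hdet\<close> are zero from \<open>N\<close> on, so
  they then agree everywhere.\<close>

lemma has_hgradient_unique:
  assumes h: "h > 0" and G: "has_hgradient N h J u G" and G': "has_hgradient N h J u G'"
  shows "G = G'"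
proof -
  let ?v = "\<lambda>n. G n - G' n"
  have v: "?v \<in> Hdet N" using G G' by (intro Hdet_diff) (simp_all add: has_hgradient_def)
  have "hinner N h G ?v = hinner N h G' ?v"
    using has_hgradient_directional[OF h G v] has_hgradient_directional[OF h G' v] by (rule LIMSEQ_unique)
  then have "hinner N h ?v ?v = 0" by (simp add: hinner_diff_left)
  then have "?v = (\<lambda>_. 0)" using h v by (intro hinner_eq_zero_imp)
  then show ?thesis by (auto simp: fun_eq_iff)
qed

lemma has_hgradient_hgradient:
  "h > 0 \<Longrightarrow> has_hgradient N h J u G \<Longrightarrow> has_hgradient N h J u (hgradient N h J u)"
  unfolding hgradient_def
  by (rule theI[where P = "has_hgradient N h J u" and a = G]) (assumption, rule has_hgradient_unique)

text \<open>By convexity the segment from the minimiser towards \<open>u\<close> is admissible, so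
  all difference quotients along it are nonnegative, and so is their limit.\<close>

lemma hgradient_at_minimiser:
  assumes h: "h > 0" and U: "convex U" and min: "is_arg_min J (\<lambda>u. u \<in> Udet N U) ustar"
    and G: "has_hgradient N h J ustar G" and u: "u \<in> Udet N U"
  shows "0 \<le> hinner N h G (\<lambda>n. u n - ustar n)"
proof (rule LIMSEQ_le_const)
  have ustar: "ustar \<in> Udet N U" and le: "\<And>w. w \<in> Udet N U \<Longrightarrow> J ustar \<le> J w"
    using min by (auto simp: is_arg_min_def not_less)
  show "(\<lambda>k. (J (\<lambda>n. ustar n + (1 / real (Suc k)) *\<^sub>R (u n - ustar n)) - J ustar) * real (Suc k))
      \<longlonglongrightarrow> hinner N h G (\<lambda>n. u n - ustar n)"
    using u ustar by (intro has_hgradient_directional h G Hdet_diff Udet_subset_Hdet)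
  show "\<exists>k0. \<forall>k\<ge>k0. 0 \<le> (J (\<lambda>n. ustar n + (1 / real (Suc k)) *\<^sub>R (u n - ustar n)) - J ustar) * real (Suc k)"
    using le[OF Udet_convex_combination[OF U ustar u]]
    by (intro exI allI impI mult_nonneg_nonneg) (simp_all add: field_simps)
qed

text \<open>The weight \<open>h\<close> is the same at every time, so the minimisation separates
  into closest-point problems in \<open>U\<close>. For uniqueness, a competitor has nonnegative
  excess at each time and nonpositive total excess, hence no excess at all.\<close>

lemma hproj_eq:
  fixes U :: "'c::euclidean_space set"
  assumes h: "h > 0" and U: "closed U" "convex U" "U \<noteq> {}"
  shows "hproj N h U w = (\<lambda>n. if n < N then closest_point U (w n) else 0)"
proof -
  let ?c = "\<lambda>n. if n < N then closest_point U (w n) else 0"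
  have le: "hnorm N h (\<lambda>n. w n - ?c n) \<le> hnorm N h (\<lambda>n. w n - z n)" if "z \<in> Udet N U" for z
  proof -
    have "(\<Sum>n<N. (norm (w n - ?c n))\<^sup>2) \<le> (\<Sum>n<N. (norm (w n - z n))\<^sup>2)"
      using that closest_point_le[OF U(1)] by (intro sum_mono) (auto simp: Udet_def dist_norm intro!: power_mono)
    then have "(hnorm N h (\<lambda>n. w n - ?c n))\<^sup>2 \<le> (hnorm N h (\<lambda>n. w n - z n))\<^sup>2"
      using h by (simp add: hnorm_sq)
    then show ?thesis using h by (simp add: power2_le_iff_abs_le hnorm_nonneg)
  qed
  have c: "?c \<in> Udet N U"
    using closest_point_in_set[OF U(1,3)] by (auto simp: Udet_def Hdet_def)
  show ?thesis
    unfolding hproj_def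
  proof (rule the_equality, intro conjI ballI c le)
    fix v assume v: "v \<in> Udet N U \<and> (\<forall>z\<in>Udet N U. hnorm N h (\<lambda>n. w n - v n) \<le> hnorm N h (\<lambda>n. w n - z n))"
    then have "(hnorm N h (\<lambda>n. w n - v n))\<^sup>2 \<le> (hnorm N h (\<lambda>n. w n - ?c n))\<^sup>2"
      using c h by (intro power_mono hnorm_nonneg) auto
    then have sum: "(\<Sum>n<N. (norm (w n - v n))\<^sup>2 - (norm (w n - ?c n))\<^sup>2) \<le> 0"
      using h by (simp add: hnorm_sq sum_subtractf)
    have nn: "0 \<le> (norm (w n - v n))\<^sup>2 - (norm (w n - ?c n))\<^sup>2" if "n < N" for n
      using v that closest_point_le[OF U(1), of "v n" "w n"] by (auto simp: Udet_def dist_norm intro!: power_mono)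
    then have "(\<Sum>n<N. (norm (w n - v n))\<^sup>2 - (norm (w n - ?c n))\<^sup>2) = 0"
      using sum by (intro antisym sum_nonneg) auto
    then have "\<forall>n\<in>{..<N}. (norm (w n - v n))\<^sup>2 - (norm (w n - ?c n))\<^sup>2 = 0"
      using nn by (subst (asm) sum_nonneg_eq_0_iff) auto
    then have "norm (w n - v n) = norm (w n - closest_point U (w n))" if "n < N" for n
      using that by (simp add: power2_eq_iff_nonneg)
    then have "v n = closest_point U (w n)" if "n < N" for n
      using that v closest_point_le[OF U(1), of _ "w n"]
      by (intro closest_point_unique U) (auto simp: Udet_def dist_norm)
    then show "v = ?c" using v by (auto simp: Udet_def Hdet_def fun_eq_iff)
  qed
qed

lemma hproj_Udet:
  fixes U :: "'c::euclidean_space set"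
  assumes "h > 0" "closed U" "convex U" "U \<noteq> {}"
  shows "hproj N h U w \<in> Udet N U"
  using closest_point_in_set[OF assms(2,4)] by (auto simp: hproj_eq[OF assms] Udet_def Hdet_def)

lemma hproj_nonexpansive:
  fixes U :: "'c::euclidean_space set"
  assumes h: "h > 0" and U: "closed U" "convex U" and v: "v \<in> Udet N U" and "U \<noteq> {}"
  shows "(hnorm N h (\<lambda>n. hproj N h U w n - v n))\<^sup>2 \<le> (hnorm N h (\<lambda>n. w n - v n))\<^sup>2"
proof -
  have "norm (closest_point U (w n) - v n) \<le> norm (w n - v n)" if "n < N" for n
    using closest_point_lipschitz[OF U(2,1) \<open>U \<noteq> {}\<close>, of "w n" "v n"] closest_point_self[of "v n" U] v that
    by (auto simp: Udet_def dist_norm)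
  then have "(\<Sum>n<N. (norm (hproj N h U w n - v n))\<^sup>2) \<le> (\<Sum>n<N. (norm (w n - v n))\<^sup>2)"
    by (intro sum_mono power_mono) (simp_all add: hproj_eq[OF h U \<open>U \<noteq> {}\<close>])
  then show ?thesis using h by (simp add: hnorm_sq)
qed

section \<open>The samplewise gradient as an unbiased estimator\<close>

locale fbm_control = fbm_noise M H h B + smooth_control N h L L' P
  for M :: "'w measure" and H h B N L L' and P :: "('x::euclidean_space, 'c::euclidean_space) control_problem"
begin

abbreviation path :: "'w \<Rightarrow> nat \<Rightarrow> real" where "path \<omega> \<equiv> (\<lambda>n. \<xi> n \<omega>)"

abbreviation cost_fn :: "(nat \<Rightarrow> 'c) \<Rightarrow> real" where "cost_fn \<equiv> det_cost N h P M \<xi>"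

lemma path_cost_integrable: "integrable M (\<lambda>\<omega>. path_cost N h P (path \<omega>) u)"
proof -
  obtain A where A: "A \<ge> 0" "\<And>\<xi>. \<bar>path_cost N h P \<xi> u\<bar> \<le> A * noise_size N \<xi>"
    using path_cost_growth by blast
  show ?thesis
  proof (rule Bochner_Integration.integrable_bound)
    show "integrable M (\<lambda>\<omega>. A * noise_size N (path \<omega>))"
      using noise_size_moment[of N 1] by simp
    show "AE \<omega> in M. norm (path_cost N h P (path \<omega>) u) \<le> norm (A * noise_size N (path \<omega>))"
      using A(2) by (auto intro!: order_trans[OF A(2) abs_ge_self])
  qed (intro path_cost_measurable fgn_measurable borel_measurable_const)
qed

text \<open>Dominated convergence with the pathwise derivative as limit and a power of the noise
  size as majorant; integrability of the limit is part of its conclusion.\<close>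

lemma
  shows ghat_inner_integrable: "integrable M (\<lambda>\<omega>. hinner N h (ghat N h P (path \<omega>) u) v)"
    and cost_difference_quotient: "(\<lambda>k. (cost_fn (\<lambda>n. u n + (1 / real (Suc k)) *\<^sub>R v n) - cost_fn u) * real (Suc k))
      \<longlonglongrightarrow> expectation (\<lambda>\<omega>. hinner N h (ghat N h P (path \<omega>) u) v)"
proof -
  let ?s = "\<lambda>k \<omega>. (path_cost N h P (path \<omega>) (\<lambda>n. u n + (1 / real (Suc k)) *\<^sub>R v n)
      - path_cost N h P (path \<omega>) u) * real (Suc k)"
  let ?f = "\<lambda>\<omega>. hinner N h (ghat N h P (path \<omega>) u) v"
  obtain Q where Q: "Q \<ge> 0" "\<And>\<xi> t. t \<ge> 0 \<Longrightarrow>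
    \<bar>path_cost N h P \<xi> (\<lambda>k. u k + t *\<^sub>R v k) - path_cost N h P \<xi> u\<bar> \<le> t * Q * noise_size N \<xi> ^ N"
    using path_cost_lipschitz by blast
  let ?w = "\<lambda>\<omega>. Q * noise_size N (path \<omega>) ^ N"
  have f: "?f \<in> borel_measurable M"
    unfolding hinner_def
    by (intro borel_measurable_times borel_measurable_sum borel_measurable_inner ghat_measurable
        fgn_measurable borel_measurable_const)
  have s: "?s k \<in> borel_measurable M" for k
    by (intro borel_measurable_times borel_measurable_diff path_cost_measurable
        fgn_measurable borel_measurable_const)
  have w: "integrable M ?w" by (intro integrable_mult_right noise_size_moment)
  have lim: "AE \<omega> in M. (\<lambda>k. ?s k \<omega>) \<longlonglongrightarrow> ?f \<omega>"
  proof (rule AE_I2)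
    fix \<omega>
    have "((\<lambda>t. (path_cost N h P (path \<omega>) (\<lambda>k. u k + t *\<^sub>R v k) - path_cost N h P (path \<omega>) u) / t)
        \<longlongrightarrow> ?f \<omega>) (at 0)"
      using path_cost_has_derivative[of "path \<omega>" u v] unfolding DERIV_def by simp
    moreover have "filterlim (\<lambda>k. 1 / real (Suc k)) (at 0) sequentially"
      using LIMSEQ_inverse_real_of_nat
      by (intro filterlim_atI) (simp_all add: inverse_eq_divide)
    ultimately have "(\<lambda>k. (path_cost N h P (path \<omega>) (\<lambda>n. u n + (1 / real (Suc k)) *\<^sub>R v n)
        - path_cost N h P (path \<omega>) u) / (1 / real (Suc k))) \<longlonglongrightarrow> ?f \<omega>"
      by (rule filterlim_compose)
    then show "(\<lambda>k. ?s k \<omega>) \<longlonglongrightarrow> ?f \<omega>" by simp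
  qed
  have dom: "AE \<omega> in M. norm (?s k \<omega>) \<le> ?w \<omega>" for k
  proof (rule AE_I2)
    fix \<omega>
    have "norm (?s k \<omega>) \<le> ((1 / real (Suc k)) * Q * noise_size N (path \<omega>) ^ N) * real (Suc k)"
      unfolding real_norm_def abs_mult abs_of_nat
      by (intro mult_right_mono Q(2)) simp_all
    then show "norm (?s k \<omega>) \<le> ?w \<omega>" by simp
  qed
  show "integrable M ?f"
    by (rule integrable_dominated_convergence[OF f s w lim dom])
  have "(\<lambda>k. expectation (?s k)) \<longlonglongrightarrow> expectation ?f"
    by (rule integral_dominated_convergence[OF f s w lim dom])
  then show "(\<lambda>k. (cost_fn (\<lambda>n. u n + (1 / real (Suc k)) *\<^sub>R v n) - cost_fn u) * real (Suc k))
      \<longlonglongrightarrow> expectation ?f"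
    using path_cost_integrable by (simp add: det_cost_eq)
qed

text \<open>Dominated convergence and Frechet differentiability assign limits to the same difference
  quotients, so the two limits coincide.\<close>

lemma ghat_unbiased:
  assumes "has_hgradient N h cost_fn u G" "v \<in> Hdet N"
  shows "expectation (\<lambda>\<omega>. hinner N h (ghat N h P (path \<omega>) u) v) = hinner N h G v"
  using cost_difference_quotient has_hgradient_directional[OF h_pos assms] by (rule LIMSEQ_unique)

lemma ghat_coercive:
  assumes conv: "strongly_convex_cost N h (control_set P) \<mu> cost_fn" and "convex (control_set P)"
    and min: "is_arg_min cost_fn (\<lambda>u. u \<in> Udet N (control_set P)) ustar"
    and u: "u \<in> Udet N (control_set P)"
  shows "\<mu> * (hnorm N h (\<lambda>n. u n - ustar n))\<^sup>2
    \<le> expectation (\<lambda>\<omega>. hinner N h (ghat N h P (path \<omega>) u) (\<lambda>n. u n - ustar n))"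
proof -
  have ustar: "ustar \<in> Udet N (control_set P)" using min by (simp add: is_arg_min_def)
  have grad: "has_hgradient N h cost_fn w (hgradient N h cost_fn w)" if "w \<in> Udet N (control_set P)" for w
    using conv Udet_subset_Hdet[OF that] h_pos unfolding strongly_convex_cost_def
    by (blast intro: has_hgradient_hgradient)
  have "\<mu> * (hnorm N h (\<lambda>n. u n - ustar n))\<^sup>2
    \<le> hinner N h (\<lambda>n. hgradient N h cost_fn u n - hgradient N h cost_fn ustar n) (\<lambda>n. u n - ustar n)"
    using conv u ustar unfolding strongly_convex_cost_def by blast
  also have "\<dots> \<le> hinner N h (hgradient N h cost_fn u) (\<lambda>n. u n - ustar n)"
    using hgradient_at_minimiser[OF h_pos assms(2) min grad[OF ustar] u] by (simp add: hinner_diff_left)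
  also have "\<dots> = expectation (\<lambda>\<omega>. hinner N h (ghat N h P (path \<omega>) u) (\<lambda>n. u n - ustar n))"
    using u ustar by (intro ghat_unbiased[symmetric] grad Hdet_diff Udet_subset_Hdet)
  finally show ?thesis .
qed

text \<open>The leading 3 comes from squaring a sum of three terms, and
  \<open>3 + \<bar>M\<^sub>4\<bar>\<close> joins the Gaussian fourth moment to that of the adjoint.
  In the second part the weight \<open>h\<close> of the norm cancels the 1 / h of the noise term.
  Absolute values are taken because \<open>M\<^sub>2\<close> and \<open>M\<^sub>4\<close> are
  arbitrary reals.\<close>

definition ghat_bound :: "real \<Rightarrow> real \<Rightarrow> real" where
  "ghat_bound M\<^sub>2 M\<^sub>4 = 3 * L\<^sup>2 * real N * (h * (1 + \<bar>M\<^sub>2\<bar>) + (3 + \<bar>M\<^sub>4\<bar>) / 2)"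

lemma
  assumes bounds: "gradient_bounds N h P M \<xi> V L\<^sub>J M\<^sub>2 M\<^sub>4" and V: "V \<ge> 0"
    and u: "u \<in> Udet N (control_set P)"
  shows ghat_square_integrable: "integrable M (\<lambda>\<omega>. (hnorm N h (ghat N h P (path \<omega>) u))\<^sup>2)"
    and ghat_second_moment:
      "expectation (\<lambda>\<omega>. (hnorm N h (ghat N h P (path \<omega>) u))\<^sup>2) \<le> ghat_bound M\<^sub>2 M\<^sub>4 * (1 + V)"
proof -
  define W where "W = 1 + V"
  have W: "W \<ge> 1" using V by (simp add: W_def)
  let ?p = "\<lambda>n \<omega>. norm (phat N h P (path \<omega>) u n)"
  have p2: "integrable M (\<lambda>\<omega>. ?p n \<omega> ^ 2)" "expectation (\<lambda>\<omega>. ?p n \<omega> ^ 2) \<le> M\<^sub>2 * W"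
    and p4: "integrable M (\<lambda>\<omega>. ?p n \<omega> ^ 4)" "expectation (\<lambda>\<omega>. ?p n \<omega> ^ 4) \<le> M\<^sub>4 * W\<^sup>2" if "n \<le> N" for n
    using bounds u that unfolding gradient_bounds_def Let_def W_def by blast+
  let ?d = "\<lambda>n \<omega>. 3 * L\<^sup>2 * (?p (Suc n) \<omega> ^ 2 + 1 + 1 / (2 * h) * (W * \<xi> n \<omega> ^ 4 + ?p (Suc n) \<omega> ^ 4 / W))"
  have dom: "(norm (ghat N h P (path \<omega>) u n))\<^sup>2 \<le> ?d n \<omega>" if n: "n < N" for n \<omega>
  proof -
    let ?q = "?p (Suc n) \<omega>" and ?x = "\<bar>\<xi> n \<omega>\<bar>" 
    define k where "k = h powr (-1/2)"
    have k: "k\<^sup>2 = 1 / h"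
      using h_pos powr_minus_divide[of h 1] by (simp add: k_def power2_eq_square flip: powr_add)
    have three: "(a + b + c)\<^sup>2 \<le> 3 * (a\<^sup>2 + b\<^sup>2 + c\<^sup>2)" for a b c :: real
      using sum_squares_bound[of a b] sum_squares_bound[of a c] sum_squares_bound[of b c]
      by (simp add: power2_eq_square algebra_simps)
    have "(norm (ghat N h P (path \<omega>) u n))\<^sup>2 \<le> (L * ?q + L + k * L * (?x * ?q))\<^sup>2"
      unfolding k_def by (intro power_mono ghat_norm_bound n) simp
    also have "\<dots> \<le> 3 * ((L * ?q)\<^sup>2 + L\<^sup>2 + (k * L * (?x * ?q))\<^sup>2)" by (rule three)
    also have "\<dots> = 3 * L\<^sup>2 * (?q\<^sup>2 + 1 + 1 / h * (?x * ?q)\<^sup>2)"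
      by (simp add: power_mult_distrib k algebra_simps)
    also have "\<dots> \<le> ?d n \<omega>"
    proof -
      \<comment> \<open>The weight is balanced for linear growth: the noise part contributes 3 W,
        and the fourth moment of the adjoint, of order W^2, is divided by W. An unweighted
        inequality would leave W^2.\<close>
      have "2 * (sqrt W * ?x\<^sup>2) * (?q\<^sup>2 / sqrt W) \<le> (sqrt W * ?x\<^sup>2)\<^sup>2 + (?q\<^sup>2 / sqrt W)\<^sup>2"
        by (rule sum_squares_bound)
      then have "2 * (?x * ?q)\<^sup>2 \<le> W * \<xi> n \<omega> ^ 4 + ?q ^ 4 / W"
        using W by (simp add: power_mult_distrib power_divide flip: power_mult)
      then have "1 / h * (?x * ?q)\<^sup>2 \<le> 1 / (2 * h) * (W * \<xi> n \<omega> ^ 4 + ?q ^ 4 / W)"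
        using h_pos by (simp add: field_simps)
      then show ?thesis by (intro mult_left_mono add_mono order_refl) simp_all
    qed
    finally show ?thesis .
  qed
  have dint: "integrable M (?d n)" if "n < N" for n
    using p2[of "Suc n"] p4[of "Suc n"] that gaussian_rv_moment[OF gaussian_fgn, of n 4] by simp
  have meas: "(\<lambda>\<omega>. (norm (ghat N h P (path \<omega>) u n))\<^sup>2) \<in> borel_measurable M" for n
  proof -
    have [measurable]: "(\<lambda>\<omega>. ghat N h P (path \<omega>) u n) \<in> borel_measurable M"
      by (intro ghat_measurable fgn_measurable borel_measurable_const)
    show ?thesis by measurable
  qed
  have gint: "integrable M (\<lambda>\<omega>. (norm (ghat N h P (path \<omega>) u n))\<^sup>2)" if "n < N" for n
    using dom[OF that]
    by (intro Bochner_Integration.integrable_bound[OF dint[OF that] meas]) (auto intro: order_trans[OF _ abs_ge_self])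
  have gle: "expectation (\<lambda>\<omega>. (norm (ghat N h P (path \<omega>) u n))\<^sup>2)
      \<le> 3 * L\<^sup>2 * (1 + \<bar>M\<^sub>2\<bar> + (3 + \<bar>M\<^sub>4\<bar>) / (2 * h)) * W" if n: "n < N" for n
  proof -
    have "expectation (\<lambda>\<omega>. (norm (ghat N h P (path \<omega>) u n))\<^sup>2) \<le> expectation (?d n)"
      by (intro integral_mono gint dint dom n)
    also have "\<dots> = 3 * L\<^sup>2 * (expectation (\<lambda>\<omega>. ?p (Suc n) \<omega> ^ 2) + 1
        + 1 / (2 * h) * (W * 3 + expectation (\<lambda>\<omega>. ?p (Suc n) \<omega> ^ 4) / W))"
      using p2[of "Suc n"] p4[of "Suc n"] n gaussian_rv_moment[OF gaussian_fgn, of n 4]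
      by (simp add: fgn_fourth_moment prob_space)
    also have "\<dots> \<le> 3 * L\<^sup>2 * (\<bar>M\<^sub>2\<bar> * W + 1 * W + 1 / (2 * h) * (W * 3 + \<bar>M\<^sub>4\<bar> * W))"
    proof (intro mult_left_mono add_mono order_refl)
      show "expectation (\<lambda>\<omega>. ?p (Suc n) \<omega> ^ 2) \<le> \<bar>M\<^sub>2\<bar> * W"
        by (rule order_trans[OF p2(2)]) (use n W in \<open>simp_all add: mult_right_mono\<close>)
      have "expectation (\<lambda>\<omega>. ?p (Suc n) \<omega> ^ 4) \<le> \<bar>M\<^sub>4\<bar> * W\<^sup>2"
        by (rule order_trans[OF p4(2)]) (use n W in \<open>simp_all add: mult_right_mono\<close>)
      then show "expectation (\<lambda>\<omega>. ?p (Suc n) \<omega> ^ 4) / W \<le> \<bar>M\<^sub>4\<bar> * W"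
        using W by (simp add: field_simps power2_eq_square)
    qed (use W h_pos in simp_all)
    also have "\<dots> = 3 * L\<^sup>2 * (1 + \<bar>M\<^sub>2\<bar> + (3 + \<bar>M\<^sub>4\<bar>) / (2 * h)) * W"
      by (simp add: field_simps)
    finally show ?thesis .
  qed
  have eq: "(\<lambda>\<omega>. (hnorm N h (ghat N h P (path \<omega>) u))\<^sup>2) = (\<lambda>\<omega>. h * (\<Sum>n<N. (norm (ghat N h P (path \<omega>) u n))\<^sup>2))"
    by (simp add: hnorm_sq[OF h_pos])
  show "integrable M (\<lambda>\<omega>. (hnorm N h (ghat N h P (path \<omega>) u))\<^sup>2)"
    unfolding eq using gint by (intro integrable_mult_right Bochner_Integration.integrable_sum) simp
  have "expectation (\<lambda>\<omega>. (hnorm N h (ghat N h P (path \<omega>) u))\<^sup>2)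
      = h * (\<Sum>n<N. expectation (\<lambda>\<omega>. (norm (ghat N h P (path \<omega>) u n))\<^sup>2))"
    unfolding eq using gint by simp
  also have "\<dots> \<le> h * (\<Sum>n<N. 3 * L\<^sup>2 * (1 + \<bar>M\<^sub>2\<bar> + (3 + \<bar>M\<^sub>4\<bar>) / (2 * h)) * W)"
    using gle h_pos by (intro mult_left_mono sum_mono) auto
  also have "\<dots> = ghat_bound M\<^sub>2 M\<^sub>4 * (1 + V)"
    using h_pos by (simp add: ghat_bound_def W_def field_simps)
  finally show "expectation (\<lambda>\<omega>. (hnorm N h (ghat N h P (path \<omega>) u))\<^sup>2) \<le> ghat_bound M\<^sub>2 M\<^sub>4 * (1 + V)" .
qed

end

section \<open>Projected stochastic gradient descent\<close>

lemma inverse_rate_recursion: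
  fixes a :: "nat \<Rightarrow> real"
  assumes nonneg: "\<And>k. 0 \<le> a k" and D: "0 \<le> D"
    and step: "\<And>k. a (Suc k) \<le> (1 - 2 / (real k + 1)) * a k + D / (real k + 1)\<^sup>2"
    and K: "K \<ge> 1"
  shows "a K \<le> D / real K"
  using K
proof (induction K rule: nat_induct_at_least)
  case base
  \<comment> \<open>At index 0 the contraction factor is 1 - 2 = -1, so a nonnegative
    \<open>a 0\<close> can only lower the bound. From index 1 on the factor is nonnegative, which
    the induction step needs when it inserts the hypothesis.\<close>
  show ?case using step[of 0] nonneg[of 0] by simp
next
  case (Suc k)
  define x where "x = real k"
  have x: "x \<ge> 1" using Suc by (simp add: x_def)
  have "a (Suc k) \<le> (1 - 2 / (x + 1)) * a k + D / (x + 1)\<^sup>2" using step[of k] by (simp add: x_def)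
  also have "\<dots> \<le> (1 - 2 / (x + 1)) * (D / x) + D / (x + 1)\<^sup>2"
    using Suc x by (intro add_mono mult_left_mono) (simp_all add: x_def)
  also have "1 - 2 / (x + 1) = (x - 1) / (x + 1)"
    using x by (simp add: field_simps)
  also have "(x - 1) / (x + 1) * (D / x) + D / (x + 1)\<^sup>2 = D / (x + 1) * ((x - 1) / x + 1 / (x + 1))"
    by (simp add: distrib_left power2_eq_square mult_ac)
  also have "\<dots> \<le> D / (x + 1) * 1"
  proof (intro mult_left_mono)
    have "(x - 1) / x = 1 - 1 / x" "1 / (x + 1) \<le> 1 / x"
      using x by (simp_all add: diff_divide_distrib frac_le)
    then show "(x - 1) / x + 1 / (x + 1) \<le> 1" by linarith
  qed (use x D in simp)
  finally show ?case by (simp add: x_def add.commute)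
qed

lemma reconstruct_cong:
  "(\<And>i. i \<le> n \<Longrightarrow> z i = z' i) \<Longrightarrow> reconstruct \<beta> z n = reconstruct \<beta> z' n"
  unfolding reconstruct_def by (intro sum.cong) auto

text \<open>Only the noise of earlier iterations matters. The two runs may live on different sample
  spaces, which lets an iterate be rewritten as a function on the product space of past
  noise.\<close>

lemma sgd_cong:
  "(\<And>j n. j < k \<Longrightarrow> n < N \<Longrightarrow> Z j n \<omega> = Z' j n \<omega>')
    \<Longrightarrow> sgd N h P \<beta> Z step u0 k \<omega> = sgd N h P \<beta> Z' step u0 k \<omega>'"
proof (induction k)
  case (Suc k)
  have "ghat N h P (reconstruct \<beta> (\<lambda>n. Z k n \<omega>)) = ghat N h P (reconstruct \<beta> (\<lambda>n. Z' k n \<omega>'))"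
    using Suc.prems by (intro ext fun_cong[OF ghat_cong] reconstruct_cong) auto
  moreover have "sgd N h P \<beta> Z step u0 k \<omega> = sgd N h P \<beta> Z' step u0 k \<omega>'"
    using Suc by simp
  ultimately show ?case by (simp add: Let_def)
qed simp

text \<open>Coercivity and the second-moment bound are assumed only at fixed admissible controls.
  Carrying them over to the random iterates is the purpose of this context.\<close>

locale sgd_scheme = fbm_control M H h B N L L' P + S: prob_space S
  for M :: "'w measure" and H h B N L L'
    and P :: "('x::euclidean_space, 'c::euclidean_space) control_problem" and S :: "'s measure" +
  fixes Z :: "nat \<Rightarrow> nat \<Rightarrow> 's \<Rightarrow> real" and \<beta> :: "nat \<Rightarrow> nat \<Rightarrow> real" and step :: "nat \<Rightarrow> real"
    and u0 ustar :: "nat \<Rightarrow> 'c" and \<mu> G :: real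
  assumes closed_U: "closed (control_set P)" and convex_U: "convex (control_set P)"
    and zero_U: "0 \<in> control_set P"
    and cholesky: "cholesky_factor N (fgn_cov H) \<beta>" and white: "white_noise S N Z"
    and u0: "u0 \<in> Udet N (control_set P)" and ustar: "ustar \<in> Udet N (control_set P)"
    and step_pos: "\<And>k. step k > 0"
    and coercive: "\<And>u. u \<in> Udet N (control_set P) \<Longrightarrow> \<mu> * (hnorm N h (\<lambda>n. u n - ustar n))\<^sup>2
      \<le> expectation (\<lambda>\<omega>. hinner N h (ghat N h P (path \<omega>) u) (\<lambda>n. u n - ustar n))"
    and second_moment: "\<And>u. u \<in> Udet N (control_set P) \<Longrightarrow>
      integrable M (\<lambda>\<omega>. (hnorm N h (ghat N h P (path \<omega>) u))\<^sup>2) \<and>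
      expectation (\<lambda>\<omega>. (hnorm N h (ghat N h P (path \<omega>) u))\<^sup>2) \<le> G"
begin

lemma nonempty_U: "control_set P \<noteq> {}" using zero_U by auto

abbreviation iter :: "nat \<Rightarrow> 's \<Rightarrow> nat \<Rightarrow> 'c" where
  "iter \<equiv> sgd N h P \<beta> Z step u0"

abbreviation sq_err :: "nat \<Rightarrow> 's \<Rightarrow> real" where
  "sq_err k \<omega> \<equiv> (hnorm N h (\<lambda>n. iter k \<omega> n - ustar n))\<^sup>2"

lemma sgd_Udet: "sgd N h P \<beta> Z' step u0 k \<omega> \<in> Udet N (control_set P)"
  using u0 hproj_Udet[OF h_pos closed_U convex_U nonempty_U] by (cases k) (simp_all add: Let_def)

text \<open>Sample space and noise are left general because the lemma serves twice: on
  \<open>S\<close>, and on the product space of past noise with the coordinates as noise.\<close>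

lemma sgd_measurable:
  fixes \<Omega> :: "'v measure"
  shows "(\<And>j n. j < k \<Longrightarrow> n < N \<Longrightarrow> Z' j n \<in> borel_measurable \<Omega>)
    \<Longrightarrow> (\<lambda>\<omega>. sgd N h P \<beta> Z' step u0 k \<omega> n) \<in> borel_measurable \<Omega>"
proof (induction k arbitrary: n)
  case (Suc k)
  have cp: "closest_point (control_set P) \<in> borel_measurable borel"
    by (intro borel_measurable_continuous_onI continuous_on_closest_point closed_U convex_U nonempty_U)
  have "(\<lambda>\<omega>. sgd N h P \<beta> Z' step u0 k \<omega> n
      - step k *\<^sub>R ghat N h P (\<lambda>n. reconstruct \<beta> (\<lambda>i. Z' k i \<omega>) n) (\<lambda>n. sgd N h P \<beta> Z' step u0 k \<omega> n) n)
      \<in> borel_measurable \<Omega>" for n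
    using Suc by (intro borel_measurable_diff borel_measurable_scaleR borel_measurable_const ghat_measurable
        reconstruct_measurable) auto
  from measurable_compose[OF this cp] show ?case
    by (simp add: Let_def hproj_eq[OF h_pos closed_U convex_U nonempty_U])
qed simp

lemma iter_measurable: "(\<lambda>\<omega>. iter k \<omega> n) \<in> borel_measurable S"
  by (intro sgd_measurable S.white_noise_measurable[OF white])

section \<open>Separation of the current noise from the past\<close>

definition past_space :: "nat \<Rightarrow> (nat \<times> nat \<Rightarrow> real) measure" where
  "past_space k = (\<Pi>\<^sub>M p\<in>{..<k} \<times> {..<N}. borel)"

definition noise_space :: "(nat \<Rightarrow> real) measure" where
  "noise_space = (\<Pi>\<^sub>M n\<in>{..<N}. borel)"

definition past :: "nat \<Rightarrow> 's \<Rightarrow> nat \<times> nat \<Rightarrow> real" where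
  "past k \<omega> = (\<lambda>p\<in>{..<k} \<times> {..<N}. Z (fst p) (snd p) \<omega>)"

definition noise :: "nat \<Rightarrow> 's \<Rightarrow> nat \<Rightarrow> real" where
  "noise k \<omega> = (\<lambda>n\<in>{..<N}. reconstruct \<beta> (\<lambda>i. Z k i \<omega>) n)"

text \<open>The scheme run with the coordinate projections as noise, which exhibits the iterate as a
  measurable function of the recorded past.\<close>

definition past_iter :: "nat \<Rightarrow> (nat \<times> nat \<Rightarrow> real) \<Rightarrow> nat \<Rightarrow> 'c" where
  "past_iter k = sgd N h P \<beta> (\<lambda>j n f. f (j, n)) step u0 k"

lemma past_iter_past: "past_iter k (past k \<omega>) = iter k \<omega>"
  unfolding past_iter_def past_def by (rule sgd_cong) auto

lemma past_iter_Udet: "past_iter k x \<in> Udet N (control_set P)"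
  unfolding past_iter_def by (rule sgd_Udet)

lemma past_iter_measurable: "(\<lambda>x. past_iter k x n) \<in> borel_measurable (past_space k)"
  unfolding past_iter_def past_space_def
  by (intro sgd_measurable measurable_component_singleton) auto

text \<open>Past and current noise use disjoint index blocks of one independent family, so their
  joint law is a product. Reconstruction acts on the second block alone and preserves this.\<close>

lemma
  shows past_measurable: "past k \<in> measurable S (past_space k)"
    and noise_measurable: "noise k \<in> measurable S noise_space"
    and past_noise_law: "distr S (past_space k) (past k) \<Otimes>\<^sub>M distr S noise_space (noise k)
      = distr S (past_space k \<Otimes>\<^sub>M noise_space) (\<lambda>\<omega>. (past k \<omega>, noise k \<omega>))"
proof -
  let ?A = "{..<k} \<times> {..<N}" and ?B = "{k} \<times> {..<N}"
  \<comment> \<open>The library's \<open>indep_var\<close> wants both variables in the same type, so the current noise is first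
    kept as a function of index pairs and decoded afterwards.\<close>
  define fresh_space where "fresh_space = (\<Pi>\<^sub>M p\<in>?B. borel :: real measure)"
  define fresh where "fresh \<omega> = (\<lambda>p\<in>?B. Z (fst p) (snd p) \<omega>)" for \<omega>
  define F where "F f = (\<lambda>n\<in>{..<N}. reconstruct \<beta> (\<lambda>i. f (k, i)) n)" for f
  have F[measurable]: "F \<in> measurable fresh_space noise_space"
    unfolding noise_space_def fresh_space_def F_def
    by (intro measurable_restrict reconstruct_measurable measurable_component_singleton) auto
  have noise: "noise k = (\<lambda>\<omega>. F (fresh \<omega>))"
    unfolding noise_def F_def fresh_def by (intro ext restrict_ext reconstruct_cong) auto
  have "S.indep_vars (\<lambda>_. borel) (\<lambda>p. Z (fst p) (snd p)) (UNIV \<times> {..<N})"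
    using white by (simp add: white_noise_def case_prod_unfold)
  then have "S.indep_var (past_space k) (past k) fresh_space fresh"
    unfolding past_space_def fresh_space_def past_def[abs_def] fresh_def[abs_def]
    by (rule S.indep_var_restrict) auto
  then have past[measurable]: "past k \<in> measurable S (past_space k)"
    and fresh[measurable]: "fresh \<in> measurable S fresh_space"
    and law: "distr S (past_space k) (past k) \<Otimes>\<^sub>M distr S fresh_space fresh
      = distr S (past_space k \<Otimes>\<^sub>M fresh_space) (\<lambda>\<omega>. (past k \<omega>, fresh \<omega>))"
    unfolding S.indep_var_distribution_eq by auto
  show "past k \<in> measurable S (past_space k)" "noise k \<in> measurable S noise_space"
    unfolding noise by measurable
  let ?D = "distr S (past_space k) (past k)" and ?E = "distr S fresh_space fresh"
  have n: "distr S noise_space (noise k) = distr ?E noise_space F"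
    unfolding noise by (subst distr_distr) (simp_all add: comp_def)
  interpret n: prob_space "distr ?E noise_space F"
    unfolding n[symmetric] by (rule S.prob_space_distr) fact
  have "?D \<Otimes>\<^sub>M distr ?E noise_space F = distr ?D (past_space k) (\<lambda>x. x) \<Otimes>\<^sub>M distr ?E noise_space F"
    by (simp add: distr_id2)
  also have "\<dots> = distr (?D \<Otimes>\<^sub>M ?E) (past_space k \<Otimes>\<^sub>M noise_space) (\<lambda>(x, y). (x, F y))"
    by (rule pair_measure_distr) (simp_all add: n.sigma_finite_measure_axioms)
  also have "\<dots> = distr S (past_space k \<Otimes>\<^sub>M noise_space) (\<lambda>\<omega>. (past k \<omega>, noise k \<omega>))"
    unfolding law noise by (subst distr_distr) (simp_all add: comp_def)
  finally show "?D \<Otimes>\<^sub>M distr S noise_space (noise k)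
      = distr S (past_space k \<Otimes>\<^sub>M noise_space) (\<lambda>\<omega>. (past k \<omega>, noise k \<omega>))"
    unfolding n .
qed

lemma noise_law: "distr S noise_space (noise k) = distr M noise_space (\<lambda>\<omega>. \<lambda>n\<in>{..<N}. \<xi> n \<omega>)"
  unfolding noise_space_def noise_def by (rule reconstruct_law[OF S.prob_space_axioms white cholesky])

abbreviation stoch_grad :: "nat \<Rightarrow> 's \<Rightarrow> nat \<Rightarrow> 'c" where
  "stoch_grad k \<omega> \<equiv> ghat N h P (noise k \<omega>) (iter k \<omega>)"

lemma iter_Suc: "iter (Suc k) \<omega> = hproj N h (control_set P) (\<lambda>n. iter k \<omega> n - step k *\<^sub>R stoch_grad k \<omega> n)"
proof -
  have "ghat N h P (reconstruct \<beta> (\<lambda>n. Z k n \<omega>)) u = ghat N h P (noise k \<omega>) u" for u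
    by (rule ghat_cong) (simp add: noise_def)
  then show ?thesis by (simp add: Let_def)
qed

text \<open>The order matters. Tonelli comes first, as it needs no integrability, and settles the
  squared norm; together with the assumed integrability of the error this dominates the inner
  product, and only then does Fubini apply to that signed quantity.\<close>

lemma
  assumes int: "integrable S (sq_err k)"
  shows stoch_grad_square_integrable: "integrable S (\<lambda>\<omega>. (hnorm N h (stoch_grad k \<omega>))\<^sup>2)"
    and stoch_grad_second_moment: "S.expectation (\<lambda>\<omega>. (hnorm N h (stoch_grad k \<omega>))\<^sup>2) \<le> G"
    and stoch_grad_inner_integrable:
      "integrable S (\<lambda>\<omega>. hinner N h (stoch_grad k \<omega>) (\<lambda>n. iter k \<omega> n - ustar n))"
    and stoch_grad_coercive: "\<mu> * S.expectation (sq_err k)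
      \<le> S.expectation (\<lambda>\<omega>. hinner N h (stoch_grad k \<omega>) (\<lambda>n. iter k \<omega> n - ustar n))"
proof -
  let ?D = "distr S (past_space k) (past k)" and ?\<nu> = "distr S noise_space (noise k)"
  note past[measurable] = past_measurable[of k] and noise[measurable] = noise_measurable[of k]
    and joint = past_noise_law[of k]
  interpret D: prob_space ?D by (rule S.prob_space_distr) fact
  interpret \<nu>: prob_space ?\<nu> by (rule S.prob_space_distr) fact
  interpret D\<nu>: pair_prob_space ?D ?\<nu> ..
  have pathm: "(\<lambda>\<omega>. \<lambda>n\<in>{..<N}. \<xi> n \<omega>) \<in> measurable M noise_space"
    unfolding noise_space_def by (intro measurable_restrict fgn_measurable)
  have ghat_path: "ghat N h P (\<lambda>n\<in>{..<N}. \<xi> n \<omega>) u = ghat N h P (path \<omega>) u" for \<omega> u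
    by (rule ghat_cong) simp
  define q where "q z = (hnorm N h (ghat N h P (snd z) (past_iter k (fst z))))\<^sup>2" for z
  define r where "r z = hinner N h (ghat N h P (snd z) (past_iter k (fst z))) (\<lambda>n. past_iter k (fst z) n - ustar n)" for z
  define e where "e x = (hnorm N h (\<lambda>n. past_iter k x n - ustar n))\<^sup>2" for x
  let ?PN = "past_space k \<Otimes>\<^sub>M noise_space"
  have it: "(\<lambda>z. past_iter k (fst z) n) \<in> borel_measurable ?PN" for n
    using measurable_compose[OF measurable_fst past_iter_measurable] .
  have gm: "(\<lambda>z. ghat N h P (snd z) (past_iter k (fst z)) n) \<in> borel_measurable ?PN" for n
  proof -
    have "(\<lambda>z. snd z n) \<in> borel_measurable ?PN" if "n < N" for n
      unfolding noise_space_def using that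
      by (intro measurable_compose[OF measurable_snd measurable_component_singleton]) simp
    with it show ?thesis by (intro ghat_measurable)
  qed
  have qm[measurable]: "q \<in> borel_measurable ?PN"
  proof -
    note gm[measurable]
    show ?thesis unfolding q_def[abs_def] hnorm_sq[OF h_pos] by measurable
  qed
  have rm[measurable]: "r \<in> borel_measurable ?PN"
    unfolding r_def[abs_def] hinner_def
    by (intro borel_measurable_times borel_measurable_const borel_measurable_sum borel_measurable_inner gm
        borel_measurable_diff it)
  have em[measurable]: "e \<in> borel_measurable (past_space k)"
  proof -
    note past_iter_measurable[measurable]
    show ?thesis unfolding e_def[abs_def] hnorm_sq[OF h_pos] by measurable
  qed
  have q_eq: "(hnorm N h (stoch_grad k \<omega>))\<^sup>2 = q (past k \<omega>, noise k \<omega>)"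
    and r_eq: "hinner N h (stoch_grad k \<omega>) (\<lambda>n. iter k \<omega> n - ustar n) = r (past k \<omega>, noise k \<omega>)"
    and e_eq: "sq_err k \<omega> = e (past k \<omega>)" for \<omega>
    by (simp_all add: q_def r_def e_def past_iter_past)
  have eD: "integrable ?D e"
    using int unfolding e_eq by (subst integrable_distr_eq) simp_all
  \<comment> \<open>With the past frozen, the inner integral is an expectation at one admissible
    control; equality of the noise laws moves it to \<open>M\<close>, where the moment bound holds
    uniformly.\<close>
  have q_inner: "(\<integral>\<^sup>+y. ennreal (q (x, y)) \<partial>?\<nu>) \<le> ennreal G" if x: "x \<in> space (past_space k)" for x
  proof -
    have [measurable]: "(\<lambda>y. q (x, y)) \<in> borel_measurable noise_space"
      using measurable_compose[OF measurable_Pair1'[OF x] qm] .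
    have "(\<integral>\<^sup>+y. ennreal (q (x, y)) \<partial>?\<nu>) = (\<integral>\<^sup>+\<omega>. ennreal (q (x, \<lambda>n\<in>{..<N}. \<xi> n \<omega>)) \<partial>M)"
      unfolding noise_law using pathm by (subst nn_integral_distr) simp_all
    also have "\<dots> = ennreal (expectation (\<lambda>\<omega>. (hnorm N h (ghat N h P (path \<omega>) (past_iter k x)))\<^sup>2))"
      using second_moment[OF past_iter_Udet] by (simp add: q_def ghat_path nn_integral_eq_integral)
    also have "\<dots> \<le> ennreal G" using second_moment[OF past_iter_Udet] by (intro ennreal_leI) simp
    finally show ?thesis .
  qed
  have G: "0 \<le> G"
  proof -
    have "0 \<le> expectation (\<lambda>\<omega>. (hnorm N h (ghat N h P (path \<omega>) u0))\<^sup>2)" by simp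
    then show ?thesis using second_moment[OF u0] by linarith
  qed
  have "(\<integral>\<^sup>+z. ennreal (q z) \<partial>(?D \<Otimes>\<^sub>M ?\<nu>)) = (\<integral>\<^sup>+x. \<integral>\<^sup>+y. ennreal (q (x, y)) \<partial>?\<nu> \<partial>?D)"
    by (subst \<nu>.nn_integral_fst[symmetric]) simp_all
  also have "\<dots> \<le> (\<integral>\<^sup>+x. ennreal G \<partial>?D)"
    using q_inner by (intro nn_integral_mono) simp
  also have "\<dots> = ennreal G" using D.emeasure_space_1 by simp
  finally have q_le: "(\<integral>\<^sup>+z. ennreal (q z) \<partial>(?D \<Otimes>\<^sub>M ?\<nu>)) \<le> ennreal G" .
  have q_nonneg: "0 \<le> q z" for z by (simp add: q_def)
  have q_int: "integrable (?D \<Otimes>\<^sub>M ?\<nu>) q"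
    using q_le q_nonneg by (intro integrableI_bounded) (auto intro: le_less_trans)
  then have "ennreal (integral\<^sup>L (?D \<Otimes>\<^sub>M ?\<nu>) q) \<le> ennreal G"
    using q_le q_nonneg by (simp add: nn_integral_eq_integral)
  then have q_bound: "integral\<^sup>L (?D \<Otimes>\<^sub>M ?\<nu>) q \<le> G" using G by (simp add: ennreal_le_iff)
  have pair[measurable]: "(\<lambda>\<omega>. (past k \<omega>, noise k \<omega>)) \<in> measurable S ?PN" by measurable
  show qS: "integrable S (\<lambda>\<omega>. (hnorm N h (stoch_grad k \<omega>))\<^sup>2)"
    using q_int unfolding q_eq joint by (subst (asm) integrable_distr_eq) simp_all
  show "S.expectation (\<lambda>\<omega>. (hnorm N h (stoch_grad k \<omega>))\<^sup>2) \<le> G"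
    using q_bound unfolding q_eq joint by (subst (asm) integral_distr) simp_all
  show rS: "integrable S (\<lambda>\<omega>. hinner N h (stoch_grad k \<omega>) (\<lambda>n. iter k \<omega> n - ustar n))"
  proof (rule Bochner_Integration.integrable_bound)
    show "integrable S (\<lambda>\<omega>. (hnorm N h (stoch_grad k \<omega>))\<^sup>2 + sq_err k \<omega>)"
      using qS int by (rule Bochner_Integration.integrable_add)
    show "(\<lambda>\<omega>. hinner N h (stoch_grad k \<omega>) (\<lambda>n. iter k \<omega> n - ustar n)) \<in> borel_measurable S"
      unfolding r_eq using measurable_compose[OF pair rm] .
    show "AE \<omega> in S. norm (hinner N h (stoch_grad k \<omega>) (\<lambda>n. iter k \<omega> n - ustar n))
        \<le> norm ((hnorm N h (stoch_grad k \<omega>))\<^sup>2 + sq_err k \<omega>)"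
      using abs_hinner_le[OF h_pos] by (intro AE_I2) simp
  qed
  \<comment> \<open>Integrability was obtained on \<open>S\<close> and returns to the product space
    because the joint law of past and noise is the product measure.\<close>
  have r_int: "integrable (?D \<Otimes>\<^sub>M ?\<nu>) r"
    using rS unfolding r_eq joint by (subst integrable_distr_eq) simp_all
  have r_inner: "\<mu> * e x \<le> (\<integral>y. r (x, y) \<partial>?\<nu>)" if x: "x \<in> space (past_space k)" for x
  proof -
    have [measurable]: "(\<lambda>y. r (x, y)) \<in> borel_measurable noise_space"
      using measurable_compose[OF measurable_Pair1'[OF x] rm] .
    have "(\<integral>y. r (x, y) \<partial>?\<nu>) = (\<integral>\<omega>. r (x, \<lambda>n\<in>{..<N}. \<xi> n \<omega>) \<partial>M)"
      unfolding noise_law using pathm by (subst integral_distr) simp_all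
    also have "\<dots> = expectation (\<lambda>\<omega>. hinner N h (ghat N h P (path \<omega>) (past_iter k x)) (\<lambda>n. past_iter k x n - ustar n))"
      by (simp add: r_def ghat_path)
    finally show ?thesis using coercive[OF past_iter_Udet[of k x]] by (simp add: e_def)
  qed
  have "\<mu> * integral\<^sup>L ?D e = (\<integral>x. \<mu> * e x \<partial>?D)" by simp
  also have "\<dots> \<le> (\<integral>x. \<integral>y. r (x, y) \<partial>?\<nu> \<partial>?D)"
    using eD D\<nu>.integrable_fst'[OF r_int] r_inner by (intro integral_mono) simp_all
  also have "\<dots> = integral\<^sup>L (?D \<Otimes>\<^sub>M ?\<nu>) r" by (rule D\<nu>.integral_fst'[OF r_int])
  finally show "\<mu> * S.expectation (sq_err k)
      \<le> S.expectation (\<lambda>\<omega>. hinner N h (stoch_grad k \<omega>) (\<lambda>n. iter k \<omega> n - ustar n))"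
    unfolding r_eq e_eq joint by (simp add: integral_distr)
qed

section \<open>Recursion for the expected squared error\<close>

lemma sq_err_Suc_le: "sq_err (Suc k) \<omega> \<le> sq_err k \<omega>
    - 2 * step k * hinner N h (stoch_grad k \<omega>) (\<lambda>n. iter k \<omega> n - ustar n)
    + (step k)\<^sup>2 * (hnorm N h (stoch_grad k \<omega>))\<^sup>2"
proof -
  have "sq_err (Suc k) \<omega> \<le> (hnorm N h (\<lambda>n. (iter k \<omega> n - step k *\<^sub>R stoch_grad k \<omega> n) - ustar n))\<^sup>2"
    unfolding iter_Suc by (rule hproj_nonexpansive[OF h_pos closed_U convex_U ustar nonempty_U])
  also have "(\<lambda>n. (iter k \<omega> n - step k *\<^sub>R stoch_grad k \<omega> n) - ustar n)
      = (\<lambda>n. (iter k \<omega> n - ustar n) - step k *\<^sub>R stoch_grad k \<omega> n)"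
    by (simp add: algebra_simps)
  finally show ?thesis unfolding hnorm_diff_scaled_sq[OF h_pos] .
qed

lemma sq_err_measurable: "sq_err k \<in> borel_measurable S"
proof -
  note iter_measurable[measurable]
  show ?thesis unfolding hnorm_sq[OF h_pos] by measurable
qed

text \<open>The induction starts from a deterministic control. Integrability of the current error
  makes both gradient terms integrable, and these dominate the next error.\<close>

lemma sq_err_integrable: "integrable S (sq_err k)"
proof (induction k)
  case 0
  then show ?case by simp
next
  case (Suc k)
  show ?case
  proof (rule Bochner_Integration.integrable_bound)
    show "integrable S (\<lambda>\<omega>. sq_err k \<omega>
        - 2 * step k * hinner N h (stoch_grad k \<omega>) (\<lambda>n. iter k \<omega> n - ustar n)
        + (step k)\<^sup>2 * (hnorm N h (stoch_grad k \<omega>))\<^sup>2)"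
      by (intro Bochner_Integration.integrable_add Bochner_Integration.integrable_diff integrable_mult_right Suc
          stoch_grad_square_integrable stoch_grad_inner_integrable)
    show "AE \<omega> in S. norm (sq_err (Suc k) \<omega>) \<le> norm (sq_err k \<omega>
        - 2 * step k * hinner N h (stoch_grad k \<omega>) (\<lambda>n. iter k \<omega> n - ustar n)
        + (step k)\<^sup>2 * (hnorm N h (stoch_grad k \<omega>))\<^sup>2)"
      using sq_err_Suc_le by (intro AE_I2) (auto simp del: sgd.simps intro: order_trans[OF _ abs_ge_self])
  qed (rule sq_err_measurable)
qed

lemma expected_sq_err_Suc_le:
  "S.expectation (sq_err (Suc k)) \<le> (1 - 2 * \<mu> * step k) * S.expectation (sq_err k) + (step k)\<^sup>2 * G"
proof -
  note int = sq_err_integrable stoch_grad_square_integrable[OF sq_err_integrable]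
    stoch_grad_inner_integrable[OF sq_err_integrable]
  let ?r = "\<lambda>\<omega>. hinner N h (stoch_grad k \<omega>) (\<lambda>n. iter k \<omega> n - ustar n)"
  let ?q = "\<lambda>\<omega>. (hnorm N h (stoch_grad k \<omega>))\<^sup>2"
  have "S.expectation (sq_err (Suc k)) \<le> S.expectation (\<lambda>\<omega>. sq_err k \<omega> - 2 * step k * ?r \<omega> + (step k)\<^sup>2 * ?q \<omega>)"
    by (intro integral_mono sq_err_Suc_le Bochner_Integration.integrable_add Bochner_Integration.integrable_diff
        integrable_mult_right int)
  also have "\<dots> = S.expectation (sq_err k) - 2 * step k * S.expectation ?r + (step k)\<^sup>2 * S.expectation ?q"
    using int by simp
  also have "\<dots> \<le> S.expectation (sq_err k) - 2 * step k * (\<mu> * S.expectation (sq_err k)) + (step k)\<^sup>2 * G"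
    using step_pos[of k] stoch_grad_coercive[OF sq_err_integrable, of k]
      stoch_grad_second_moment[OF sq_err_integrable, of k]
    by (intro add_mono diff_mono mult_left_mono order_refl) simp_all
  finally show ?thesis by (simp add: algebra_simps)
qed

text \<open>Since the expected error is nonnegative and \<open>\<mu> * \<eta>\<close> is at least 1,
  the contraction factor may be enlarged to 1 - 2 / (k + 1), the form required by
  \<open>inverse_rate_recursion\<close>.\<close>

lemma expected_sq_err_rate:
  assumes "\<And>k. step k = \<eta> / real (k + 1)" and "\<mu> * \<eta> \<ge> 1" and "K \<ge> 1"
  shows "S.expectation (sq_err K) \<le> \<eta>\<^sup>2 * G / real K"
proof (rule inverse_rate_recursion)
  have "0 \<le> expectation (\<lambda>\<omega>. (hnorm N h (ghat N h P (path \<omega>) u0))\<^sup>2)" by simp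
  then have "0 \<le> G" using second_moment[OF u0] by linarith
  then show "0 \<le> \<eta>\<^sup>2 * G" by simp
  show nonneg: "0 \<le> S.expectation (sq_err k)" for k by simp
  fix k
  have "2 / (real k + 1) \<le> 2 * (\<mu> * \<eta>) / (real k + 1)"
    using assms(2) by (intro divide_right_mono) simp_all
  then have "2 / (real k + 1) \<le> 2 * \<mu> * step k" by (simp add: assms(1) add.commute mult.assoc)
  then have "(1 - 2 * \<mu> * step k) * S.expectation (sq_err k) \<le> (1 - 2 / (real k + 1)) * S.expectation (sq_err k)"
    using nonneg by (intro mult_right_mono) simp_all
  then show "S.expectation (sq_err (Suc k)) \<le> (1 - 2 / (real k + 1)) * S.expectation (sq_err k)
      + \<eta>\<^sup>2 * G / (real k + 1)\<^sup>2"
    using expected_sq_err_Suc_le[of k] by (simp add: assms(1) power_divide add.commute)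
qed (rule assms(3))

end

text \<open>The maximum includes the empty sum at index 0.\<close>

lemma V_H_nonneg: "N \<ge> 1 \<Longrightarrow> 0 \<le> V_H N \<beta>"
proof -
  assume "N \<ge> 1"
  then have "(\<Sum>k<0. (\<beta> 0 k)\<^sup>2) \<le> V_H N \<beta>"
    unfolding V_H_def by (intro Max_ge finite_imageI imageI finite_lessThan) simp
  then show ?thesis by simp
qed

text \<open>The two constants are quantified before the problem, the noise and the scheme, so they
  are uniform over all data satisfying the assumptions with the given parameters.\<close>

theorem theorem22:
  fixes N :: nat and h H L L' \<mu> L\<^sub>J M\<^sub>2 M\<^sub>4 \<eta>\<^sub>0 R :: real
  assumes "N \<ge> 1" and "h > 0" and "0 < H" and "H < 1"
    and "L > 0" and "L' > 0" and "\<mu> > 0" and "\<eta>\<^sub>0 > 1 / \<mu>"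
  shows "\<exists>C\<^sub>0>0. \<exists>C\<^sub>1>0.
    \<forall>(P :: (real ^ 'd, real ^ 'p) control_problem)
      (M :: 'w measure) (B :: real \<Rightarrow> 'w \<Rightarrow> real) (\<beta> :: nat \<Rightarrow> nat \<Rightarrow> real)
      (S :: 's measure) (Z :: nat \<Rightarrow> nat \<Rightarrow> 's \<Rightarrow> real)
      (u0 :: nat \<Rightarrow> real ^ 'p) (ustar :: nat \<Rightarrow> real ^ 'p).
      prob_space M \<and> complete_measure M \<and> fractional_brownian_motion M H B \<and>
      cholesky_factor N (fgn_cov H) \<beta> \<and>
      closed (control_set P) \<and> convex (control_set P) \<and> 0 \<in> control_set P \<and>
      smooth_problem N L P \<and>
      growth_bounds N L' P \<and>
      strongly_convex_cost N h (control_set P) \<mu> (det_cost N h P M (fgn h H B)) \<and>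
      gradient_bounds N h P M (fgn h H B) (V_H N \<beta>) L\<^sub>J M\<^sub>2 M\<^sub>4 \<and>
      is_arg_min (det_cost N h P M (fgn h H B)) (\<lambda>u. u \<in> Udet N (control_set P)) ustar \<and>
      prob_space S \<and> white_noise S N Z \<and>
      u0 \<in> Udet N (control_set P) \<and> hnorm N h (\<lambda>n. u0 n - ustar n) = R \<longrightarrow>
      (\<forall>K\<ge>1. let err = (\<lambda>\<omega>. (hnorm N h (\<lambda>n.
                  sgd N h P \<beta> Z (\<lambda>k. \<eta>\<^sub>0 / real (k + 1)) u0 K \<omega> n - ustar n))\<^sup>2) in
        integrable S err \<and>
        (\<integral>\<omega>. err \<omega> \<partial>S) \<le>
          C\<^sub>0 * (1 + V_H N \<beta>) / real K + C\<^sub>1 * (1 + V_H N \<beta>) / (real K * h))"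
proof -
  \<comment> \<open>The sum of the two terms is \<open>\<eta>\<^sub>0\<^sup>2\<close> times
    \<open>ghat_bound\<close>. \<open>C0\<close> takes its part proportional to \<open>h\<close>;
    \<open>C1\<close> takes the part free of \<open>h\<close>, multiplied by \<open>h\<close>
    because the claimed bound divides it by \<open>h\<close>.\<close>
  define C0 where "C0 = 3 * \<eta>\<^sub>0\<^sup>2 * L\<^sup>2 * real N * h * (1 + \<bar>M\<^sub>2\<bar>)"
  define C1 where "C1 = 3 * \<eta>\<^sub>0\<^sup>2 * L\<^sup>2 * real N * h * (3 + \<bar>M\<^sub>4\<bar>) / 2"
  have \<eta>: "\<eta>\<^sub>0 > 0" "\<mu> * \<eta>\<^sub>0 \<ge> 1"
    using assms(7,8) less_trans[of 0 "1 / \<mu>" \<eta>\<^sub>0] by (simp_all add: field_simps)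
  have C0: "C0 > 0" and C1: "C1 > 0"
    using assms \<eta> by (simp_all add: C0_def C1_def add_pos_nonneg)
  show ?thesis
  proof (rule exI[of _ C0], rule conjI[OF C0], rule exI[of _ C1], rule conjI[OF C1],
      intro allI impI, elim conjE)
    fix P :: "(real ^ 'd, real ^ 'p) control_problem" and M :: "'w measure" and B \<beta>
      and S :: "'s measure" and Z u0 ustar and K :: nat
    assume "prob_space M" and B: "fractional_brownian_motion M H B" and \<beta>: "cholesky_factor N (fgn_cov H) \<beta>"
      and U: "closed (control_set P)" "convex (control_set P)" "0 \<in> control_set P"
      and P: "smooth_problem N L P" "growth_bounds N L' P"
      and conv: "strongly_convex_cost N h (control_set P) \<mu> (det_cost N h P M (fgn h H B))"
      and bounds: "gradient_bounds N h P M (fgn h H B) (V_H N \<beta>) L\<^sub>J M\<^sub>2 M\<^sub>4"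
      and min: "is_arg_min (det_cost N h P M (fgn h H B)) (\<lambda>u. u \<in> Udet N (control_set P)) ustar"
      and "prob_space S" and Z: "white_noise S N Z" and u0: "u0 \<in> Udet N (control_set P)" and K: "K \<ge> 1"
    interpret M: prob_space M by fact
    interpret S: prob_space S by fact
    interpret fbm_control M H h B N L L' P
      using B P assms by unfold_locales
    let ?V = "V_H N \<beta>"
    interpret sgd_scheme M H h B N L L' P S Z \<beta> "\<lambda>k. \<eta>\<^sub>0 / real (k + 1)" u0 ustar \<mu>
      "ghat_bound M\<^sub>2 M\<^sub>4 * (1 + ?V)"
    proof unfold_locales
      show "ustar \<in> Udet N (control_set P)" using min by (simp add: is_arg_min_def)
      show "\<mu> * (hnorm N h (\<lambda>n. u n - ustar n))\<^sup>2
          \<le> M.expectation (\<lambda>\<omega>. hinner N h (ghat N h P (path \<omega>) u) (\<lambda>n. u n - ustar n))"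
        if "u \<in> Udet N (control_set P)" for u
        by (rule ghat_coercive[OF conv U(2) min that])
      show "integrable M (\<lambda>\<omega>. (hnorm N h (ghat N h P (path \<omega>) u))\<^sup>2) \<and>
          M.expectation (\<lambda>\<omega>. (hnorm N h (ghat N h P (path \<omega>) u))\<^sup>2) \<le> ghat_bound M\<^sub>2 M\<^sub>4 * (1 + ?V)"
        if "u \<in> Udet N (control_set P)" for u
        using ghat_square_integrable[OF bounds V_H_nonneg that] ghat_second_moment[OF bounds V_H_nonneg that]
          assms(1) by simp
    qed (use U \<beta> Z u0 \<eta> assms in simp_all)
    have "\<eta>\<^sub>0\<^sup>2 * (ghat_bound M\<^sub>2 M\<^sub>4 * (1 + ?V)) / real K
        = C0 * (1 + ?V) / real K + C1 * (1 + ?V) / (real K * h)"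
      using assms(2) K by (simp add: ghat_bound_def C0_def C1_def field_simps)
    with expected_sq_err_rate[OF refl \<eta>(2) K] sq_err_integrable[of K]
    show "let err = (\<lambda>\<omega>. (hnorm N h (\<lambda>n.
                  sgd N h P \<beta> Z (\<lambda>k. \<eta>\<^sub>0 / real (k + 1)) u0 K \<omega> n - ustar n))\<^sup>2) in
        integrable S err \<and>
        (\<integral>\<omega>. err \<omega> \<partial>S) \<le> C0 * (1 + ?V) / real K + C1 * (1 + ?V) / (real K * h)"
      by (simp only: Let_def simp_thms)
  qed
qed

end
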